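(* Let $R,\varepsilon>0$ and let $f\in\mathbb{R}[x_1]\setminus\{0\}$ have degree $D$ and at most $3$ monomial terms. Then one can $\varepsilon$-approximate all the roots of $f$ in the closed interval $[0,R]$ using just $O\!\left(\log(D)\log\left(D\log\frac{R}{\varepsilon}\right)\right)$ arithmetic operations. In particular, one can count exactly the number of roots of $f$ in any bounded interval using just $O(\log^2 D)$ arithmetic operations.
   Context: For $I\subseteq\mathbb{R}$ and $f\in\mathbb{R}[x_1]$ whose distinct roots in $I$ are $\zeta_1,\ldots,\zeta_m$, "$\varepsilon$-approximating the roots of $f$ in $I$" means finding real numbers $z_1,\ldots,z_m\in I$ such that for every $i\in\{1,\ldots,m\}$ there is some $j\in\{1,\ldots,m\}$ with $|\zeta_i-z_j|<\varepsilon$ (in particular this yields a correct count of the roots in $I$). The model of computation is the BSS machine over $\mathbb{R}$ (real arithmetic and comparisons allowed); arithmetic operations are counted as field operations in the field generated over $\mathbb{Q}$ by the coefficients of $f$. All $O$-constants are absolute and effectively computable. *)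

theory Defs
  imports Complex_Main "HOL-Computational_Algebra.Polynomial"
begin

section \<open>A BSS machine over the reals (finite register programs)\<close>

datatype aop = Add | Sub | Mul | Div

text \<open>Instructions: arithmetic on registers (dst, src1, src2), loading a rational
constant, conditional branch (if reg >= 0 goto a else goto b), halt.\<close>
datatype instr =
    Arith aop nat nat nat
  | Const rat nat
  | Branch nat nat nat
  | Halt

type_synonym prog = "instr list"
type_synonym state = "nat \<times> (nat \<Rightarrow> real)"

fun apply_op :: "aop \<Rightarrow> real \<Rightarrow> real \<Rightarrow> real" where
  "apply_op Add x y = x + y"
| "apply_op Sub x y = x - y"
| "apply_op Mul x y = x * y"
| "apply_op Div x y = x / y"

definition halted :: "prog \<Rightarrow> state \<Rightarrow> bool" where
  "halted P s = (fst s \<ge> length P \<or> P ! fst s = Halt)"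

fun exec :: "instr \<Rightarrow> state \<Rightarrow> state" where
  "exec (Arith op d i j) (pc, r) = (Suc pc, r(d := apply_op op (r i) (r j)))"
| "exec (Const q d) (pc, r) = (Suc pc, r(d := of_rat q))"
| "exec (Branch i a b) (pc, r) = ((if r i \<ge> 0 then a else b), r)"
| "exec Halt s = s"

fun is_arith :: "instr \<Rightarrow> bool" where
  "is_arith (Arith _ _ _ _) = True"
| "is_arith _ = False"

definition step :: "prog \<Rightarrow> state \<Rightarrow> state \<times> nat" where
  "step P s = (if halted P s then (s, 0)
               else (exec (P ! fst s) s, if is_arith (P ! fst s) then 1 else 0))"

fun run :: "prog \<Rightarrow> nat \<Rightarrow> state \<Rightarrow> state \<times> nat" where
  "run P 0 s = (s, 0)"
| "run P (Suc n) s = (let (s', k) = step P s; (s'', m) = run P n s' in (s'', k + m))"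

definition inp :: "real list \<Rightarrow> nat \<Rightarrow> real" where
  "inp xs i = (if i < length xs then xs ! i else 0)"

definition computes_within :: "prog \<Rightarrow> real list \<Rightarrow> real \<Rightarrow> ((nat \<Rightarrow> real) \<Rightarrow> bool) \<Rightarrow> bool" where
  "computes_within P xs N Q =
     (\<exists>n s k. run P n (0, inp xs) = (s, k) \<and> halted P s \<and> real k \<le> N \<and> Q (snd s))"

definition spoly :: "nat \<Rightarrow> (nat \<Rightarrow> real) \<Rightarrow> (nat \<Rightarrow> nat) \<Rightarrow> real poly" where
  "spoly t c e = (\<Sum>i<t. monom (c i) (e i))"

definition valid_enc :: "nat \<Rightarrow> (nat \<Rightarrow> real) \<Rightarrow> (nat \<Rightarrow> nat) \<Rightarrow> bool" where
  "valid_enc t c e = (1 \<le> t \<and> t \<le> 3 \<and> (\<forall>i<t. c i \<noteq> 0) \<and> (\<forall>i j. i < j \<and> j < t \<longrightarrow> e i < e j))"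

definition enc :: "nat \<Rightarrow> (nat \<Rightarrow> real) \<Rightarrow> (nat \<Rightarrow> nat) \<Rightarrow> real list" where
  "enc t c e = [real t, c 0, c 1, c 2, real (e 0), real (e 1), real (e 2)]"

text \<open>Output convention: register 0 holds m, registers 1..m hold z_1..z_m.
This is the paper's notion of epsilon-approximating the roots of f in I.\<close>
definition eps_approx_out :: "real poly \<Rightarrow> real set \<Rightarrow> real \<Rightarrow> (nat \<Rightarrow> real) \<Rightarrow> bool" where
  "eps_approx_out f I \<epsilon> r =
     (let Z = {x \<in> I. poly f x = 0} in
        r 0 = real (card Z) \<and>
        (\<forall>j < card Z. r (Suc j) \<in> I) \<and>
        (\<forall>\<zeta>\<in>Z. \<exists>j < card Z. \<bar>\<zeta> - r (Suc j)\<bar> < \<epsilon>))"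

definition bint :: "real \<Rightarrow> real \<Rightarrow> bool \<Rightarrow> bool \<Rightarrow> real set" where
  "bint a b la rb = {x. (if la then a \<le> x else a < x) \<and> (if rb then x \<le> b else x < b)}"

definition of_bool_real :: "bool \<Rightarrow> real" where
  "of_bool_real p = (if p then 1 else 0)"

end

theory Submission
  imports Defs "HOL-Number_Theory.Fib"
begin

text \<open>
  After division by a power of \<open>x\<close>, a polynomial with at most three terms is, on the positive
  half-line, \<open>g(x) = A0 + A1 x^p + A2 x^q\<close> with \<open>A2 > 0\<close>, and \<open>x g'(x) = x^p (p A1 + q A2 x^(q-p))\<close>
  changes sign at most once, at the critical point \<open>m = (- p A1 / (q A2))^(1/(q-p))\<close>. The roots in
  \<open>(0, x]\<close> are therefore counted by the signs of \<open>g(x)\<close>, \<open>g'(x)\<close> and \<open>g(m)\<close>; the last one is a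
  comparison of two integer powers, so counting takes \<open>O(log D)\<close> operations.

  Once a point \<open>L \<ge> m\<close> with \<open>g(L) < 0\<close> is known, \<open>g\<close> is increasing and convex beyond \<open>L\<close>. For the root
  \<open>z = L (1 + s)\<close> one has \<open>0 \<le> x g''(x) \<le> (q + 1/s) g'(x)\<close> when \<open>x \<ge> z\<close>, so Newton's method started at
  \<open>L (1 + t)\<close> with \<open>s \<le> t \<le> s (1 + 1/q)\<close> converges quadratically from the first step on, however close
  \<open>z\<close> is to a double root. Such a \<open>t\<close> is found on the grid \<open>\<delta> (1 + 1/q)^i\<close> by a search with
  \<open>O(log (D log (R/\<epsilon>)))\<close> evaluations. The point \<open>L\<close> is obtained in the same way, as an approximation from
  above to the root \<open>m\<close> of a binomial; if it overshoots \<open>z\<close>, it is itself a good approximation to \<open>z\<close>.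
  Roots to the left of \<open>m\<close> become roots of the right kind under \<open>x \<mapsto> R/x\<close>.
\<close>

section \<open>Structured programs and their compilation\<close>

text \<open>The cost bound knows only D and R/\<epsilon>, whereas two roots can be arbitrarily
  close, so no phase may depend on root separation; an initial linear phase of Newton's method
  would. Near a double root both z - L and g'(z) are small, hence no window of fixed relative size
  about z guarantees quadratic convergence. Since the loss is 1/s, the safe window is proportional
  to z - L: the grid must be geometric in x/L - 1, not in x. Its ratio 1 + 1/q is what makes the
  error, multiplied by Newton's constant, at most 1/2 at the start. Only offsets between \<delta>
  and 1/\<delta> matter: below, L (1 + \<delta>) is already accurate; above, a root lies outside the
  scaled interval or, inverted, is smaller than the tolerance. That leaves O(q log(1/\<delta>)) grid
  points and a search logarithmic in their number, each probe costing O(log D) by repeated squaring.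
  The machine has neither indirect addressing nor root extraction, so the search can keep no list of
  step sizes and must regenerate them by division.\<close>

datatype ex = V nat | K rat | Bin aop ex ex

abbreviation add_ex (infixl "+:" 65) where "a +: b \<equiv> Bin Add a b"
abbreviation sub_ex (infixl "-:" 65) where "a -: b \<equiv> Bin Sub a b"
abbreviation mul_ex (infixl "*:" 70) where "a *: b \<equiv> Bin Mul a b"
abbreviation div_ex (infixl "'/:" 70) where "a /: b \<equiv> Bin Div a b"

datatype com =
    Asg nat ex (infix "<-" 60)
  | Seq com com (infixr ";;" 58)
  | If ex com com
  | While ex com

fun ev :: "ex \<Rightarrow> (nat \<Rightarrow> real) \<Rightarrow> real" where
  "ev (V i) r = r i"
| "ev (K c) r = of_rat c"
| "ev (Bin f a b) r = apply_op f (ev a r) (ev b r)"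

text \<open>Reading a register costs one operation because the machine has no move instruction: a
  copy is compiled to an addition of zero. Loading a constant is free.\<close>

fun ecost :: "ex \<Rightarrow> nat" where
  "ecost (V i) = 1"
| "ecost (K c) = 0"
| "ecost (Bin f a b) = Suc (ecost a + ecost b)"

text \<open>The last index is the exact number of arithmetic instructions of the compiled code.
  Branches are free, so a test costs only the evaluation of its expression; the additional one in an
  assignment pays for the move out of register \<open>T\<close>.\<close>

inductive big :: "com \<Rightarrow> (nat \<Rightarrow> real) \<Rightarrow> (nat \<Rightarrow> real) \<Rightarrow> nat \<Rightarrow> bool" where
  Asg: "big (d <- e) r (r(d := ev e r)) (Suc (ecost e))"
| Seq: "big a r r1 k1 \<Longrightarrow> big b r1 r2 k2 \<Longrightarrow> big (a ;; b) r r2 (k1 + k2)"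
| IfT: "ev e r \<ge> 0 \<Longrightarrow> big a r r1 k1 \<Longrightarrow> big (If e a b) r r1 (ecost e + k1)"
| IfF: "ev e r < 0 \<Longrightarrow> big b r r1 k1 \<Longrightarrow> big (If e a b) r r1 (ecost e + k1)"
| WhileT: "ev e r \<ge> 0 \<Longrightarrow> big a r r1 k1 \<Longrightarrow> big (While e a) r1 r2 k2 \<Longrightarrow>
    big (While e a) r r2 (ecost e + k1 + k2)"
| WhileF: "ev e r < 0 \<Longrightarrow> big (While e a) r r (ecost e)"

inductive_cases big_AsgE: "big (d <- e) r r' k"
inductive_cases big_SeqE: "big (a ;; b) r r' k"
inductive_cases big_IfE: "big (If e a b) r r' k"

text \<open>Registers from \<open>T\<close> upwards hold intermediate values of expressions.\<close>

definition T :: nat where "T = 200"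

fun evars :: "ex \<Rightarrow> bool" where
  "evars (V i) \<longleftrightarrow> i < T"
| "evars (K c) \<longleftrightarrow> True"
| "evars (Bin f a b) \<longleftrightarrow> evars a \<and> evars b"

fun cvars :: "com \<Rightarrow> bool" where
  "cvars (d <- e) \<longleftrightarrow> d < T \<and> evars e"
| "cvars (a ;; b) \<longleftrightarrow> cvars a \<and> cvars b"
| "cvars (If e a b) \<longleftrightarrow> evars e \<and> cvars a \<and> cvars b"
| "cvars (While e a) \<longleftrightarrow> evars e \<and> cvars a"

text \<open>The depth of the evaluation stack is known at compile time, so the index
  \<open>t\<close> acts as stack pointer and no indirect addressing is required.\<close>

fun cex :: "ex \<Rightarrow> nat \<Rightarrow> instr list" where
  "cex (V i) t = [Const 0 t, Arith Add t i t]"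
| "cex (K c) t = [Const c t]"
| "cex (Bin f a b) t = cex a t @ cex b (Suc t) @ [Arith f t t (Suc t)]"

fun clen :: "com \<Rightarrow> nat" where
  "clen (d <- e) = length (cex e T) + 2"
| "clen (a ;; b) = clen a + clen b"
| "clen (If e a b) = length (cex e T) + clen a + clen b + 2"
| "clen (While e a) = length (cex e T) + clen a + 2"

text \<open>Branch targets are absolute, hence the parameter \<open>pc\<close>, while
  \<open>clen\<close> gives lengths independently of the position. A \<open>Branch\<close> with two
  equal targets is an unconditional jump.\<close>

fun cc :: "com \<Rightarrow> nat \<Rightarrow> instr list" where
  "cc (d <- e) pc = cex e T @ [Const 0 (Suc T), Arith Add d T (Suc T)]"
| "cc (a ;; b) pc = cc a pc @ cc b (pc + clen a)"
| "cc (If e a b) pc =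
    (let pa = pc + length (cex e T) + 1; pb = pa + clen a + 1; pend = pb + clen b in
      cex e T @ [Branch T pa pb] @ cc a pa @ [Branch T pend pend] @ cc b pb)"
| "cc (While e a) pc =
    (let pa = pc + length (cex e T) + 1 in
      cex e T @ [Branch T pa (pa + clen a + 1)] @ cc a pa @ [Branch T pc pc])"

lemma length_cc [simp]: "length (cc c pc) = clen c"
  by (induction c arbitrary: pc) (auto simp: Let_def)

definition reach :: "prog \<Rightarrow> state \<Rightarrow> state \<Rightarrow> nat \<Rightarrow> bool" where
  "reach P s s' k \<longleftrightarrow> (\<exists>n. run P n s = (s', k))"

lemma run_add:
  "run P m s = (s1, k1) \<Longrightarrow> run P n s1 = (s2, k2) \<Longrightarrow> run P (m + n) s = (s2, k1 + k2)"
  by (induction m arbitrary: s k1) (auto split: prod.splits)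

lemma reach_trans: "reach P s s1 k1 \<Longrightarrow> reach P s1 s2 k2 \<Longrightarrow> reach P s s2 (k1 + k2)"
  unfolding reach_def using run_add by blast

lemma reach_step:
  assumes "pc < length P" "P ! pc \<noteq> Halt"
  shows "reach P (pc, r) (exec (P ! pc) (pc, r)) (if is_arith (P ! pc) then 1 else 0)"
  unfolding reach_def
  by (rule exI[of _ 1]) (use assms in \<open>simp add: step_def halted_def\<close>)

definition code_at :: "prog \<Rightarrow> nat \<Rightarrow> instr list \<Rightarrow> bool" where
  "code_at P pc is \<longleftrightarrow> (\<exists>us vs. P = us @ is @ vs \<and> length us = pc)"

lemma code_at_append [simp]:
  "code_at P pc (is @ js) \<longleftrightarrow> code_at P pc is \<and> code_at P (pc + length is) js"
proof
  assume "code_at P pc (is @ js)"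
  then obtain us vs where "P = us @ is @ js @ vs" "length us = pc"
    by (auto simp: code_at_def)
  then show "code_at P pc is \<and> code_at P (pc + length is) js"
    unfolding code_at_def
    by (intro conjI exI[of _ us] exI[of _ "js @ vs"] exI[of _ "us @ is"] exI[of _ vs]) auto
next
  assume "code_at P pc is \<and> code_at P (pc + length is) js"
  then obtain us vs us' vs' where 1: "P = us @ is @ vs" "length us = pc"
    "P = us' @ js @ vs'" "length us' = pc + length is"
    unfolding code_at_def by metis
  then have "(us @ is) @ vs = us' @ (js @ vs')" by simp
  then have "vs = js @ vs'" by (rule append_eq_append_conv[THEN iffD1, THEN conjunct2, rotated]) (use 1 in simp)
  then show "code_at P pc (is @ js)" using 1 by (auto simp: code_at_def)
qed

lemma code_at_Cons:
  "code_at P pc (i # is) \<longleftrightarrow> pc < length P \<and> P ! pc = i \<and> code_at P (Suc pc) is"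
proof -
  have "code_at P pc [i] \<longleftrightarrow> pc < length P \<and> P ! pc = i"
  proof
    assume "pc < length P \<and> P ! pc = i"
    then have "P = take pc P @ [i] @ drop (Suc pc) P" "length (take pc P) = pc"
      by (auto simp: id_take_nth_drop)
    then show "code_at P pc [i]" unfolding code_at_def by blast
  qed (auto simp: code_at_def nth_append)
  then show ?thesis using code_at_append[of P pc "[i]" "is"] by simp
qed

lemma ev_cong: "evars e \<Longrightarrow> (\<And>i. i < T \<Longrightarrow> r i = s i) \<Longrightarrow> ev e r = ev e s"
  by (induction e) auto

lemma cex_correct:
  assumes "code_at P pc (cex e t)" "evars e" "T \<le> t"
  shows "\<exists>s'. reach P (pc, s) (pc + length (cex e t), s') (ecost e) \<and>
    s' t = ev e s \<and> (\<forall>i<t. s' i = s i)"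
  using assms
proof (induction e arbitrary: t pc s)
  case (V i)
  then have *: "pc < length P" "P ! pc = Const 0 t" "Suc pc < length P" "P ! Suc pc = Arith Add t i t"
    by (auto simp: code_at_Cons)
  have "reach P (pc, s) (Suc pc, s(t := 0)) 0"
    using reach_step[of pc P s] * by simp
  moreover have "reach P (Suc pc, s(t := 0)) (Suc (Suc pc), s(t := s i)) 1"
    using reach_step[of "Suc pc" P "s(t := 0)"] * V by (simp split: if_splits)
  ultimately have "reach P (pc, s) (Suc (Suc pc), s(t := s i)) 1"
    using reach_trans by fastforce
  then show ?case by (intro exI[of _ "s(t := s i)"]) (simp add: fun_upd_def)
next
  case (K c)
  then have *: "pc < length P" "P ! pc = Const c t" by (auto simp: code_at_Cons)
  then have "reach P (pc, s) (Suc pc, s(t := of_rat c)) 0"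
    using reach_step[of pc P s] by simp
  then show ?case by (intro exI[of _ "s(t := of_rat c)"]) (simp add: fun_upd_def)
next
  case (Bin f a b)
  let ?la = "length (cex a t)" and ?lb = "length (cex b (Suc t))"
  from Bin.prems Bin.IH(1)[of pc t s] obtain s1
    where s1: "reach P (pc, s) (pc + ?la, s1) (ecost a)" "s1 t = ev a s" "\<forall>i<t. s1 i = s i"
    by auto
  from Bin.prems Bin.IH(2)[of "pc + ?la" "Suc t" s1] obtain s2
    where s2: "reach P (pc + ?la, s1) (pc + ?la + ?lb, s2) (ecost b)"
      "s2 (Suc t) = ev b s1" "\<forall>i<Suc t. s2 i = s1 i"
    by auto
  have *: "pc + ?la + ?lb < length P" "P ! (pc + ?la + ?lb) = Arith f t t (Suc t)"
    using Bin.prems by (auto simp: code_at_Cons add.assoc)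
  have b: "ev b s1 = ev b s" using ev_cong[of b s1 s] s1 Bin.prems by auto
  let ?s3 = "s2(t := apply_op f (ev a s) (ev b s))"
  have "reach P (pc + ?la + ?lb, s2) (Suc (pc + ?la + ?lb), ?s3) 1"
    using reach_step[of "pc + ?la + ?lb" P s2] * s1 s2 b by simp
  from reach_trans[OF reach_trans[OF s1(1) s2(1)] this]
  have "reach P (pc, s) (Suc (pc + ?la + ?lb), ?s3) (ecost a + ecost b + 1)" .
  then show ?case using s1 s2 by (intro exI[of _ ?s3]) (simp add: fun_upd_def add.assoc)
qed

text \<open>Source and machine states are related only below \<open>T\<close>: the scratch registers
  change freely, and by \<open>cvars\<close> no source expression can see them. The cost carries
  over unchanged because every inserted jump and constant is free.\<close>

lemma cc_correct:
  assumes "big c r r' k" "code_at P pc (cc c pc)" "cvars c" "\<forall>i<T. s i = r i"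
  shows "\<exists>s'. reach P (pc, s) (pc + clen c, s') k \<and> (\<forall>i<T. s' i = r' i)"
  using assms
proof (induction arbitrary: pc s rule: big.induct)
  case (Asg d e r)
  let ?l = "length (cex e T)"
  obtain s1 where s1: "reach P (pc, s) (pc + ?l, s1) (ecost e)" "s1 T = ev e s" "\<forall>i<T. s1 i = s i"
    using cex_correct[of P pc e T s] Asg by auto
  have e: "ev e s = ev e r" using ev_cong[of e s r] Asg by auto
  have *: "pc + ?l < length P" "P ! (pc + ?l) = Const 0 (Suc T)"
    "Suc (pc + ?l) < length P" "P ! Suc (pc + ?l) = Arith Add d T (Suc T)"
    using Asg by (auto simp: code_at_Cons)
  have "reach P (pc + ?l, s1) (Suc (pc + ?l), s1(Suc T := 0)) 0"
    using reach_step[of "pc + ?l" P s1] * by simp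
  moreover have "reach P (Suc (pc + ?l), s1(Suc T := 0))
      (Suc (Suc (pc + ?l)), s1(Suc T := 0, d := ev e r)) 1"
    using reach_step[of "Suc (pc + ?l)" P "s1(Suc T := 0)"] * s1 e by simp
  ultimately have "reach P (pc, s) (Suc (Suc (pc + ?l)), s1(Suc T := 0, d := ev e r)) (ecost e + (0 + 1))"
    by (intro reach_trans[OF s1(1)] reach_trans)
  then show ?case using s1 Asg.prems
    by (intro exI[of _ "s1(Suc T := 0, d := ev e r)"]) (simp add: fun_upd_def)
next
  case (Seq a r r1 k1 b r2 k2)
  from Seq.prems Seq.IH(1)[of pc s] obtain s1
    where s1: "reach P (pc, s) (pc + clen a, s1) k1" "\<forall>i<T. s1 i = r1 i" by auto
  from Seq.prems Seq.IH(2)[of "pc + clen a" s1] s1 obtain s2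
    where s2: "reach P (pc + clen a, s1) (pc + clen a + clen b, s2) k2" "\<forall>i<T. s2 i = r2 i" by auto
  show ?case using reach_trans[OF s1(1) s2(1)] s2(2)
    by (intro exI[of _ s2]) (simp add: add.assoc)
next
  case (IfT e r a r1 k1 b)
  let ?l = "length (cex e T)"
  let ?pa = "pc + ?l + 1" and ?pb = "pc + ?l + 1 + clen a + 1"
  obtain s1 where s1: "reach P (pc, s) (pc + ?l, s1) (ecost e)" "s1 T = ev e s" "\<forall>i<T. s1 i = s i"
    using cex_correct[of P pc e T s] IfT by (auto simp: Let_def)
  have e: "ev e s = ev e r" using ev_cong[of e s r] IfT by auto
  have *: "pc + ?l < length P" "P ! (pc + ?l) = Branch T ?pa ?pb"
    "code_at P ?pa (cc a ?pa)"
    "?pa + clen a < length P" "P ! (?pa + clen a) = Branch T (?pb + clen b) (?pb + clen b)"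
    using IfT.prems by (auto simp: code_at_Cons Let_def add_ac)
  have 1: "reach P (pc + ?l, s1) (?pa, s1) 0"
    using reach_step[of "pc + ?l" P s1] * s1 e IfT.hyps by simp
  obtain s2 where s2: "reach P (?pa, s1) (?pa + clen a, s2) k1" "\<forall>i<T. s2 i = r1 i"
    using IfT.IH[OF *(3), of s1] IfT.prems s1 by auto
  have "reach P (?pa + clen a, s2) (?pb + clen b, s2) 0"
    using reach_step[of "?pa + clen a" P s2] * by simp
  from this s1 s2 1 have "reach P (pc, s) (?pb + clen b, s2) (ecost e + (0 + (k1 + 0)))"
    by (intro reach_trans)
  then show ?case using s2 by (intro exI[of _ s2]) (auto simp: add_ac)
next
  case (IfF e r b r1 k1 a)
  let ?l = "length (cex e T)"
  let ?pa = "pc + ?l + 1" and ?pb = "pc + ?l + 1 + clen a + 1"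
  obtain s1 where s1: "reach P (pc, s) (pc + ?l, s1) (ecost e)" "s1 T = ev e s" "\<forall>i<T. s1 i = s i"
    using cex_correct[of P pc e T s] IfF by (auto simp: Let_def)
  have e: "ev e s = ev e r" using ev_cong[of e s r] IfF by auto
  have *: "pc + ?l < length P" "P ! (pc + ?l) = Branch T ?pa ?pb"
    "code_at P ?pb (cc b ?pb)"
    using IfF.prems by (auto simp: code_at_Cons Let_def add_ac)
  have 1: "reach P (pc + ?l, s1) (?pb, s1) 0"
    using reach_step[of "pc + ?l" P s1] * s1 e IfF.hyps by simp
  obtain s2 where s2: "reach P (?pb, s1) (?pb + clen b, s2) k1" "\<forall>i<T. s2 i = r1 i"
    using IfF.IH[OF *(3), of s1] IfF.prems s1 by auto
  from this s1 s2 1 have "reach P (pc, s) (?pb + clen b, s2) (ecost e + (0 + k1))"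
    by (intro reach_trans)
  then show ?case using s2 by (intro exI[of _ s2]) (auto simp: add_ac)
next
  case (WhileT e r a r1 k1 r2 k2)
  let ?l = "length (cex e T)"
  let ?pa = "pc + ?l + 1"
  obtain s1 where s1: "reach P (pc, s) (pc + ?l, s1) (ecost e)" "s1 T = ev e s" "\<forall>i<T. s1 i = s i"
    using cex_correct[of P pc e T s] WhileT by (auto simp: Let_def)
  have e: "ev e s = ev e r" using ev_cong[of e s r] WhileT by auto
  have *: "pc + ?l < length P" "P ! (pc + ?l) = Branch T ?pa (?pa + clen a + 1)"
    "code_at P ?pa (cc a ?pa)"
    "?pa + clen a < length P" "P ! (?pa + clen a) = Branch T pc pc"
    using WhileT.prems by (auto simp: code_at_Cons Let_def add_ac)
  have 1: "reach P (pc + ?l, s1) (?pa, s1) 0"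
    using reach_step[of "pc + ?l" P s1] * s1 e WhileT.hyps by simp
  obtain s2 where s2: "reach P (?pa, s1) (?pa + clen a, s2) k1" "\<forall>i<T. s2 i = r1 i"
    using WhileT.IH(1)[OF *(3), of s1] WhileT.prems s1 by auto
  have 2: "reach P (?pa + clen a, s2) (pc, s2) 0"
    using reach_step[of "?pa + clen a" P s2] * by simp
  obtain s3 where s3: "reach P (pc, s2) (pc + clen (While e a), s3) k2" "\<forall>i<T. s3 i = r2 i"
    using WhileT.IH(2)[OF WhileT.prems(1), of s2] WhileT.prems s2 by auto
  have "reach P (pc, s) (pc + clen (While e a), s3) (ecost e + (0 + (k1 + (0 + k2))))"
    using s1 s2 s3 1 2 by (intro reach_trans)
  then show ?case using s3 by (intro exI[of _ s3]) (simp add: add.assoc)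
next
  case (WhileF e r a)
  let ?l = "length (cex e T)"
  let ?pa = "pc + ?l + 1"
  obtain s1 where s1: "reach P (pc, s) (pc + ?l, s1) (ecost e)" "s1 T = ev e s" "\<forall>i<T. s1 i = s i"
    using cex_correct[of P pc e T s] WhileF by (auto simp: Let_def)
  have e: "ev e s = ev e r" using ev_cong[of e s r] WhileF by auto
  have *: "pc + ?l < length P" "P ! (pc + ?l) = Branch T ?pa (?pa + clen a + 1)"
    using WhileF.prems by (auto simp: code_at_Cons Let_def add_ac)
  have 1: "reach P (pc + ?l, s1) (?pa + clen a + 1, s1) 0"
    using reach_step[of "pc + ?l" P s1] * s1 e WhileF.hyps by simp
  have "reach P (pc, s) (?pa + clen a + 1, s1) (ecost e + 0)"
    using s1 1 by (intro reach_trans)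
  then show ?case using s1 WhileF.prems by (intro exI[of _ s1]) (auto simp: add_ac)
qed

section \<open>Weakest preconditions with cost\<close>

text \<open>The cost is threaded as an accumulator, so that the rules below rewrite straight-line code.\<close>

definition wpc :: "com \<Rightarrow> ((nat \<Rightarrow> real) \<Rightarrow> nat \<Rightarrow> bool) \<Rightarrow> (nat \<Rightarrow> real) \<Rightarrow> nat \<Rightarrow> bool" where
  "wpc c Q r k \<longleftrightarrow> (\<exists>r' k'. big c r r' k' \<and> Q r' (k + k'))"

lemma wpc_Asg [simp]: "wpc (d <- e) Q r k \<longleftrightarrow> Q (r(d := ev e r)) (k + Suc (ecost e))"
  unfolding wpc_def by (blast intro: big.Asg elim: big_AsgE)

lemma wpc_Seq [simp]: "wpc (a ;; b) Q r k \<longleftrightarrow> wpc a (wpc b Q) r k"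
  unfolding wpc_def by (fastforce intro: big.Seq elim: big_SeqE simp: add.assoc)

lemma wpc_If [simp]:
  "wpc (If e a b) Q r k \<longleftrightarrow> (if ev e r \<ge> 0 then wpc a Q r (k + ecost e) else wpc b Q r (k + ecost e))"
proof (cases "ev e r \<ge> 0")
  case True
  then have "big (If e a b) r r' k' \<longleftrightarrow> (\<exists>k1. k' = ecost e + k1 \<and> big a r r' k1)" for r' k'
    by (auto intro: big.IfT elim: big_IfE)
  with True show ?thesis unfolding wpc_def by (auto simp: add.assoc)
next
  case False
  then have "big (If e a b) r r' k' \<longleftrightarrow> (\<exists>k1. k' = ecost e + k1 \<and> big b r r' k1)" for r' k'
    by (auto intro: big.IfF elim: big_IfE)
  with False show ?thesis unfolding wpc_def by (auto simp: add.assoc)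
qed

definition spec :: "com \<Rightarrow> (nat \<Rightarrow> real) \<Rightarrow> nat \<Rightarrow> ((nat \<Rightarrow> real) \<Rightarrow> bool) \<Rightarrow> bool" where
  "spec c r N Q \<longleftrightarrow> wpc c (\<lambda>r' k. k \<le> N \<and> Q r') r 0"

lemma spec_iff: "spec c r N Q \<longleftrightarrow> (\<exists>r' k. big c r r' k \<and> k \<le> N \<and> Q r')"
  by (simp add: spec_def wpc_def)

text \<open>Replaces a called program by its specification. Only an upper bound on its cost
  survives, so the continuation has to hold for every counter up to that bound.\<close>

lemma wpc_call:
  assumes "spec c r N Q" "\<And>r' k'. k' \<le> k + N \<Longrightarrow> Q r' \<Longrightarrow> R r' k'"
  shows "wpc c R r k"
proof -
  from assms(1) obtain r' k' where "big c r r' k'" "k' \<le> N" "Q r'" by (auto simp: spec_iff)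
  then show ?thesis unfolding wpc_def using assms(2)[of "k + k'" r'] by auto
qed

lemma spec_mono:
  "spec c r N Q \<Longrightarrow> N \<le> N' \<Longrightarrow> (\<And>r'. Q r' \<Longrightarrow> Q' r') \<Longrightarrow> spec c r N' Q'"
  unfolding spec_iff by (meson order_trans)

text \<open>The index of the invariant is a ranking value that also bounds the number of rounds, so
  termination and cost come from the same induction; the last summand is the failing test.\<close>

lemma spec_While:
  assumes "I n r"
    and "\<And>n r. I n r \<Longrightarrow> ev e r \<ge> 0 \<Longrightarrow> \<exists>m<n. spec a r N (I m)"
  shows "spec (While e a) r (n * (N + ecost e) + ecost e) (\<lambda>r'. (\<exists>m. I m r') \<and> ev e r' < 0)"
  using assms(1)
proof (induction n arbitrary: r rule: less_induct)
  case (less n)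
  show ?case
  proof (cases "ev e r \<ge> 0")
    case True
    from assms(2)[OF less.prems True] obtain m r1 k1
      where 1: "m < n" "big a r r1 k1" "k1 \<le> N" "I m r1"
      by (auto simp: spec_iff)
    from less.IH[OF 1(1,4)] obtain r2 k2 where 2: "big (While e a) r1 r2 k2"
      "k2 \<le> m * (N + ecost e) + ecost e" "(\<exists>m. I m r2) \<and> ev e r2 < 0"
      by (auto simp: spec_iff)
    have "Suc m * (N + ecost e) \<le> n * (N + ecost e)" using 1 by (intro mult_right_mono) auto
    then have "ecost e + k1 + k2 \<le> n * (N + ecost e) + ecost e" using 1 2 by simp
    then show ?thesis unfolding spec_iff using big.WhileT[OF True 1(2) 2(1)] 2(3) by blast
  next
    case False
    then have "ev e r < 0" by simp
    with big.WhileF[OF this] less.prems show ?thesis unfolding spec_iff by (meson le_add2)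
  qed
qed

text \<open>No \<open>Halt\<close> is emitted: the machine stops because control arrives just behind
  the last instruction.\<close>

lemma computes_within_cc:
  assumes "spec c (inp xs) N Q" "cvars c" "real N \<le> M"
    and "\<And>r s. Q r \<Longrightarrow> (\<forall>i<T. s i = r i) \<Longrightarrow> Q' s"
  shows "computes_within (cc c 0) xs M Q'"
proof -
  obtain r k where 1: "big c (inp xs) r k" "k \<le> N" "Q r"
    using assms(1) by (auto simp: spec_iff)
  have "code_at (cc c 0) 0 (cc c 0)" unfolding code_at_def by (intro exI[of _ "[]"]) auto
  from cc_correct[OF 1(1) this assms(2), of "inp xs"] obtain s
    where s: "reach (cc c 0) (0, inp xs) (clen c, s) k" "\<forall>i<T. s i = r i" by auto
  have "halted (cc c 0) (clen c, s)" by (simp add: halted_def)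
  moreover obtain n where "run (cc c 0) n (0, inp xs) = ((clen c, s), k)"
    using s by (auto simp: reach_def)
  moreover have "real k \<le> M" using 1 assms(3) by linarith
  ultimately show ?thesis unfolding computes_within_def
    using assms(4)[OF 1(3) s(2)] by (metis snd_conv)
qed

section \<open>Trinomials on the positive half-line\<close>

definition tri :: "real \<Rightarrow> real \<Rightarrow> real \<Rightarrow> nat \<Rightarrow> nat \<Rightarrow> real \<Rightarrow> real" where
  "tri A0 A1 A2 p q x = A0 + A1 * x ^ p + A2 * x ^ q"

text \<open>The Euler operator \<open>x d/dx\<close> applied to \<^const>\<open>tri\<close>, once and twice.\<close>

definition etri :: "real \<Rightarrow> real \<Rightarrow> nat \<Rightarrow> nat \<Rightarrow> real \<Rightarrow> real" where
  "etri A1 A2 p q x = real p * A1 * x ^ p + real q * A2 * x ^ q"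

definition eetri :: "real \<Rightarrow> real \<Rightarrow> nat \<Rightarrow> nat \<Rightarrow> real \<Rightarrow> real" where
  "eetri A1 A2 p q x = real p ^ 2 * A1 * x ^ p + real q ^ 2 * A2 * x ^ q"

text \<open>Up to a positive factor, this is the derivative of \<^const>\<open>tri\<close>.\<close>

definition slope :: "real \<Rightarrow> real \<Rightarrow> nat \<Rightarrow> nat \<Rightarrow> real \<Rightarrow> real" where
  "slope A1 A2 p q x = real p * A1 + real q * A2 * x ^ (q - p)"

text \<open>The degenerate case \<open>p = q\<close> admits binomials. It is needed not only for
  binomial input: the slope of a trinomial is itself of this form, so the same root finder can
  locate the critical point.\<close>

definition nrm :: "real \<Rightarrow> real \<Rightarrow> nat \<Rightarrow> nat \<Rightarrow> bool" where
  "nrm A1 A2 p q \<longleftrightarrow> A2 > 0 \<and> 0 < p \<and> (p < q \<or> p = q \<and> A1 = 0)"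

lemma nrm_le: "nrm A1 A2 p q \<Longrightarrow> p \<le> q" "nrm A1 A2 p q \<Longrightarrow> 0 < q"
  by (auto simp: nrm_def)

lemma tri_0: "nrm A1 A2 p q \<Longrightarrow> tri A0 A1 A2 p q 0 = A0"
  by (auto simp: tri_def nrm_def zero_power)

lemma etri_eq: "p \<le> q \<Longrightarrow> etri A1 A2 p q x = x ^ p * slope A1 A2 p q x"
  by (simp add: etri_def slope_def algebra_simps flip: power_add)

lemma eetri_eq:
  assumes "p \<le> q"
  shows "eetri A1 A2 p q x = x ^ p * (real p * slope A1 A2 p q x + real q * real (q - p) * A2 * x ^ (q - p))"
proof -
  have "x ^ q = x ^ p * x ^ (q - p)" using assms by (simp flip: power_add)
  then show ?thesis using assms
    by (simp add: eetri_def slope_def algebra_simps power2_eq_square of_nat_diff)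
qed

text \<open>For \<open>p < q\<close> the slope is strictly increasing; for \<open>p = q\<close> it
  is the positive constant \<open>q * A2\<close>. Both cases share the sign statement, though not
  the growth.\<close>

lemma slope_strict_mono:
  assumes "nrm A1 A2 p q" "0 < x" "x < y" "slope A1 A2 p q x \<ge> 0"
  shows "slope A1 A2 p q y > 0"
proof (cases "p < q")
  case True
  then have "x ^ (q - p) < y ^ (q - p)" using assms by (intro power_strict_mono) auto
  then have "real q * A2 * x ^ (q - p) < real q * A2 * y ^ (q - p)"
    using assms by (intro mult_strict_left_mono) (auto simp: nrm_def)
  then show ?thesis using assms by (simp add: slope_def)
next
  case False
  then show ?thesis using assms by (auto simp: nrm_def slope_def)
qed

lemma slope_mono:
  "nrm A1 A2 p q \<Longrightarrow> 0 < x \<Longrightarrow> x \<le> y \<Longrightarrow> slope A1 A2 p q x \<ge> 0 \<Longrightarrow> slope A1 A2 p q y \<ge> 0"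
  using slope_strict_mono[of A1 A2 p q x y] by (cases "x = y") auto

text \<open>Dividing by \<open>x\<close> avoids the truncated exponent \<open>n - 1\<close> and
  expresses every derivative through the Euler operator.\<close>

lemma DERIV_pow_Euler:
  fixes x :: real
  assumes "x \<noteq> 0"
  shows "((\<lambda>x. c * x ^ n) has_real_derivative (real n * c * x ^ n) / x) (at x)"
  by (rule derivative_eq_intros refl)+ (use assms in \<open>cases n; simp\<close>)

lemma DERIV_tri: "x \<noteq> 0 \<Longrightarrow> (tri A0 A1 A2 p q has_real_derivative etri A1 A2 p q x / x) (at x)"
  unfolding tri_def etri_def
  by (rule derivative_eq_intros DERIV_pow_Euler refl | assumption)+ (simp add: field_simps)

lemma DERIV_etri: "x \<noteq> 0 \<Longrightarrow> (etri A1 A2 p q has_real_derivative eetri A1 A2 p q x / x) (at x)"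
  unfolding eetri_def etri_def
  by (rule derivative_eq_intros DERIV_pow_Euler refl | assumption)+ (simp add: field_simps power2_eq_square)

lemma DERIV_etri_div:
  "x \<noteq> 0 \<Longrightarrow> ((\<lambda>x. etri A1 A2 p q x / x) has_real_derivative
    (eetri A1 A2 p q x - etri A1 A2 p q x) / x ^ 2) (at x)"
  by (rule derivative_eq_intros DERIV_etri refl | assumption)+ (simp add: field_simps power2_eq_square)

lemma continuous_tri: "continuous_on S (tri A0 A1 A2 p q)"
  unfolding tri_def by (intro continuous_intros)

text \<open>The slope may vanish at \<open>x\<close> itself, as it does at the critical point;
  strictness comes from the open interval, where \<open>slope_strict_mono\<close> makes it
  positive.\<close>

lemma tri_strict_mono:
  assumes "nrm A1 A2 p q" "0 < x" "x < y" "slope A1 A2 p q x \<ge> 0"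
  shows "tri A0 A1 A2 p q x < tri A0 A1 A2 p q y"
proof (rule DERIV_pos_imp_increasing_open[OF assms(3)])
  fix z assume z: "x < z" "z < y"
  then have "etri A1 A2 p q z > 0"
    using assms slope_strict_mono[of A1 A2 p q x z] by (simp add: etri_eq nrm_le)
  with z assms DERIV_tri[of z A0 A1 A2 p q]
  show "\<exists>d. (tri A0 A1 A2 p q has_real_derivative d) (at z) \<and> 0 < d"
    by (intro exI[of _ "etri A1 A2 p q z / z"]) auto
qed (auto intro: continuous_tri)

text \<open>The left end may be 0, where the Euler form of the derivative is meaningless; continuity
  takes care of the end points. This covers the whole falling branch starting at
  \<open>A0\<close>.\<close>

lemma tri_strict_antimono:
  assumes "nrm A1 A2 p q" "0 \<le> x" "x < y" "slope A1 A2 p q y \<le> 0"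
  shows "tri A0 A1 A2 p q y < tri A0 A1 A2 p q x"
proof (rule DERIV_neg_imp_decreasing_open[OF assms(3)])
  fix z assume z: "x < z" "z < y"
  then have "slope A1 A2 p q z < 0"
    using assms slope_strict_mono[of A1 A2 p q z y] by fastforce
  then have "etri A1 A2 p q z < 0"
    using z assms by (simp add: etri_eq nrm_le mult_pos_neg)
  with z assms DERIV_tri[of z A0 A1 A2 p q]
  show "\<exists>d. (tri A0 A1 A2 p q has_real_derivative d) (at z) \<and> d < 0"
    by (intro exI[of _ "etri A1 A2 p q z / z"]) (auto simp: divide_neg_pos)
qed (auto intro: continuous_tri)

lemma tri_IVT:
  assumes "a \<le> b" "tri A0 A1 A2 p q a < 0" "tri A0 A1 A2 p q b \<ge> 0"
  shows "\<exists>z. a < z \<and> z \<le> b \<and> tri A0 A1 A2 p q z = 0"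
proof -
  from IVT'[OF less_imp_le[OF assms(2)] assms(3,1) continuous_tri]
  obtain z where "a \<le> z" "z \<le> b" "tri A0 A1 A2 p q z = 0" by auto
  then show ?thesis using assms by (intro exI[of _ z]) (cases "a = z"; auto)
qed

lemma tri_IVT2:
  assumes "a \<le> b" "tri A0 A1 A2 p q a > 0" "tri A0 A1 A2 p q b \<le> 0"
  shows "\<exists>z. a < z \<and> z \<le> b \<and> tri A0 A1 A2 p q z = 0"
proof -
  from IVT2'[OF assms(3) less_imp_le[OF assms(2)] assms(1) continuous_tri]
  obtain z where "a \<le> z" "z \<le> b" "tri A0 A1 A2 p q z = 0" by auto
  then show ?thesis using assms by (intro exI[of _ z]) (cases "a = z"; auto)
qed

section \<open>Newton's method to the right of a critical point\<close>

text \<open>The upper bound loses \<open>1 / s\<close> because the derivative may vanish at \<open>L\<close>;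
  Bernoulli's inequality controls the loss.\<close>

lemma convexity_bounds:
  assumes n: "nrm A1 A2 p q" and L: "0 < L" "slope A1 A2 p q L \<ge> 0" and s: "0 < s"
  defines "x \<equiv> L * (1 + s)"
  shows "0 \<le> eetri A1 A2 p q x - etri A1 A2 p q x"
    and "eetri A1 A2 p q x - etri A1 A2 p q x \<le> (real q + 1 / s) * etri A1 A2 p q x"
    and "etri A1 A2 p q x > 0"
proof -
  define X Y where "X = x ^ (q - p)" and "Y = L ^ (q - p)"
  have pq: "p \<le> q" "0 < p" "A2 > 0" using n by (auto simp: nrm_def)
  have x: "x > 0" "L < x" using L s by (auto simp: x_def)
  have X: "X > 0" "Y > 0" using x L by (auto simp: X_def Y_def)
  have b: "slope A1 A2 p q x > 0" using slope_strict_mono[OF n L(1) x(2) L(2)] .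
  then show pos: "etri A1 A2 p q x > 0" using x pq by (simp add: etri_eq)
  have e: "eetri A1 A2 p q x - etri A1 A2 p q x =
      x ^ p * ((real p - 1) * slope A1 A2 p q x + real q * A2 * (real (q - p) * X))"
    using pq by (simp add: etri_eq eetri_eq algebra_simps X_def)
  have "real p - 1 \<ge> 0" using pq by simp
  then show "0 \<le> eetri A1 A2 p q x - etri A1 A2 p q x"
    unfolding e using x pq X b by (intro mult_nonneg_nonneg add_nonneg_nonneg) auto
  have "1 + real (q - p) * s \<le> (1 + s) ^ (q - p)"
    using Bernoulli_inequality[of s "q - p"] s by simp
  then have "(1 + real (q - p) * s) * Y \<le> (1 + s) ^ (q - p) * Y"
    using X by (intro mult_right_mono) auto
  also have "(1 + s) ^ (q - p) * Y = X" by (simp add: X_def Y_def x_def power_mult_distrib)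
  finally have "real (q - p) * s * Y \<le> X - Y" by (simp add: algebra_simps)
  then have "real (q - p) * Y \<le> (1 / s) * (X - Y)" using s by (simp add: field_simps)
  then have "real (q - p) * X \<le> (real (q - p) + 1 / s) * (X - Y)" by (simp add: algebra_simps)
  then have "real q * A2 * (real (q - p) * X) \<le> real q * A2 * ((real (q - p) + 1 / s) * (X - Y))"
    using pq by (intro mult_left_mono) auto
  \<comment> \<open>The constant term of the slope cancels in the difference, so
    \<open>X - Y\<close> measures the growth of the slope since \<open>L\<close>; the nonnegative
    slope at \<open>L\<close> is then dropped.\<close>
  also have "\<dots> = (real (q - p) + 1 / s) * (slope A1 A2 p q x - slope A1 A2 p q L)"
    by (simp add: slope_def X_def Y_def algebra_simps)
  also have "\<dots> \<le> (real (q - p) + 1 / s) * slope A1 A2 p q x"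
    using L s by (intro mult_left_mono) auto
  finally have "(real p - 1) * slope A1 A2 p q x + real q * A2 * (real (q - p) * X)
      \<le> (real p - 1 + real (q - p) + 1 / s) * slope A1 A2 p q x"
    by (simp add: algebra_simps)
  also have "\<dots> \<le> (real q + 1 / s) * slope A1 A2 p q x"
    using b pq by (intro mult_right_mono) (auto simp: of_nat_diff)
  finally have "x ^ p * ((real p - 1) * slope A1 A2 p q x + real q * A2 * (real (q - p) * X))
      \<le> x ^ p * ((real q + 1 / s) * slope A1 A2 p q x)"
    using x by (intro mult_left_mono) auto
  then show "eetri A1 A2 p q x - etri A1 A2 p q x \<le> (real q + 1 / s) * etri A1 A2 p q x"
    unfolding e using pq by (simp add: etri_eq algebra_simps)
qed

text \<open>Taylor expansion about \<open>x\<close>, evaluated at the root \<open>z\<close>, turns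
  the new error into g''(t) (x - z)^2 / (2 g'(x)) for some t between z and x. Here
  \<open>eetri - etri\<close> is t^2 g''(t), so \<kappa> bounds t g''(t) / g'(t); convexity replaces
  g'(t) by g'(x), and \<open>z < t\<close> replaces 1/t by 1/z.\<close>

lemma Newton_step:
  assumes z: "0 < z" "tri A0 A1 A2 p q z = 0" "z \<le> x"
    and conv: "\<And>t. z \<le> t \<Longrightarrow> t \<le> x \<Longrightarrow> 0 \<le> eetri A1 A2 p q t - etri A1 A2 p q t"
    and upper: "\<And>t. z \<le> t \<Longrightarrow> t \<le> x \<Longrightarrow> eetri A1 A2 p q t - etri A1 A2 p q t \<le> \<kappa> * etri A1 A2 p q t"
    and pos: "\<And>t. z \<le> t \<Longrightarrow> t \<le> x \<Longrightarrow> 0 < etri A1 A2 p q t"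
    and \<kappa>: "\<kappa> \<ge> 0"
  defines "x' \<equiv> x - x * tri A0 A1 A2 p q x / etri A1 A2 p q x"
  shows "z \<le> x'" "x' - z \<le> \<kappa> / (2 * z) * (x - z)\<^sup>2"
proof -
  have "z \<le> x' \<and> x' - z \<le> \<kappa> / (2 * z) * (x - z)\<^sup>2"
  proof (cases "z = x")
    case True
    then show ?thesis using z by (simp add: x'_def)
  next
    case False
    define g1 where "g1 t = etri A1 A2 p q t / t" for t
    define g2 where "g2 t = (eetri A1 A2 p q t - etri A1 A2 p q t) / t ^ 2" for t
    define df where "df m = (if m = 0 then tri A0 A1 A2 p q else if m = 1 then g1 else g2)" for m :: nat
    have d: "\<forall>m t. m < 2 \<and> z \<le> t \<and> t \<le> x \<longrightarrow> (df m has_real_derivative df (Suc m) t) (at t)"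
    proof (intro allI impI)
      fix m :: nat and t assume "m < 2 \<and> z \<le> t \<and> t \<le> x"
      then have t: "t \<noteq> 0" "m = 0 \<or> m = 1" using z by auto
      have "g1 = (\<lambda>x. etri A1 A2 p q x / x)" by (auto simp: g1_def)
      then have "(g1 has_real_derivative g2 t) (at t)"
        using DERIV_etri_div[OF t(1)] by (simp add: g2_def)
      moreover have "(tri A0 A1 A2 p q has_real_derivative g1 t) (at t)"
        using DERIV_tri[OF t(1)] by (simp add: g1_def)
      ultimately show "(df m has_real_derivative df (Suc m) t) (at t)"
        using t(2) by (auto simp: df_def)
    qed
    have "\<exists>t. (if z < x then z < t \<and> t < x else x < t \<and> t < z) \<and>
        tri A0 A1 A2 p q z = (\<Sum>m<2. df m x / fact m * (z - x) ^ m) + df 2 t / fact 2 * (z - x) ^ 2"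
      by (rule Taylor[of 2 df _ z x x z]) (use d z False in \<open>auto simp: df_def\<close>)
    then obtain t where t: "z < t" "t < x"
      and "0 = tri A0 A1 A2 p q x + g1 x * (z - x) + g2 t / 2 * (z - x)\<^sup>2"
      using z False by (auto simp: df_def numeral_2_eq_2 split: if_splits)
    then have T: "g1 x * (x - z) - tri A0 A1 A2 p q x = g2 t / 2 * (x - z)\<^sup>2"
      by (simp add: algebra_simps power2_commute)
    have px: "x > 0" and g1x: "g1 x > 0" using z pos[of x] by (auto simp: g1_def)
    have "x' - z = (g1 x * (x - z) - tri A0 A1 A2 p q x) / g1 x"
      using px g1x pos[of x] z by (simp add: x'_def g1_def field_simps)
    then have E: "x' - z = g2 t / 2 * (x - z)\<^sup>2 / g1 x" unfolding T by simp
    have g2t: "0 \<le> g2 t" using conv[of t] t by (simp add: g2_def)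
    have "g1 t \<le> g1 x"
    proof (rule DERIV_nonneg_imp_nondecreasing[of t x g1])
      fix u assume u: "t \<le> u" "u \<le> x"
      then have "0 \<le> g2 u" using conv[of u] t by (simp add: g2_def)
      moreover have "(df 1 has_real_derivative df (Suc 1) u) (at u)" using d u t by auto
      ultimately show "\<exists>y. (g1 has_real_derivative y) (at u) \<and> 0 \<le> y"
        by (auto simp: df_def)
    qed (use t in auto)
    have "g2 t \<le> \<kappa> * etri A1 A2 p q t / t ^ 2"
      unfolding g2_def using upper[of t] t by (intro divide_right_mono) auto
    then have "g2 t \<le> \<kappa> * g1 t / t"
      by (simp add: g1_def power2_eq_square)
    also have "\<dots> \<le> \<kappa> * g1 x / z"
      using \<open>g1 t \<le> g1 x\<close> t z \<kappa> g1x by (intro frac_le mult_left_mono mult_nonneg_nonneg) auto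
    finally have "g2 t / 2 * (x - z)\<^sup>2 / g1 x \<le> \<kappa> * g1 x / z / 2 * (x - z)\<^sup>2 / g1 x"
      using g1x by (intro divide_right_mono mult_right_mono) auto
    also have "\<dots> = \<kappa> / (2 * z) * (x - z)\<^sup>2" using g1x by simp
    finally show ?thesis using E g2t g1x
      by (smt (verit) divide_nonneg_nonneg mult_nonneg_nonneg zero_le_power2)
  qed
  then show "z \<le> x'" "x' - z \<le> \<kappa> / (2 * z) * (x - z)\<^sup>2" by auto
qed


text \<open>The quantity \<open>(x - z) * (real q + 1 / s) / (2 * z)\<close> is the error times the
  constant of \<open>Newton_step\<close>, so one step simply squares its bound.\<close>

lemma Newton_contract:
  assumes n: "nrm A1 A2 p q" and L: "0 < L" "slope A1 A2 p q L \<ge> 0" and s: "0 < s"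
    and z: "z = L * (1 + s)" "tri A0 A1 A2 p q z = 0"
    and x: "z \<le> x" "(x - z) * (real q + 1 / s) / (2 * z) \<le> y"
  defines "x' \<equiv> x - x * tri A0 A1 A2 p q x / etri A1 A2 p q x"
  shows "z \<le> x'" "(x' - z) * (real q + 1 / s) / (2 * z) \<le> y * y"
proof -
  let ?k = "real q + 1 / s"
  have z0: "z > 0" using L s z by simp
  have k0: "?k \<ge> 0" using s by simp
  have *: "0 \<le> eetri A1 A2 p q t - etri A1 A2 p q t"
    "eetri A1 A2 p q t - etri A1 A2 p q t \<le> ?k * etri A1 A2 p q t"
    "0 < etri A1 A2 p q t" if t: "z \<le> t" for t
  proof -
    define u where "u = t / L - 1"
    have "1 + s \<le> t / L" using t z L by (simp add: field_simps)
    then have u: "s \<le> u" "L * (1 + u) = t" using L by (auto simp: u_def)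
    then have "u > 0" using s by simp
    note c = convexity_bounds[OF n L this, unfolded u(2)]
    show "0 \<le> eetri A1 A2 p q t - etri A1 A2 p q t" "0 < etri A1 A2 p q t"
      by (fact c)+
    \<comment> \<open>Points to the right of the root have larger offsets from \<open>L\<close>, so
      the constant belonging to the root serves the whole interval.\<close>
    have "1 / u \<le> 1 / s" using u s by (intro frac_le) auto
    then have "(real q + 1 / u) * etri A1 A2 p q t \<le> ?k * etri A1 A2 p q t"
      using c(3) by (intro mult_right_mono) auto
    with c(2) show "eetri A1 A2 p q t - etri A1 A2 p q t \<le> ?k * etri A1 A2 p q t" by linarith
  qed
  note N = Newton_step[OF z0 z(2) x(1) *(1) *(2) *(3) k0]
  show "z \<le> x'" unfolding x'_def by (rule N)
  have "(x' - z) * ?k / (2 * z) \<le> (?k / (2 * z) * (x - z)\<^sup>2) * ?k / (2 * z)"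
    unfolding x'_def using z0 k0 N(2) by (intro divide_right_mono mult_right_mono) auto
  also have "\<dots> = ((x - z) * ?k / (2 * z))\<^sup>2" by (simp add: power2_eq_square)
  also have "\<dots> \<le> y\<^sup>2" using x z0 k0 by (intro power_mono) auto
  finally show "(x' - z) * ?k / (2 * z) \<le> y * y" by (simp add: power2_eq_square)
qed

text \<open>Origin of the grid ratio. Here \<open>t\<close> is the offset of the root and
  \<open>s\<close> the grid point below it: the next grid point exceeds \<open>t\<close> by at most
  t/q, and t/q times q + 1/t is t + 1/q, at most 1 + t, which is z/L.\<close>

lemma Newton_start:
  assumes "0 < L" "0 < q" "0 < s" "s < t" "t \<le> s * (1 + 1 / real q)" "z = L * (1 + t)"
  shows "(L * (1 + s * (1 + 1 / real q)) - z) * (real q + 1 / t) / (2 * z) \<le> 1 / 2"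
proof -
  have t: "t > 0" using assms by simp
  have "s / q \<le> t / q" using assms by (intro divide_right_mono) auto
  then have "s * (1 + 1 / real q) - t \<le> t / q" using assms by (simp add: algebra_simps)
  then have "(s * (1 + 1 / real q) - t) * (real q + 1 / t) \<le> t / q * (real q + 1 / t)"
    using t by (intro mult_right_mono) auto
  also have "\<dots> = t + 1 / q" using assms t by (simp add: field_simps)
  also have "\<dots> \<le> 1 + t" using assms by (simp add: field_simps)
  finally have *: "(s * (1 + 1 / real q) - t) * (real q + 1 / t) \<le> 1 + t" .
  have "L * (1 + s * (1 + 1 / real q)) - z = L * (s * (1 + 1 / real q) - t)"
    unfolding assms(6) by (simp add: algebra_simps)
  then have "(L * (1 + s * (1 + 1 / real q)) - z) * (real q + 1 / t) / (2 * z)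
      = L * ((s * (1 + 1 / real q) - t) * (real q + 1 / t)) / (L * (2 * (1 + t)))"
    by (simp add: assms(6) mult_ac)
  also have "\<dots> = (s * (1 + 1 / real q) - t) * (real q + 1 / t) / (2 * (1 + t))"
    using assms(1) by (subst mult_divide_mult_cancel_left) auto
  also have "\<dots> \<le> (1 + t) / (2 * (1 + t))" using * t by (intro divide_right_mono) auto
  also have "\<dots> = 1 / 2" using t by simp
  finally show ?thesis .
qed

text \<open>Since q + 1/s is at least 1, dropping it from the normalised error leaves a relative
  error bound.\<close>

lemma Newton_stop:
  assumes "0 < z" "0 < q" "0 < s" "z \<le> x" "(x - z) * (real q + 1 / s) / (2 * z) \<le> y" "2 * y \<le> \<delta>"
  shows "x \<le> z * (1 + \<delta>)"
proof -
  have "x - z \<le> (x - z) * (real q + 1 / s)"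
  proof -
    have "1 \<le> real q + 1 / s" using assms by (simp add: add_increasing2)
    then have "(x - z) * 1 \<le> (x - z) * (real q + 1 / s)" using assms by (intro mult_left_mono) auto
    then show ?thesis by simp
  qed
  also have "\<dots> \<le> 2 * y * z" using assms by (simp add: field_simps)
  also have "\<dots> \<le> \<delta> * z" using assms by (intro mult_right_mono) auto
  finally show ?thesis by (simp add: algebra_simps)
qed

section \<open>Approximating the rightmost root\<close>

text \<open>None of the three outcomes is a failure. The range ends at \<open>L / \<delta>\<close>
  because a root farther out need not be located, and a start with nonnegative value is handed back
  for the caller to interpret.\<close>

definition find_root_res :: "(real \<Rightarrow> real) \<Rightarrow> real \<Rightarrow> real \<Rightarrow> real \<Rightarrow> bool" where
  "find_root_res g L \<delta> x \<longleftrightarrow> g L \<ge> 0 \<and> x = L \<or> g L < 0 \<and> g (L / \<delta>) < 0 \<and> x = L / \<delta> \<or>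
     g L < 0 \<and> (\<exists>z. L < z \<and> g z = 0 \<and> z \<le> x \<and> x \<le> z * (1 + \<delta>))"

text \<open>Tolerance in a normalised variable u. The value 1 stands for every u up to 1, and a
  value of at least 1/\<delta> for every larger u. For u = z/(\<delta> R) these mean z below the
  tolerance and z beyond R; for u = R/z they mean z = R and z below the tolerance.\<close>

definition right_approx :: "real \<Rightarrow> real \<Rightarrow> real \<Rightarrow> bool" where
  "right_approx \<delta> z x \<longleftrightarrow> x \<ge> 1 \<and> (z \<le> x \<and> (x \<le> z * (1 + \<delta>) \<or> x = 1) \<or> x < z \<and> 1 \<le> x * \<delta>)"

text \<open>Two outcomes of the search for the critical point would give a nonnegative slope at
  \<open>L\<close>, so \<open>L\<close> is the end 1/\<delta> of the range, and every point of
  nonnegative slope lies beyond it.\<close>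

lemma right_approx_critical:
  assumes n: "nrm A1 A2 p q" and z: "0 < z" "slope A1 A2 p q z \<ge> 0" and d: "0 < \<delta>" "\<delta> < 1"
    and L: "find_root_res (slope A1 A2 p q) 1 \<delta> L" "slope A1 A2 p q L < 0"
  shows "right_approx \<delta> z L"
proof -
  have False if "1 < u" "slope A1 A2 p q u = 0" "u \<le> L" for u
    using slope_mono[OF n, of u L] that L(2) by simp
  then have "L = 1 / \<delta>" using L unfolding find_root_res_def by auto
  moreover have "L < z"
  proof (rule ccontr)
    assume "\<not> L < z"
    then show False using slope_mono[OF n z(1), of L] z(2) L(2) by simp
  qed
  ultimately show ?thesis using d by (simp add: right_approx_def)
qed

lemma right_approx_root:
  assumes n: "nrm A1 A2 p q" and z: "0 < z" "tri A0 A1 A2 p q z = 0" "slope A1 A2 p q z \<ge> 0"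
    and d: "0 < \<delta>" "\<delta> < 1"
    and L: "find_root_res (slope A1 A2 p q) 1 \<delta> L" "slope A1 A2 p q L \<ge> 0"
    and x: "find_root_res (tri A0 A1 A2 p q) L \<delta> x"
  shows "right_approx \<delta> z x"
proof -
  let ?g = "tri A0 A1 A2 p q"
  have L': "L = 1 \<or> (\<exists>u. 1 < u \<and> slope A1 A2 p q u = 0 \<and> u \<le> L \<and> L \<le> u * (1 + \<delta>))"
    using L unfolding find_root_res_def by auto
  then have L1: "L \<ge> 1" by auto
  have zL: "L < z" if "?g L < 0"
  proof (rule ccontr)
    assume "\<not> L < z"
    then show False using tri_strict_mono[OF n z(1), of L A0] z that by (cases "z = L") auto
  qed
  consider "?g L \<ge> 0" "x = L" | "?g L < 0" "?g (L / \<delta>) < 0" "x = L / \<delta>"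
    | u where "?g L < 0" "L < u" "?g u = 0" "u \<le> x" "x \<le> u * (1 + \<delta>)"
    using x unfolding find_root_res_def by blast
  then show ?thesis
  proof cases
    case 1
    have "z \<le> L"
    proof (rule ccontr)
      assume "\<not> z \<le> L"
      then show False using tri_strict_mono[OF n, of L z A0] 1 L L1 z by auto
    qed
    moreover have "L = 1 \<or> L \<le> z * (1 + \<delta>)"
    proof (cases "L = 1")
      case False
      then obtain u where u: "1 < u" "slope A1 A2 p q u = 0" "u \<le> L" "L \<le> u * (1 + \<delta>)"
        using L' by auto
      \<comment> \<open>The critical point lies to the left of \<open>z\<close>, so a point within
        the factor 1 + \<delta> of it cannot exceed \<open>z\<close> by more than that
        factor.\<close>
      have "u \<le> z" using slope_strict_mono[OF n z(1), of u] u z by force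
      then have "u * (1 + \<delta>) \<le> z * (1 + \<delta>)" using d by (intro mult_right_mono) auto
      then show ?thesis using u by simp
    qed auto
    ultimately show ?thesis using 1 L1 by (auto simp: right_approx_def)
  next
    case 2
    have "x < z"
    proof (rule ccontr)
      assume "\<not> x < z"
      then show False using tri_strict_mono[OF n z(1), of x A0] z 2 by (cases "z = x") auto
    qed
    moreover have "L * \<delta> \<le> L * 1" using L1 d by (intro mult_left_mono) auto
    then have "L \<le> L / \<delta>" using d by (simp add: field_simps)
    then have "x \<ge> 1" "1 \<le> x * \<delta>" using 2 L1 d by auto
    ultimately show ?thesis by (simp add: right_approx_def)
  next
    case (3 u)
    have "L < z" using zL 3 by simp
    have "slope A1 A2 p q u \<ge> 0" using slope_mono[OF n, of L u] L L1 3 by simp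
    then have "u = z" using tri_strict_mono[OF n, of u z A0] tri_strict_mono[OF n, of z u A0] z 3 L1
      by (cases u z rule: linorder_cases) auto
    then show ?thesis using 3 L1 by (auto simp: right_approx_def)
  qed
qed

section \<open>Transfer of the tolerance through scaling and inversion of the variable\<close>

lemma right_approx_scale:
  assumes "right_approx \<delta> (z / (\<delta> * R)) x" "0 < \<delta>" "0 < R" "0 < z" "z \<le> R"
  shows "\<bar>z - min R (\<delta> * R * x)\<bar> \<le> \<delta> * R" "0 \<le> min R (\<delta> * R * x)"
proof -
  have dR: "\<delta> * R > 0" using assms by simp
  have x: "x \<ge> 1" using assms by (simp add: right_approx_def)
  then show "0 \<le> min R (\<delta> * R * x)" using dR assms by simp
  have dz: "\<delta> * z \<le> \<delta> * R" using assms by (intro mult_left_mono) auto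
  consider "z / (\<delta> * R) \<le> x" "x \<le> z / (\<delta> * R) * (1 + \<delta>)" | "z / (\<delta> * R) \<le> x" "x = 1"
    | "x < z / (\<delta> * R)" "1 \<le> x * \<delta>"
    using assms by (auto simp: right_approx_def)
  then show "\<bar>z - min R (\<delta> * R * x)\<bar> \<le> \<delta> * R"
  proof cases
    case 1
    then have "z \<le> \<delta> * R * x" "\<delta> * R * x \<le> z + \<delta> * z"
      using dR by (auto simp: field_simps)
    then have "z \<le> min R (\<delta> * R * x)" "min R (\<delta> * R * x) \<le> z + \<delta> * z"
      using assms(5) by (auto intro: min.coboundedI2)
    then show ?thesis using dz by linarith
  next
    case 2
    then have "z \<le> \<delta> * R" using dR by (simp add: field_simps)
    moreover have "min R (\<delta> * R * x) \<le> \<delta> * R" using 2 by simp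
    moreover have "0 < min R (\<delta> * R * x)" using 2 dR assms(3) by simp
    ultimately show ?thesis using assms(4) by linarith
  next
    case 3
    have "R * 1 \<le> R * (x * \<delta>)" using 3 assms by (intro mult_left_mono) auto
    moreover have "x * (\<delta> * R) < z" using 3 dR by (simp add: field_simps)
    moreover have "x * (\<delta> * R) = R * (x * \<delta>)" by (simp add: mult_ac)
    ultimately have False using assms(5) by linarith
    then show ?thesis ..
  qed
qed

lemma right_approx_inverse:
  assumes "right_approx \<delta> (R / z) x" "0 < \<delta>" "0 < R" "0 < z" "z \<le> R"
  shows "\<bar>z - R / x\<bar> \<le> \<delta> * R" "0 \<le> R / x" "R / x \<le> R"
proof -
  have x: "x \<ge> 1" using assms by (simp add: right_approx_def)
  then show "0 \<le> R / x" "R / x \<le> R" using assms by (auto simp: field_simps)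
  have R: "R > 0" by fact
  consider "R / z \<le> x" "x \<le> R / z * (1 + \<delta>)" | "R / z \<le> x" "x = 1" | "x < R / z" "1 \<le> x * \<delta>"
    using assms by (auto simp: right_approx_def)
  then show "\<bar>z - R / x\<bar> \<le> \<delta> * R"
  proof cases
    case 1
    have "R / x \<le> z" using 1 x assms by (simp add: field_simps)
    have "z * x \<le> R * (1 + \<delta>)" using 1 assms by (simp add: field_simps)
    then have "z \<le> R / x + \<delta> * (R / x)" using x by (simp add: field_simps)
    also have "\<delta> * (R / x) \<le> \<delta> * R" using assms x by (intro mult_left_mono) (auto simp: field_simps)
    finally show ?thesis using \<open>R / x \<le> z\<close> by simp
  next
    case 2
    then show ?thesis using assms by (simp add: field_simps)
  next
    case 3
    then have "z < R / x" using x assms by (simp add: field_simps)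
    moreover have "R / x \<le> \<delta> * R"
    proof -
      have "R * 1 \<le> R * (x * \<delta>)" using 3 R by (intro mult_left_mono) auto
      then show ?thesis using x by (simp add: field_simps)
    qed
    ultimately show ?thesis using assms by simp
  qed
qed

text \<open>Serves two substitutions: \<open>c = \<delta> * R\<close> brings the interval to the
  normalised scale, and \<open>c = - 1\<close> reflects negative roots.\<close>

lemma tri_scale: "tri A0 (A1 * c ^ p) (A2 * c ^ q) p q x = tri A0 A1 A2 p q (c * x)"
  by (simp add: tri_def power_mult_distrib algebra_simps)

lemma slope_scale:
  "p \<le> q \<Longrightarrow> slope (A1 * c ^ p) (A2 * c ^ q) p q x = c ^ p * slope A1 A2 p q (c * x)"
  by (simp add: slope_def power_mult_distrib algebra_simps flip: power_add)

lemma nrm_scale: "0 < c \<Longrightarrow> nrm A1 A2 p q \<Longrightarrow> nrm (A1 * c ^ p) (A2 * c ^ q) p q"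
  by (auto simp: nrm_def)

text \<open>This is the reciprocal polynomial: the coefficients appear in reverse order, and the
  middle exponent becomes its distance from the top one.\<close>

lemma tri_inverse:
  assumes "p \<le> q" "0 < R" "0 < z"
  shows "tri (A2 * R ^ q) (A1 * R ^ p) A0 (q - p) q (R / z) = (R / z) ^ q * tri A0 A1 A2 p q z"
proof -
  have "(R / z) ^ q = (R / z) ^ p * (R / z) ^ (q - p)" using assms by (simp flip: power_add)
  then show ?thesis using assms by (simp add: tri_def power_divide field_simps)
qed

text \<open>Reversal replaces the Euler derivative by q times the value minus the Euler derivative.
  At a root the value vanishes, so only the sign changes.\<close>

lemma slope_inverse:
  assumes "p \<le> q" "0 < R" "0 < z" "tri A0 A1 A2 p q z = 0" "slope A1 A2 p q z \<le> 0"
  shows "slope (A1 * R ^ p) A0 (q - p) q (R / z) \<ge> 0"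
proof -
  have "slope (A1 * R ^ p) A0 (q - p) q (R / z) * z ^ p
      = R ^ p * (real (q - p) * (A1 * z ^ p) + real q * A0)"
    using assms by (simp add: slope_def power_divide field_simps)
  also have "real (q - p) * (A1 * z ^ p) + real q * A0 = real q * tri A0 A1 A2 p q z - etri A1 A2 p q z"
    using assms(1) by (simp add: tri_def etri_def of_nat_diff algebra_simps)
  also have "\<dots> = - (z ^ p * slope A1 A2 p q z)" using assms by (simp add: etri_eq)
  finally have "slope (A1 * R ^ p) A0 (q - p) q (R / z) * z ^ p
      = R ^ p * (z ^ p * - slope A1 A2 p q z)" by simp
  also have "\<dots> \<ge> 0" using assms by (intro mult_nonneg_nonneg) auto
  finally have "0 \<le> slope (A1 * R ^ p) A0 (q - p) q (R / z) * z ^ p" .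
  moreover have "0 < z ^ p" using assms by simp
  ultimately show ?thesis by (auto simp: zero_le_mult_iff)
qed

section \<open>Counting positive roots\<close>

definition pos_roots :: "(real \<Rightarrow> real) \<Rightarrow> real \<Rightarrow> real set" where
  "pos_roots g x = {z. 0 < z \<and> z \<le> x \<and> g z = 0}"

text \<open>Write the Euler derivative as \<open>p * (g z - A0) + (q - p) * A2 * z ^ q\<close>. The
  first summand is positive and the second nonnegative, so whatever the sign of \<open>A1\<close>,
  zero can be crossed only upwards.\<close>

lemma slope_pos_of_neg_const:
  assumes "nrm A1 A2 p q" "A0 < 0" "0 < z" "tri A0 A1 A2 p q z \<ge> 0"
  shows "slope A1 A2 p q z > 0"
proof -
  have "real p * (A1 * z ^ p + A2 * z ^ q) > 0"
    using assms by (intro mult_pos_pos) (auto simp: tri_def nrm_def)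
  moreover have "real (q - p) * (A2 * z ^ q) \<ge> 0" using assms by (simp add: nrm_def)
  ultimately have "etri A1 A2 p q z > 0"
    using nrm_le[OF assms(1)] by (simp add: etri_def of_nat_diff algebra_simps)
  then show ?thesis using assms by (simp add: etri_eq nrm_le zero_less_mult_iff)
qed

text \<open>The trinomial starts negative at 0 and increases wherever it is nonnegative, so the sign
  at the right end decides.\<close>

lemma card_pos_roots_neg_const:
  assumes n: "nrm A1 A2 p q" and A0: "A0 < 0" and x: "0 < x"
  shows "card (pos_roots (tri A0 A1 A2 p q) x) = (if tri A0 A1 A2 p q x \<ge> 0 then 1 else 0)"
proof -
  let ?g = "tri A0 A1 A2 p q"
  have mono: "?g z < ?g y" if "0 < z" "z < y" "?g z \<ge> 0" for z y
    using tri_strict_mono[OF n that(1,2)] slope_pos_of_neg_const[OF n A0 that(1,3)] by simp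
  show ?thesis
  proof (cases "?g x \<ge> 0")
    case True
    have "?g 0 < 0" using n A0 by (simp add: tri_0)
    with True x obtain z where z: "0 < z" "z \<le> x" "?g z = 0"
      using tri_IVT[of 0 x A0 A1 A2 p q] by auto
    have "y = z" if "0 < y" "?g y = 0" for y
      using mono[of y z] mono[of z y] that z by (cases y z rule: linorder_cases) auto
    with z have "pos_roots ?g x = {z}" unfolding pos_roots_def by blast
    then show ?thesis using True by simp
  next
    case False
    have "?g z \<noteq> 0" if "0 < z" "z \<le> x" for z
      using mono[of z x] that False by (cases "z = x") auto
    then have "pos_roots ?g x = {}" by (auto simp: pos_roots_def)
    then show ?thesis using False by simp
  qed
qed

lemma pos_roots_pos_coeffs:
  assumes "nrm A1 A2 p q" "A0 > 0" "A1 \<ge> 0"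
  shows "pos_roots (tri A0 A1 A2 p q) x = {}"
proof -
  have "tri A0 A1 A2 p q z > 0" if "z > 0" for z
    using assms that by (auto simp: tri_def nrm_def intro!: add_pos_nonneg)
  then show ?thesis by (force simp: pos_roots_def)
qed

text \<open>The root extraction takes place in the proof only; no program ever holds this
  \<open>m\<close>.\<close>

lemma slope_root_exists:
  assumes "nrm A1 A2 p q" "A1 < 0"
  obtains m where "0 < m" "slope A1 A2 p q m = 0"
proof -
  have pq: "p < q" "0 < p" "A2 > 0" using assms by (auto simp: nrm_def)
  let ?m = "root (q - p) (real p * - A1 / (real q * A2))"
  have c: "real p * - A1 / (real q * A2) > 0"
    using pq assms by (intro divide_pos_pos mult_pos_pos) auto
  then have "?m > 0" using pq by (intro real_root_gt_zero) auto
  moreover have "?m ^ (q - p) = real p * - A1 / (real q * A2)"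
    using pq c by (intro real_root_pow_pos2) auto
  then have "slope A1 A2 p q ?m = 0" using pq unfolding slope_def by (simp add: field_simps)
  ultimately show thesis by (rule that)
qed

text \<open>Substituting the known value of \<open>m ^ (q - p)\<close> gives g(m) = c (w - m^p) with
  c > 0. Raising the comparison of w with m^p to the power q - p makes m enter only through m^(q-p),
  which is rational in the input. This is the classical trinomial discriminant, split into two
  powers.\<close>

lemma discriminant_sgn:
  assumes n: "nrm A1 A2 p q" and A: "A0 > 0" "A1 < 0" and m: "0 < m" "slope A1 A2 p q m = 0"
  defines "U \<equiv> (A0 * real q / (- A1 * real (q - p))) ^ (q - p)"
    and "W \<equiv> (- A1 * real p / (A2 * real q)) ^ p"
  shows "tri A0 A1 A2 p q m \<ge> 0 \<longleftrightarrow> W \<le> U" "tri A0 A1 A2 p q m \<le> 0 \<longleftrightarrow> U \<le> W"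
proof -
  have pq: "p < q" "0 < p" "A2 > 0" using assms by (auto simp: nrm_def)
  define w where "w = A0 * real q / (- A1 * real (q - p))"
  have w: "w > 0" using pq A unfolding w_def by (intro divide_pos_pos mult_pos_pos) auto
  have mq: "m ^ (q - p) = - A1 * real p / (A2 * real q)"
    using m pq by (simp add: slope_def field_simps)
  have W: "W = (m ^ p) ^ (q - p)"
    unfolding W_def mq[symmetric] by (simp add: mult.commute flip: power_mult)
  have "m ^ q = m ^ p * m ^ (q - p)" using pq by (simp flip: power_add)
  then have "tri A0 A1 A2 p q m = A0 + A1 * m ^ p + A2 * (m ^ p * (- A1 * real p / (A2 * real q)))"
    by (simp add: tri_def mq)
  also have "\<dots> = (- A1 * real (q - p) / real q) * (w - m ^ p)"
    unfolding w_def using pq A by (simp add: field_simps of_nat_diff)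
  finally obtain c where t: "tri A0 A1 A2 p q m = c * (w - m ^ p)"
    and c_def: "c = - A1 * real (q - p) / real q" by blast
  have c: "c > 0" unfolding c_def
    using pq A by (intro divide_pos_pos mult_pos_pos) auto
  have "tri A0 A1 A2 p q m \<ge> 0 \<longleftrightarrow> m ^ p \<le> w"
    unfolding t using c by (simp add: zero_le_mult_iff)
  also have "\<dots> \<longleftrightarrow> W \<le> U" unfolding W U_def w_def[symmetric]
    using pq m w by (simp add: power_mono_iff)
  finally show "tri A0 A1 A2 p q m \<ge> 0 \<longleftrightarrow> W \<le> U" .
  have "tri A0 A1 A2 p q m \<le> 0 \<longleftrightarrow> w \<le> m ^ p"
    unfolding t using c by (simp add: mult_le_0_iff)
  also have "\<dots> \<longleftrightarrow> U \<le> W" unfolding W U_def w_def[symmetric]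
    using pq m w by (simp add: power_mono_iff)
  finally show "tri A0 A1 A2 p q m \<le> 0 \<longleftrightarrow> U \<le> W" .
qed

text \<open>The trinomial falls from \<open>A0 > 0\<close> to its minimum at \<open>m\<close> and
  rises afterwards. The nested conditionals copy the branches of \<open>count\<close>, each being a
  sign available to the machine.\<close>

lemma card_pos_roots_two_changes:
  assumes n: "nrm A1 A2 p q" and A: "A0 > 0" "A1 < 0" and m: "0 < m" "slope A1 A2 p q m = 0"
    and x: "0 < x"
  shows "card (pos_roots (tri A0 A1 A2 p q) x) =
    (if slope A1 A2 p q x \<ge> 0
     then (if tri A0 A1 A2 p q m \<ge> 0 then (if tri A0 A1 A2 p q m \<le> 0 then 1 else 0)
           else (if tri A0 A1 A2 p q x \<ge> 0 then 2 else 1))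
     else (if tri A0 A1 A2 p q x \<le> 0 then 1 else 0))"
proof -
  let ?g = "tri A0 A1 A2 p q"
  have inc: "?g y < ?g z" if "m \<le> y" "y < z" for y z
    using tri_strict_mono[OF n, of y z] slope_mono[OF n, of m y] that m by auto
  have dec: "?g z < ?g y" if "0 \<le> y" "y < z" "z \<le> m" for y z
    using tri_strict_antimono[OF n, of y z] slope_strict_mono[OF n, of z m] that m by fastforce
  have g0: "?g 0 > 0" using n A by (simp add: tri_0)
  have xm: "slope A1 A2 p q x \<ge> 0 \<longleftrightarrow> m \<le> x"
    using slope_strict_mono[OF n x, of m] slope_mono[OF n m(1), of x] m by force
  show ?thesis
  proof (cases "m \<le> x")
    case False
    show ?thesis
    proof (cases "?g x \<le> 0")
      case True
      then obtain z where z: "0 < z" "z \<le> x" "?g z = 0"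
        using tri_IVT2[of 0 x A0 A1 A2 p q] g0 x by auto
      have "y = z" if "0 < y" "y \<le> x" "?g y = 0" for y
        using dec[of y z] dec[of z y] that z False by (cases y z rule: linorder_cases) auto
      with z have "pos_roots ?g x = {z}" unfolding pos_roots_def by blast
      then show ?thesis using True False xm by simp
    next
      case gx: False
      have "?g z \<noteq> 0" if "0 < z" "z \<le> x" for z
        using dec[of z x] that False gx by (cases "z = x") auto
      then have "pos_roots ?g x = {}" by (auto simp: pos_roots_def)
      then show ?thesis using gx False xm by simp
    qed
  next
    case True
    have min: "?g m < ?g y" if "0 < y" "y \<noteq> m" for y
      using dec[of y m] inc[of m y] that by (cases y m rule: linorder_cases) auto
    consider "?g m > 0" | "?g m = 0" | "?g m < 0" by linarith
    then show ?thesis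
    proof cases
      case 1
      have "?g y \<noteq> 0" if "0 < y" for y using min[OF that] 1 by (cases "y = m") auto
      then have "pos_roots ?g x = {}" by (auto simp: pos_roots_def)
      then show ?thesis using 1 True xm by simp
    next
      case 2
      have "y = m" if "0 < y" "?g y = 0" for y using min[OF that(1)] that 2 by (cases "y = m") auto
      with 2 True m have "pos_roots ?g x = {m}" unfolding pos_roots_def by blast
      then show ?thesis using 2 True xm by simp
    next
      case 3
      obtain z where z: "0 < z" "z \<le> m" "?g z = 0"
        using tri_IVT2[of 0 m A0 A1 A2 p q] g0 m 3 by auto
      have z1: "y = z" if "0 < y" "y \<le> m" "?g y = 0" for y
        using dec[of y z] dec[of z y] that z by (cases y z rule: linorder_cases) auto
      show ?thesis
      proof (cases "?g x \<ge> 0")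
        case gx: True
        obtain u where u: "m < u" "u \<le> x" "?g u = 0"
          using tri_IVT[of m x A0 A1 A2 p q] True 3 gx by auto
        have u1: "y = u" if "m \<le> y" "?g y = 0" for y
          using inc[of y u] inc[of u y] that u by (cases y u rule: linorder_cases) auto
        have "pos_roots ?g x \<subseteq> {z, u}"
        proof
          fix y assume "y \<in> pos_roots ?g x"
          then show "y \<in> {z, u}" using z1[of y] u1[of y] by (cases "y \<le> m") (auto simp: pos_roots_def)
        qed
        moreover have "{z, u} \<subseteq> pos_roots ?g x" using z u True m by (simp add: pos_roots_def)
        ultimately have "pos_roots ?g x = {z, u}" by (rule equalityI)
        then show ?thesis using 3 True xm gx z u by simp
      next
        case gx: False
        have u1: "?g y \<noteq> 0" if "m \<le> y" "y \<le> x" for y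
          using inc[of y x] that gx by (cases "y = x") auto
        have "pos_roots ?g x \<subseteq> {z}"
        proof
          fix y assume "y \<in> pos_roots ?g x"
          then show "y \<in> {z}" using z1[of y] u1[of y] by (cases "y \<le> m") (auto simp: pos_roots_def)
        qed
        moreover have "{z} \<subseteq> pos_roots ?g x" using z True m by (simp add: pos_roots_def)
        ultimately have "pos_roots ?g x = {z}" by (rule equalityI)
        then show ?thesis using 3 True xm gx by simp
      qed
    qed
  qed
qed

section \<open>Powers and evaluation\<close>

definition same_off :: "nat set \<Rightarrow> (nat \<Rightarrow> real) \<Rightarrow> (nat \<Rightarrow> real) \<Rightarrow> bool" where
  "same_off S r r' \<longleftrightarrow> (\<forall>i. i \<notin> S \<longrightarrow> r' i = r i)"

definition pow_up :: com where
  "pow_up = While (V 11 -: V 13) (13 <- V 13 +: V 13)"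

text \<open>Square and multiply from the leading bit. Registers hold reals and offer no integer
  division, so a bit is read by comparing the remainder in 14 with a power of two;
  \<open>14 <- V 14\<close> stands in for a skip.\<close>

definition pow_down :: com where
  "pow_down = While (V 13 -: K 2)
     (13 <- V 13 /: K 2 ;; 12 <- V 12 *: V 12 ;;
      If (V 14 -: V 13) (14 <- V 14 -: V 13 ;; 12 <- V 12 *: V 10) (14 <- V 14))"

text \<open>Input: base in 10, exponent in 11; output in 12.\<close>

definition pow :: com where
  "pow = (13 <- K 1 ;; pow_up ;; 12 <- K 1 ;; 14 <- V 11 ;; pow_down)"

lemma spec_pow_up:
  assumes "r 11 = real n" "r 13 = 1" "n < 2 ^ l"
  shows "spec pow_up r (7 * l + 3)
    (\<lambda>r'. (\<exists>j\<le>l. n < 2 ^ j \<and> r' 13 = 2 ^ j) \<and> same_off {13} r r')"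
proof -
  define I where "I k r' \<longleftrightarrow> (\<exists>j\<le>l. k = l - j \<and> r' 13 = 2 ^ j \<and> same_off {13} r r')"
    for k :: nat and r' :: "nat \<Rightarrow> real"
  have "spec pow_up r (l * (4 + ecost (V 11 -: V 13)) + ecost (V 11 -: V 13))
      (\<lambda>r'. (\<exists>k. I k r') \<and> ev (V 11 -: V 13) r' < 0)"
    unfolding pow_up_def
  proof (rule spec_While)
    show "I l r" using assms by (auto simp: I_def same_off_def intro!: exI[of _ 0])
    fix k r' assume "I k r'" and e: "ev (V 11 -: V 13) r' \<ge> 0"
    then obtain j where j: "j \<le> l" "k = l - j" "r' 13 = 2 ^ j" "same_off {13} r r'"
      by (auto simp: I_def)
    have "real (2 ^ j) \<le> real n" using e j assms by (simp add: same_off_def)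
    then have "(2::nat) ^ j < 2 ^ l" using assms(3) by (simp only: of_nat_le_iff)
    then have "j < l" by (simp add: power_strict_increasing_iff)
    then show "\<exists>m<k. spec (13 <- V 13 +: V 13) r' 4 (I m)"
      using j by (intro exI[of _ "l - Suc j"]) (auto simp: spec_def I_def same_off_def intro!: exI[of _ "Suc j"])
  qed
  then show ?thesis
  proof (rule spec_mono)
    fix r' assume "(\<exists>k. I k r') \<and> ev (V 11 -: V 13) r' < 0"
    then obtain j where j: "j \<le> l" "r' 13 = 2 ^ j" "same_off {13} r r'" "r' 11 < r' 13"
      by (auto simp: I_def)
    then have "real n < real (2 ^ j)" using assms by (simp add: same_off_def)
    then have "n < 2 ^ j" by (simp only: of_nat_less_iff)
    with j show "(\<exists>j\<le>l. n < 2 ^ j \<and> r' 13 = 2 ^ j) \<and> same_off {13} r r'" by auto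
  qed simp
qed

lemma spec_pow_down:
  assumes "r 12 = 1" "r 13 = 2 ^ j" "r 14 = real n" "n < 2 ^ j" "j \<le> l"
  shows "spec pow_down r (20 * l + 2) (\<lambda>r'. r' 12 = r 10 ^ n \<and> same_off {12,13,14} r r')"
proof -
  \<comment> \<open>\<open>i\<close> is the number formed by the bits already read and
    \<open>t\<close> the part of the exponent still in register 14; at k = 0 nothing is
    left.\<close>
  define I where "I k r' \<longleftrightarrow> k \<le> l \<and> r' 13 = 2 ^ k \<and> (\<exists>i t. n = 2 ^ k * i + t \<and> t < 2 ^ k \<and>
      r' 12 = r 10 ^ i \<and> r' 14 = real t) \<and> same_off {12,13,14} r r'"
    for k :: nat and r' :: "nat \<Rightarrow> real"
  have "spec pow_down r (j * (18 + ecost (V 13 -: K 2)) + ecost (V 13 -: K 2))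
      (\<lambda>r'. (\<exists>k. I k r') \<and> ev (V 13 -: K 2) r' < 0)"
    unfolding pow_down_def
  proof (rule spec_While)
    show "I j r" using assms by (auto simp: I_def same_off_def intro!: exI[of _ 0])
    fix k r' assume I: "I k r'" and e: "ev (V 13 -: K 2) r' \<ge> 0"
    then have "k \<noteq> 0" by (cases "k = 0") (auto simp: I_def)
    then obtain k' where k: "k = Suc k'" using not0_implies_Suc by auto
    from I obtain i t where it: "n = 2 ^ k * i + t" "t < 2 ^ k" "r' 12 = r 10 ^ i" "r' 14 = real t"
      by (auto simp: I_def)
    have r: "r' 13 = 2 ^ k" "r' 10 = r 10" "same_off {12,13,14} r r'" "k \<le> l"
      using I by (auto simp: I_def same_off_def)
    show "\<exists>m<k. spec (13 <- V 13 /: K 2 ;; 12 <- V 12 *: V 12 ;;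
      If (V 14 -: V 13) (14 <- V 14 -: V 13 ;; 12 <- V 12 *: V 10) (14 <- V 14)) r' 18 (I m)"
    proof (intro exI conjI)
      show "k' < k" using k by simp
      show "spec (13 <- V 13 /: K 2 ;; 12 <- V 12 *: V 12 ;;
        If (V 14 -: V 13) (14 <- V 14 -: V 13 ;; 12 <- V 12 *: V 10) (14 <- V 14)) r' 18 (I k')"
      proof (cases "2 ^ k' \<le> t")
        case True
        then have c: "(2::real) ^ k' \<le> real t" by (metis of_nat_le_iff of_nat_numeral of_nat_power)
        have "n = 2 ^ k' * Suc (2 * i) + (t - 2 ^ k')" "t - 2 ^ k' < 2 ^ k'"
          using it True k by (auto simp: algebra_simps)
        moreover have "real (t - 2 ^ k') = real t - 2 ^ k'" using True by (simp add: of_nat_diff)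
        moreover have "r 10 ^ i * r 10 ^ i * r 10 = r 10 ^ Suc (2 * i)"
          by (simp add: mult_2 power_add)
        ultimately have "\<exists>i' t'. n = 2 ^ k' * i' + t' \<and> t' < 2 ^ k' \<and>
            r 10 ^ i * r 10 ^ i * r 10 = r 10 ^ i' \<and> real t - 2 ^ k' = real t'" by metis
        then show ?thesis using r c it k by (simp add: spec_def I_def same_off_def)
      next
        case False
        then have c: "real t < (2::real) ^ k'" by (metis of_nat_less_iff of_nat_numeral of_nat_power not_le)
        have "n = 2 ^ k' * (2 * i) + t" "t < 2 ^ k'"
          using it False k by (auto simp: algebra_simps)
        moreover have "r 10 ^ i * r 10 ^ i = r 10 ^ (2 * i)"
          by (simp add: mult_2 power_add)
        ultimately have "\<exists>i' t'. n = 2 ^ k' * i' + t' \<and> t' < 2 ^ k' \<and>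
            r 10 ^ i * r 10 ^ i = r 10 ^ i' \<and> real t = real t'" by metis
        then show ?thesis using r c it k by (simp add: spec_def I_def same_off_def)
      qed
    qed
  qed
  then show ?thesis
  proof (rule spec_mono)
    fix r' assume "(\<exists>k. I k r') \<and> ev (V 13 -: K 2) r' < 0"
    then obtain k where "I k r'" "(2::real) ^ k < 2 ^ 1" by (auto simp: I_def)
    then have "I 0 r'" using power_less_imp_less_exp[of "2::real" k 1] by auto
    then show "r' 12 = r 10 ^ n \<and> same_off {12, 13, 14} r r'" by (auto simp: I_def)
  qed (use assms in simp)
qed

lemma spec_pow:
  assumes "r 11 = real n" "n < 2 ^ l"
  shows "spec pow r (30 * (l + 1)) (\<lambda>r'. r' 12 = r 10 ^ n \<and> same_off {12,13,14} r r')"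
proof -
  have 1: "spec pow_up (r(13 := 1)) (7 * l + 3) (\<lambda>r'. (\<exists>j\<le>l. n < 2 ^ j \<and> r' 13 = 2 ^ j) \<and>
      same_off {13} (r(13 := 1)) r')"
    by (rule spec_pow_up) (use assms in auto)
  show ?thesis
    unfolding spec_def pow_def
    apply simp
    apply (rule wpc_call[OF 1])
    apply (elim conjE exE)
    subgoal for r' k j
      apply simp
      apply (rule wpc_call[OF spec_pow_down[of _ j n l]])
           apply (auto simp: same_off_def assms)
      done
    done
qed

text \<open>Input: the coefficients in 20, 21, 22, the exponents in 23, 24, the argument in 25;
  output: the values of \<^const>\<open>tri\<close> in 26 and of \<^const>\<open>etri\<close> in 27.\<close>

definition evl :: com where
  "evl = (10 <- V 25 ;; 11 <- V 23 ;; pow ;; 26 <- V 21 *: V 12 ;; 11 <- V 24 ;; pow ;;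
     28 <- V 22 *: V 12 ;; 27 <- V 23 *: V 26 +: V 24 *: V 28 ;; 26 <- V 20 +: V 26 +: V 28)"

definition evl_regs :: "nat set" where "evl_regs = {10,11,12,13,14,26,27,28}"

lemma spec_evl:
  assumes "r 23 = real p" "r 24 = real q" "p \<le> q" "q < 2 ^ l"
  shows "spec evl r (100 * (l + 1)) (\<lambda>r'. r' 26 = tri (r 20) (r 21) (r 22) p q (r 25) \<and>
     r' 27 = etri (r 21) (r 22) p q (r 25) \<and> same_off evl_regs r r')"
proof -
  have p: "p < 2 ^ l" using assms by simp
  show ?thesis unfolding spec_def evl_def
    apply simp
    apply (rule wpc_call[OF spec_pow[of _ p l]])
      apply (simp add: assms)
     apply (rule p)
    apply simp
    apply (rule wpc_call[OF spec_pow[of _ q l]])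
      apply (simp add: assms same_off_def)
     apply (rule assms)
    apply (simp add: assms same_off_def evl_regs_def)
    apply (auto simp: tri_def etri_def assms)
    done
qed

section \<open>Bracketing and refining a root\<close>

definition holds_tri :: "(nat \<Rightarrow> real) \<Rightarrow> real \<Rightarrow> real \<Rightarrow> real \<Rightarrow> nat \<Rightarrow> nat \<Rightarrow> bool" where
  "holds_tri r A0 A1 A2 p q \<longleftrightarrow>
     r 20 = A0 \<and> r 21 = A1 \<and> r 22 = A2 \<and> r 23 = real p \<and> r 24 = real q"

lemma wpc_evl:
  assumes "holds_tri r A0 A1 A2 p q" "p \<le> q" "q < 2 ^ l"
    and "\<And>r' k'. k' \<le> k + 100 * (l + 1) \<Longrightarrow> r' 26 = tri A0 A1 A2 p q (r 25) \<Longrightarrow>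
      r' 27 = etri A1 A2 p q (r 25) \<Longrightarrow> same_off evl_regs r r' \<Longrightarrow> Q r' k'"
  shows "wpc evl Q r k"
  using assms by (intro wpc_call[OF spec_evl[of r p q l]]) (auto simp: holds_tri_def)

text \<open>Loops continue on a nonnegative register, but the climb must continue on a strictly
  negative value; the flag in 38 converts one test into the other.\<close>

definition test_up :: com where
  "test_up = (25 <- V 30 *: (K 1 +: V 34 *: V 36) ;; evl ;; If (V 26) (38 <- K (-1)) (38 <- K 1))"

text \<open>The root is bracketed on a geometric grid around \<open>L\<close> by a Fibonacci search:
  registers 35 and 36 hold consecutive terms of \<open>\<beta> ^ fib i\<close>, a sequence that can be
  traversed upwards by multiplication and downwards by division, so no stack is needed.\<close>

definition fib_up :: com where
  "fib_up = While (V 38) (39 <- V 35 *: V 36 ;; 35 <- V 36 ;; 36 <- V 39 ;; test_up)"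

text \<open>The bracket has lower offset \<open>s\<close> in 34 and upper offset s \<beta>^fib(i+1),
  and is probed at s \<beta>^fib(i). Keeping the lower part lowers the index by one; moving
  \<open>s\<close> to the probe leaves width fib(i-1) and lowers it by two. The divisions restore
  the matching pair.\<close>

definition fib_down :: com where
  "fib_down = While (V 36 -: V 37 *: V 37)
     (25 <- V 30 *: (K 1 +: V 34 *: V 35) ;; evl ;;
      If (V 26) (39 <- V 36 /: V 35 ;; 36 <- V 35 ;; 35 <- V 39)
                (34 <- V 34 *: V 35 ;; 36 <- V 36 /: V 35 ;; 35 <- V 35 /: V 36))"

text \<open>The true error cannot be observed. Register 38 carries an a priori bound for the
  normalised error, squared along with each step, and it alone decides when to stop.\<close>

definition newton :: com where
  "newton = While (V 38 +: V 38 -: V 31)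
     (25 <- V 33 ;; evl ;; 33 <- V 33 -: V 33 *: V 26 /: V 27 ;; 38 <- V 38 *: V 38)"

definition find_root_search :: com where
  "find_root_search = (34 <- V 31 ;; 35 <- K 1 ;; 36 <- K 1 +: K 1 /: V 24 ;; 37 <- V 36 ;;
     test_up ;; fib_up ;; fib_down ;;
     33 <- V 30 *: (K 1 +: V 34 *: V 36) ;; 38 <- K (1/2) ;; newton)"

definition find_root_near :: com where
  "find_root_near = (25 <- V 30 *: (K 1 +: V 31) ;; evl ;; If (V 26) (33 <- V 25) find_root_search)"

definition find_root_far :: com where
  "find_root_far = (25 <- V 30 *: V 32 ;; evl ;; If (V 26) find_root_near (33 <- V 30 *: V 32))"

text \<open>Input: a trinomial in 20 to 24, \<open>L\<close> in 30, \<open>\<delta>\<close> in 31 and \<open>1 / \<delta>\<close> in 32; output in 33.\<close>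

definition find_root :: com where
  "find_root = (25 <- V 30 ;; evl ;; If (V 26) (33 <- V 30) find_root_far)"

definition find_root_regs :: "nat set" where
  "find_root_regs = evl_regs \<union> {25,33,34,35,36,37,38,39}"

lemma wpc_test_up:
  assumes "holds_tri r A0 A1 A2 p q" "p \<le> q" "q < 2 ^ l"
    and "\<And>r' k'. k' \<le> k + (100 * (l + 1) + 9) \<Longrightarrow>
      (r' 38 \<ge> 0 \<longleftrightarrow> tri A0 A1 A2 p q (r 30 * (1 + r 34 * r 36)) < 0) \<Longrightarrow>
      same_off (evl_regs \<union> {25,38}) r r' \<Longrightarrow> Q r' k'"
  shows "wpc test_up Q r k"
  unfolding test_up_def
  apply simp
  apply (rule wpc_evl[OF _ assms(2,3), of _ A0 A1 A2])
   apply (use assms(1) in \<open>simp add: holds_tri_def\<close>)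
  apply (auto simp: same_off_def evl_regs_def intro!: assms(4))
  done

text \<open>Termination is left to the caller through \<open>M\<close>, which follows there from the
  sign of the trinomial at \<open>L / \<delta>\<close>.\<close>

lemma spec_fib_up:
  fixes \<beta> :: real
  assumes h: "holds_tri r A0 A1 A2 p q" "p \<le> q" "q < 2 ^ l"
    and r: "r 35 = 1" "r 36 = \<beta>"
    and r38: "r 38 \<ge> 0 \<longleftrightarrow> tri A0 A1 A2 p q (r 30 * (1 + r 34 * r 36)) < 0"
    and M: "\<And>i. tri A0 A1 A2 p q (r 30 * (1 + r 34 * \<beta> ^ fib (Suc i))) < 0 \<Longrightarrow> i < M"
  shows "spec fib_up r ((M + 1) * (130 * (l + 1)))
    (\<lambda>r'. (\<exists>i\<le>M. r' 35 = \<beta> ^ fib i \<and> r' 36 = \<beta> ^ fib (Suc i)) \<and>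
      tri A0 A1 A2 p q (r 30 * (1 + r 34 * r' 36)) \<ge> 0 \<and>
      same_off (evl_regs \<union> {25,35,36,38,39}) r r')"
proof -
  define I where "I k r' \<longleftrightarrow> (\<exists>i\<le>M. k = M - i \<and> r' 35 = \<beta> ^ fib i \<and> r' 36 = \<beta> ^ fib (Suc i)) \<and>
      (r' 38 \<ge> 0 \<longleftrightarrow> tri A0 A1 A2 p q (r 30 * (1 + r 34 * r' 36)) < 0) \<and>
      same_off (evl_regs \<union> {25,35,36,38,39}) r r'"
    for k :: nat and r' :: "nat \<Rightarrow> real"
  have "spec fib_up r (M * (100 * (l + 1) + 20 + ecost (V 38)) + ecost (V 38))
      (\<lambda>r'. (\<exists>k. I k r') \<and> ev (V 38) r' < 0)"
    unfolding fib_up_def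
  proof (rule spec_While)
    show "I M r" using r r38 by (auto simp: I_def same_off_def intro!: exI[of _ 0])
    fix k r' assume "I k r'" and e: "ev (V 38) r' \<ge> 0"
    then obtain i where i: "i \<le> M" "k = M - i" "r' 35 = \<beta> ^ fib i" "r' 36 = \<beta> ^ fib (Suc i)"
      and s: "same_off (evl_regs \<union> {25,35,36,38,39}) r r'"
      and t: "tri A0 A1 A2 p q (r 30 * (1 + r 34 * r' 36)) < 0"
      by (auto simp: I_def)
    have iM: "i < M" using M[of i] t i by simp
    have h': "holds_tri (r'(39 := r' 35 * r' 36, 35 := r' 36, 36 := r' 35 * r' 36)) A0 A1 A2 p q"
      using h s by (simp add: holds_tri_def same_off_def evl_regs_def)
    have "spec (39 <- V 35 *: V 36 ;; 35 <- V 36 ;; 36 <- V 39 ;; test_up) r'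
        (100 * (l + 1) + 20) (I (M - Suc i))"
      unfolding spec_def
      apply simp
      apply (rule wpc_test_up[OF h' h(2,3)])
      apply (simp add: I_def)
      apply (intro conjI exI[of _ "Suc i"])
           apply (use i iM s in \<open>auto simp: same_off_def evl_regs_def power_add mult.commute\<close>)
      done
    then show "\<exists>m<k. spec (39 <- V 35 *: V 36 ;; 35 <- V 36 ;; 36 <- V 39 ;; test_up) r'
        (100 * (l + 1) + 20) (I m)"
      using i iM by (intro exI[of _ "M - Suc i"]) simp
  qed
  then show ?thesis
    by (rule spec_mono) (auto simp: I_def algebra_simps)
qed

lemma fib_Suc_ge_2: "fib (Suc i) \<ge> 2 \<Longrightarrow> i \<ge> 2"
  by (cases i; cases "i - 1") auto

lemma spec_fib_down:
  fixes \<beta> :: real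
  assumes h: "holds_tri r A0 A1 A2 p q" "p \<le> q" "q < 2 ^ l"
    and \<beta>: "1 < \<beta>" "r 37 = \<beta>" and i: "i \<le> M" "r 35 = \<beta> ^ fib i" "r 36 = \<beta> ^ fib (Suc i)"
    and s: "0 < r 34"
    and t: "tri A0 A1 A2 p q (r 30 * (1 + r 34)) < 0"
      "tri A0 A1 A2 p q (r 30 * (1 + r 34 * r 36)) \<ge> 0"
  shows "spec fib_down r ((M + 1) * (130 * (l + 1)))
    (\<lambda>r'. r 34 \<le> r' 34 \<and> r' 36 = \<beta> \<and> tri A0 A1 A2 p q (r 30 * (1 + r' 34)) < 0 \<and>
      tri A0 A1 A2 p q (r 30 * (1 + r' 34 * \<beta>)) \<ge> 0 \<and>
      same_off (evl_regs \<union> {25,34,35,36,39}) r r')"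
proof -
  let ?g = "tri A0 A1 A2 p q"
  define I where "I i r' \<longleftrightarrow> r' 35 = \<beta> ^ fib i \<and> r' 36 = \<beta> ^ fib (Suc i) \<and> r 34 \<le> r' 34 \<and>
      ?g (r 30 * (1 + r' 34)) < 0 \<and> ?g (r 30 * (1 + r' 34 * r' 36)) \<ge> 0 \<and>
      same_off (evl_regs \<union> {25,34,35,36,39}) r r'"
    for i :: nat and r' :: "nat \<Rightarrow> real"
  let ?e = "V 36 -: V 37 *: V 37"
  let ?a = "(25 <- V 30 *: (K 1 +: V 34 *: V 35) ;; evl ;;
      If (V 26) (39 <- V 36 /: V 35 ;; 36 <- V 35 ;; 35 <- V 39)
                (34 <- V 34 *: V 35 ;; 36 <- V 36 /: V 35 ;; 35 <- V 35 /: V 36))"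
  \<comment> \<open>The index is not stored, so the exit test compares register 36 with the square
    of \<beta>: the bracket is a single grid step exactly when \<open>fib (Suc j)\<close> is
    1.\<close>
  have sq: "fib (Suc j) \<ge> 2 \<longleftrightarrow> \<beta> * \<beta> \<le> \<beta> ^ fib (Suc j)" for j
    using power_increasing_iff[of \<beta> 2 "fib (Suc j)"] \<beta> by (simp add: power2_eq_square)
  have "spec fib_down r (i * (100 * (l + 1) + 24 + ecost ?e) + ecost ?e)
      (\<lambda>r'. (\<exists>k. I k r') \<and> ev ?e r' < 0)"
    unfolding fib_down_def
  proof (rule spec_While)
    show "I i r" using i t by (auto simp: I_def same_off_def)
    fix j r' assume I: "I j r'" and e: "ev ?e r' \<ge> 0"
    have r': "r' 35 = \<beta> ^ fib j" "r' 36 = \<beta> ^ fib (Suc j)" "r 34 \<le> r' 34"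
      "?g (r 30 * (1 + r' 34)) < 0" "?g (r 30 * (1 + r' 34 * r' 36)) \<ge> 0"
      and so: "same_off (evl_regs \<union> {25,34,35,36,39}) r r'"
      using I by (auto simp: I_def)
    have "\<beta> * \<beta> \<le> \<beta> ^ fib (Suc j)"
      using e r' so \<beta> by (simp add: same_off_def evl_regs_def)
    then have "fib (Suc j) \<ge> 2" using sq by simp
    then have "j \<ge> 2" by (rule fib_Suc_ge_2)
    then obtain j' where j: "j = Suc (Suc j')" by (metis add_2_eq_Suc le_Suc_ex)
    have q1: "\<beta> ^ fib (Suc j) / \<beta> ^ fib j = \<beta> ^ fib (Suc j')"
      using \<beta> by (simp add: j power_add)
    have q2: "\<beta> ^ fib j / \<beta> ^ fib (Suc j') = \<beta> ^ fib j'"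
      using \<beta> by (simp add: j power_add)
    have s': "0 < r' 34" using r'(3) s by simp
    then have le: "r' 34 \<le> r' 34 * \<beta> ^ fib j" using \<beta> by simp
    have h': "holds_tri (r'(25 := r' 30 * (1 + r' 34 * r' 35))) A0 A1 A2 p q"
      using h so by (simp add: holds_tri_def same_off_def evl_regs_def)
    show "\<exists>m<j. spec ?a r' (100 * (l + 1) + 24) (I m)"
    proof (cases "?g (r 30 * (1 + r' 34 * r' 35)) \<ge> 0")
      case True
      have "spec ?a r' (100 * (l + 1) + 24) (I (Suc j'))"
        unfolding spec_def
        apply simp
        apply (rule wpc_evl[OF h' h(2,3)])
        apply (use True r' so q1 in \<open>auto simp: I_def same_off_def evl_regs_def j\<close>)
        done
      then show ?thesis using j by (intro exI[of _ "Suc j'"]) simp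
    next
      case False
      have "\<beta> ^ fib j * \<beta> ^ fib (Suc j') = \<beta> ^ fib (Suc j)"
        by (simp add: j power_add)
      then have "spec ?a r' (100 * (l + 1) + 24) (I j')"
        unfolding spec_def
        apply simp
        apply (rule wpc_evl[OF h' h(2,3)])
        apply (use False r' so q1 q2 le in \<open>auto simp: mult.assoc I_def same_off_def evl_regs_def\<close>)
        done
      then show ?thesis using j by (intro exI[of _ j']) simp
    qed
  qed
  then show ?thesis
  proof (rule spec_mono)
    have "i * (100 * (l + 1) + 24 + ecost ?e) \<le> M * (100 * (l + 1) + 24 + ecost ?e)"
      using i by (intro mult_right_mono) auto
    then show "i * (100 * (l + 1) + 24 + ecost ?e) + ecost ?e \<le> (M + 1) * (130 * (l + 1))"
      by (simp add: algebra_simps)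
    fix r' assume "(\<exists>k. I k r') \<and> ev ?e r' < 0"
    then obtain j where j: "I j r'" and e: "ev ?e r' < 0" by auto
    then have "\<not> \<beta> * \<beta> \<le> \<beta> ^ fib (Suc j)"
      using \<beta> by (simp add: I_def same_off_def evl_regs_def)
    then have "\<not> fib (Suc j) \<ge> 2" using sq by simp
    moreover have "fib (Suc j) > 0" by (simp add: fib_neq_0_nat)
    ultimately have "fib (Suc j) = 1" by simp
    then show "r 34 \<le> r' 34 \<and> r' 36 = \<beta> \<and> ?g (r 30 * (1 + r' 34)) < 0 \<and>
      ?g (r 30 * (1 + r' 34 * \<beta>)) \<ge> 0 \<and> same_off (evl_regs \<union> {25,34,35,36,39}) r r'"
      using j by (auto simp: I_def)
  qed
qed

lemma spec_newton:
  assumes h: "holds_tri r A0 A1 A2 p q" "nrm A1 A2 p q" "q < 2 ^ l"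
    and L: "0 < L" "slope A1 A2 p q L \<ge> 0" and s: "0 < s"
    and z: "z = L * (1 + s)" "tri A0 A1 A2 p q z = 0"
    and r: "r 38 = 1 / 2" "z \<le> r 33" "(r 33 - z) * (real q + 1 / s) / (2 * z) \<le> 1 / 2"
    and M: "2 * (1 / 2) ^ (2 ^ M) < r 31"
  shows "spec newton r ((M + 1) * (130 * (l + 1)))
    (\<lambda>r'. z \<le> r' 33 \<and> r' 33 \<le> z * (1 + r 31) \<and> same_off (evl_regs \<union> {25,33,38}) r r')"
proof -
  define I where "I k r' \<longleftrightarrow> (\<exists>i\<le>M. k = M - i \<and> r' 38 = (1 / 2) ^ (2 ^ i)) \<and>
      z \<le> r' 33 \<and> (r' 33 - z) * (real q + 1 / s) / (2 * z) \<le> r' 38 \<and>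
      same_off (evl_regs \<union> {25,33,38}) r r'"
    for k :: nat and r' :: "nat \<Rightarrow> real"
  let ?e = "V 38 +: V 38 -: V 31"
  let ?a = "(25 <- V 33 ;; evl ;; 33 <- V 33 -: V 33 *: V 26 /: V 27 ;; 38 <- V 38 *: V 38)"
  have "spec newton r (M * (100 * (l + 1) + 20 + ecost ?e) + ecost ?e)
      (\<lambda>r'. (\<exists>k. I k r') \<and> ev ?e r' < 0)"
    unfolding newton_def
  proof (rule spec_While)
    show "I M r" using r(2,3) unfolding I_def r(1) by (auto simp: same_off_def intro!: exI[of _ 0])
    fix k r' assume "I k r'" and e: "ev ?e r' \<ge> 0"
    then obtain i where i: "i \<le> M" "k = M - i" "r' 38 = (1 / 2) ^ (2 ^ i)"
      and r': "z \<le> r' 33" "(r' 33 - z) * (real q + 1 / s) / (2 * z) \<le> r' 38"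
      and so: "same_off (evl_regs \<union> {25,33,38}) r r'"
      by (auto simp: I_def)
    have "2 * r' 38 \<ge> r 31" using e so by (simp add: same_off_def evl_regs_def)
    with M have "(1 / 2 :: real) ^ (2 ^ M) < (1 / 2) ^ (2 ^ i)" unfolding i(3) by linarith
    then have "(2::nat) ^ i < 2 ^ M" by (subst (asm) power_strict_decreasing_iff) auto
    then have iM: "i < M" by simp
    have h': "holds_tri (r'(25 := r' 33)) A0 A1 A2 p q"
      using h so by (simp add: holds_tri_def same_off_def evl_regs_def)
    note N = Newton_contract[OF h(2) L s z r']
    have sqr: "r' 38 * r' 38 = (1 / 2) ^ (2 ^ Suc i)" unfolding i(3)
      by (simp add: mult_2 flip: power_add)
    have "spec ?a r' (100 * (l + 1) + 20) (I (M - Suc i))"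
      unfolding spec_def
      apply simp
      apply (rule wpc_evl[OF h' nrm_le(1)[OF h(2)] h(3)])
      apply (simp add: I_def)
      apply (intro conjI exI[of _ "Suc i"])
           apply (use i(1,2) iM so N sqr in \<open>simp_all add: same_off_def evl_regs_def del: power_Suc\<close>)
      done
    then show "\<exists>m<k. spec ?a r' (100 * (l + 1) + 20) (I m)"
      using i iM by (intro exI[of _ "M - Suc i"]) simp
  qed
  then show ?thesis
  proof (rule spec_mono)
    fix r' assume "(\<exists>k. I k r') \<and> ev ?e r' < 0"
    then have r': "z \<le> r' 33" "(r' 33 - z) * (real q + 1 / s) / (2 * z) \<le> r' 38"
      and so: "same_off (evl_regs \<union> {25,33,38}) r r'" and e: "ev ?e r' < 0"
      by (auto simp: I_def)
    have "2 * r' 38 \<le> r 31" using e so by (simp add: same_off_def evl_regs_def)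
    moreover have "z > 0" using z L s by simp
    ultimately show "z \<le> r' 33 \<and> r' 33 \<le> z * (1 + r 31) \<and> same_off (evl_regs \<union> {25,33,38}) r r'"
      using Newton_stop[OF _ nrm_le(2)[OF h(2)] s r'] r' so by simp
  qed (simp add: algebra_simps)
qed

text \<open>The search takes at most \<open>M\<close> steps up and down, and Newton's method at most \<open>M\<close> steps.\<close>

definition steps_suffice :: "nat \<Rightarrow> nat \<Rightarrow> real \<Rightarrow> bool" where
  "steps_suffice l M \<delta> \<longleftrightarrow> 2 * (1 / 2) ^ (2 ^ M) < \<delta> \<and>
     (\<forall>q. 0 < q \<and> q < 2 ^ l \<longrightarrow> 1 / \<delta>\<^sup>2 \<le> (1 + 1 / real q) ^ fib M)"

lemma spec_find_root_search:
  assumes h: "holds_tri r A0 A1 A2 p q" "nrm A1 A2 p q" "q < 2 ^ l"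
    and L: "0 < r 30" "slope A1 A2 p q (r 30) \<ge> 0"
    and d: "r 31 = \<delta>" "0 < \<delta>" "\<delta> < 1"
    and M: "steps_suffice l M \<delta>"
    and t: "tri A0 A1 A2 p q (r 30 * (1 + \<delta>)) < 0" "tri A0 A1 A2 p q (r 30 / \<delta>) \<ge> 0"
  shows "spec find_root_search r (3 * ((M + 1) * (130 * (l + 1))) + 130 * (l + 1))
    (\<lambda>r'. (\<exists>z. r 30 < z \<and> tri A0 A1 A2 p q z = 0 \<and> z \<le> r' 33 \<and> r' 33 \<le> z * (1 + \<delta>)) \<and>
      same_off find_root_regs r r')"
proof -
  let ?g = "tri A0 A1 A2 p q" and ?L = "r 30"
  define \<beta> where "\<beta> = 1 + 1 / real q"
  have q: "0 < q" using nrm_le(2)[OF h(2)] .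
  have \<beta>: "1 < \<beta>" using q by (simp add: \<beta>_def)
  have pq: "p \<le> q" using nrm_le(1)[OF h(2)] .
  have iM: "i < M" if "?g (?L * (1 + \<delta> * \<beta> ^ fib (Suc i))) < 0" for i
  proof -
    \<comment> \<open>To the right of \<open>L\<close> the trinomial increases, and it is
      nonnegative at \<open>L / \<delta>\<close>; a grid point with a negative value lies before
      that point.\<close>
    have "?L * (1 + \<delta> * \<beta> ^ fib (Suc i)) < ?L / \<delta>"
    proof (rule ccontr)
      assume a: "\<not> ?thesis"
      have "slope A1 A2 p q (?L / \<delta>) \<ge> 0"
        by (rule slope_mono[OF h(2) L(1) _ L(2)]) (use d L in \<open>simp add: field_simps\<close>)
      then show False using a that t(2) L d
          tri_strict_mono[OF h(2), of "?L / \<delta>" "?L * (1 + \<delta> * \<beta> ^ fib (Suc i))" A0]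
        by (cases "?L / \<delta> = ?L * (1 + \<delta> * \<beta> ^ fib (Suc i))") auto
    qed
    then have "?L * (1 + \<delta> * \<beta> ^ fib (Suc i)) < ?L * (1 / \<delta>)" by simp
    then have "1 + \<delta> * \<beta> ^ fib (Suc i) < 1 / \<delta>" using L by (simp only: mult_less_cancel_left_pos)
    \<comment> \<open>The power is below (1/\<delta> - 1)/\<delta>; enlarging this to 1/\<delta>^2
      gives the threshold used in \<open>steps_suffice\<close>.\<close>
    then have "\<beta> ^ fib (Suc i) < 1 / \<delta>\<^sup>2" using d by (simp add: field_simps power2_eq_square)
    also have "\<dots> \<le> \<beta> ^ fib M" using M q h by (simp add: steps_suffice_def \<beta>_def)
    finally have "fib (Suc i) < fib M" using \<beta> by (simp add: power_strict_increasing_iff)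
    then have "\<not> M \<le> Suc i" using fib_mono[of M "Suc i"] by auto
    then show ?thesis by simp
  qed
  define r0 where "r0 = r(34 := \<delta>, 35 := 1, 36 := \<beta>, 37 := \<beta>)"
  have h0: "holds_tri r0 A0 A1 A2 p q" using h by (simp add: holds_tri_def r0_def)
  have "wpc test_up (wpc (fib_up ;; fib_down ;;
          33 <- V 30 *: (K 1 +: V 34 *: V 36) ;; 38 <- K (1/2) ;; newton)
     (\<lambda>r' k. k \<le> 3 * ((M + 1) * (130 * (l + 1))) + 130 * (l + 1) \<and>
       (\<exists>z. r 30 < z \<and> ?g z = 0 \<and> z \<le> r' 33 \<and> r' 33 \<le> z * (1 + \<delta>)) \<and>
      same_off find_root_regs r r')) r0 (Suc (Suc (Suc (Suc (Suc (Suc (Suc (Suc (Suc 0)))))))))"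
  proof (rule wpc_test_up[OF h0 pq h(3)])
    fix r1 k1 assume k1: "k1 \<le> Suc (Suc (Suc (Suc (Suc (Suc (Suc (Suc (Suc 0)))))))) + (100 * (l + 1) + 9)"
      and r1: "(0 \<le> r1 38) = (?g (r0 30 * (1 + r0 34 * r0 36)) < 0)"
      and s1: "same_off (evl_regs \<union> {25, 38}) r0 r1"
    have h1: "holds_tri r1 A0 A1 A2 p q"
      using h0 s1 by (simp add: holds_tri_def same_off_def evl_regs_def)
    have e1: "r1 30 = ?L" "r1 34 = \<delta>" "r1 35 = 1" "r1 36 = \<beta>" "r1 37 = \<beta>" "r1 31 = \<delta>"
      using s1 d by (auto simp: same_off_def evl_regs_def r0_def)
    have "spec fib_up r1 ((M + 1) * (130 * (l + 1)))
      (\<lambda>r'. (\<exists>i\<le>M. r' 35 = \<beta> ^ fib i \<and> r' 36 = \<beta> ^ fib (Suc i)) \<and>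
        ?g (r1 30 * (1 + r1 34 * r' 36)) \<ge> 0 \<and>
        same_off (evl_regs \<union> {25,35,36,38,39}) r1 r')"
      by (rule spec_fib_up[OF h1 pq h(3)]) (use e1 r1 iM in \<open>auto simp: r0_def\<close>)
    then show "wpc (fib_up ;; fib_down ;;
          33 <- V 30 *: (K 1 +: V 34 *: V 36) ;; 38 <- K (1/2) ;; newton)
     (\<lambda>r' k. k \<le> 3 * ((M + 1) * (130 * (l + 1))) + 130 * (l + 1) \<and>
       (\<exists>z. r 30 < z \<and> ?g z = 0 \<and> z \<le> r' 33 \<and> r' 33 \<le> z * (1 + \<delta>)) \<and>
      same_off find_root_regs r r') r1 k1"
      proof (rule wpc_Seq[THEN iffD2, OF wpc_call])
      fix r2 k2 assume k2: "k2 \<le> k1 + (M + 1) * (130 * (l + 1))"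
        and "(\<exists>i\<le>M. r2 35 = \<beta> ^ fib i \<and> r2 36 = \<beta> ^ fib (Suc i)) \<and>
        ?g (r1 30 * (1 + r1 34 * r2 36)) \<ge> 0 \<and>
        same_off (evl_regs \<union> {25,35,36,38,39}) r1 r2"
      then obtain i where i: "i \<le> M" "r2 35 = \<beta> ^ fib i" "r2 36 = \<beta> ^ fib (Suc i)"
        and t2: "?g (?L * (1 + \<delta> * r2 36)) \<ge> 0"
        and s2: "same_off (evl_regs \<union> {25,35,36,38,39}) r1 r2"
        using e1 by auto
      have h2: "holds_tri r2 A0 A1 A2 p q"
        using h1 s2 by (simp add: holds_tri_def same_off_def evl_regs_def)
      have e2: "r2 30 = ?L" "r2 34 = \<delta>" "r2 37 = \<beta>" "r2 31 = \<delta>"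
        using s2 e1 by (auto simp: same_off_def evl_regs_def)
      have "spec fib_down r2 ((M + 1) * (130 * (l + 1)))
        (\<lambda>r'. r2 34 \<le> r' 34 \<and> r' 36 = \<beta> \<and> ?g (r2 30 * (1 + r' 34)) < 0 \<and>
          ?g (r2 30 * (1 + r' 34 * \<beta>)) \<ge> 0 \<and>
          same_off (evl_regs \<union> {25,34,35,36,39}) r2 r')"
        by (rule spec_fib_down[OF h2 pq h(3) \<beta> e2(3) i]) (use e2 t2 t d in auto)
      then show "wpc (fib_down ;; 33 <- V 30 *: (K 1 +: V 34 *: V 36) ;; 38 <- K (1/2) ;; newton)
       (\<lambda>r' k. k \<le> 3 * ((M + 1) * (130 * (l + 1))) + 130 * (l + 1) \<and>
         (\<exists>z. r 30 < z \<and> ?g z = 0 \<and> z \<le> r' 33 \<and> r' 33 \<le> z * (1 + \<delta>)) \<and>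
        same_off find_root_regs r r') r2 k2"
        proof (rule wpc_Seq[THEN iffD2, OF wpc_call])
        fix r3 k3 assume k3: "k3 \<le> k2 + (M + 1) * (130 * (l + 1))"
          and "r2 34 \<le> r3 34 \<and> r3 36 = \<beta> \<and> ?g (r2 30 * (1 + r3 34)) < 0 \<and>
          ?g (r2 30 * (1 + r3 34 * \<beta>)) \<ge> 0 \<and>
          same_off (evl_regs \<union> {25,34,35,36,39}) r2 r3"
        then have r3: "\<delta> \<le> r3 34" "r3 36 = \<beta>" "?g (?L * (1 + r3 34)) < 0"
          "?g (?L * (1 + r3 34 * \<beta>)) \<ge> 0"
          and s3: "same_off (evl_regs \<union> {25,34,35,36,39}) r2 r3"
          using e2 by auto
        have h3: "holds_tri r3 A0 A1 A2 p q"
          using h2 s3 by (simp add: holds_tri_def same_off_def evl_regs_def)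
        have e3: "r3 30 = ?L" "r3 31 = \<delta>"
          using s3 e2 by (auto simp: same_off_def evl_regs_def)
        let ?s = "r3 34"
        have s0: "?s > 0" using r3 d by simp
        have "?L * (1 + ?s) \<le> ?L * (1 + ?s * \<beta>)"
          using L s0 \<beta> by (intro mult_left_mono) auto
        from tri_IVT[OF this r3(3,4)] obtain z
          where z: "?L * (1 + ?s) < z" "z \<le> ?L * (1 + ?s * \<beta>)" "?g z = 0" by auto
        \<comment> \<open>In terms of its offset \<sigma>, the root sits in one grid cell, and the
          upper end of that cell is the starting point required by
          \<open>Newton_start\<close>.\<close>
        define \<sigma> where "\<sigma> = z / ?L - 1"
        have zs: "z = ?L * (1 + \<sigma>)" using L by (simp add: \<sigma>_def)
        have \<sigma>: "?s < \<sigma>" "\<sigma> \<le> ?s * \<beta>" using z L by (auto simp: zs)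
        have Lz: "?L < z" using zs L \<sigma> s0 by (simp add: algebra_simps)
        have start: "(?L * (1 + ?s * \<beta>) - z) * (real q + 1 / \<sigma>) / (2 * z) \<le> 1 / 2"
          unfolding \<beta>_def by (rule Newton_start[OF L(1) q s0 \<sigma>(1) _ zs]) (use \<sigma> \<beta>_def in auto)
        define r4 where "r4 = r3(33 := ?L * (1 + ?s * \<beta>), 38 := 1 / 2)"
        have "spec newton r4 ((M + 1) * (130 * (l + 1)))
          (\<lambda>r'. z \<le> r' 33 \<and> r' 33 \<le> z * (1 + r4 31) \<and> same_off (evl_regs \<union> {25,33,38}) r4 r')"
          by (rule spec_newton[OF _ h(2,3) L _ zs z(3)])
            (use h3 \<sigma> s0 start z e3 M in \<open>auto simp: r4_def holds_tri_def steps_suffice_def\<close>)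
        then have "wpc newton (\<lambda>r' k. k \<le> 3 * ((M + 1) * (130 * (l + 1))) + 130 * (l + 1) \<and>
            (\<exists>z. r 30 < z \<and> ?g z = 0 \<and> z \<le> r' 33 \<and> r' 33 \<le> z * (1 + \<delta>)) \<and>
            same_off find_root_regs r r') r4 (Suc (Suc (Suc (Suc (Suc (Suc (Suc (Suc k3))))))))"
        proof (rule wpc_call)
          fix r5 k5 assume k5: "k5 \<le> Suc (Suc (Suc (Suc (Suc (Suc (Suc (Suc k3))))))) + (M + 1) * (130 * (l + 1))"
            and "z \<le> r5 33 \<and> r5 33 \<le> z * (1 + r4 31) \<and> same_off (evl_regs \<union> {25,33,38}) r4 r5"
          then have r5: "z \<le> r5 33" "r5 33 \<le> z * (1 + \<delta>)" and s5: "same_off (evl_regs \<union> {25,33,38}) r4 r5"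
            using e3 by (auto simp: r4_def)
          have "same_off find_root_regs r r5"
            using s1 s2 s3 s5 by (simp add: same_off_def find_root_regs_def r4_def r0_def)
          moreover have "k5 \<le> 3 * ((M + 1) * (130 * (l + 1))) + 130 * (l + 1)"
            using k1 k2 k3 k5 by (simp add: algebra_simps)
          ultimately show "k5 \<le> 3 * ((M + 1) * (130 * (l + 1))) + 130 * (l + 1) \<and>
            (\<exists>z. r 30 < z \<and> ?g z = 0 \<and> z \<le> r5 33 \<and> r5 33 \<le> z * (1 + \<delta>)) \<and>
            same_off find_root_regs r r5"
            using r5 Lz z by blast
        qed
        then show "wpc (33 <- V 30 *: (K 1 +: V 34 *: V 36) ;; 38 <- K (1/2) ;; newton)
         (\<lambda>r' k. k \<le> 3 * ((M + 1) * (130 * (l + 1))) + 130 * (l + 1) \<and>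
           (\<exists>z. r 30 < z \<and> ?g z = 0 \<and> z \<le> r' 33 \<and> r' 33 \<le> z * (1 + \<delta>)) \<and>
          same_off find_root_regs r r') r3 k3"
          using r3 e3 by (simp add: r4_def of_rat_divide)
      qed
    qed
  qed
  moreover have "r 24 = real q" using h by (simp add: holds_tri_def)
  ultimately show ?thesis using d by (simp add: spec_def find_root_search_def r0_def \<beta>_def)
qed

lemma spec_find_root_near:
  assumes h: "holds_tri r A0 A1 A2 p q" "nrm A1 A2 p q" "q < 2 ^ l"
    and L: "0 < r 30" "slope A1 A2 p q (r 30) \<ge> 0"
    and d: "r 31 = \<delta>" "0 < \<delta>" "\<delta> < 1"
    and M: "steps_suffice l M \<delta>"
    and t: "tri A0 A1 A2 p q (r 30) < 0" "tri A0 A1 A2 p q (r 30 / \<delta>) \<ge> 0"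
  shows "spec find_root_near r (700 * ((M + 1) * (l + 1)))
    (\<lambda>r'. find_root_res (tri A0 A1 A2 p q) (r 30) \<delta> (r' 33) \<and> same_off find_root_regs r r')"
proof -
  let ?g = "tri A0 A1 A2 p q" and ?L = "r 30"
  have h1: "holds_tri (r(25 := x)) A0 A1 A2 p q" for x using h by (simp add: holds_tri_def)
  show ?thesis unfolding spec_def find_root_near_def
    apply simp
    apply (rule wpc_evl[OF h1 nrm_le(1)[OF h(2)] h(3)])
    subgoal premises prems for r1 k1
    proof (cases "?g (?L * (1 + \<delta>)) \<ge> 0")
      case True
      have "?L \<le> ?L * (1 + \<delta>)" using L d by simp
      from tri_IVT[OF this t(1) True] obtain z where
        z: "?L < z" "z \<le> ?L * (1 + \<delta>)" "?g z = 0" by auto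
      \<comment> \<open>A root between \<open>L\<close> and \<open>L * (1 + \<delta>)\<close> is
        approximated by the upper end with relative error at most \<delta>. This is why the grid can
        begin at offset \<delta>.\<close>
      have "?L * (1 + \<delta>) \<le> z * (1 + \<delta>)" using z d by (intro mult_right_mono) auto
      then have "find_root_res ?g ?L \<delta> (?L * (1 + \<delta>))"
        using t z unfolding find_root_res_def by force
      then show ?thesis using True prems d
        by (simp add: same_off_def find_root_regs_def evl_regs_def algebra_simps)
    next
      case False
      have e: "r1 30 = ?L" "r1 31 = \<delta>" using prems d by (auto simp: same_off_def evl_regs_def)
      have h2: "holds_tri r1 A0 A1 A2 p q"
        using h prems by (simp add: holds_tri_def same_off_def evl_regs_def)
      have sp: "spec find_root_search r1 (3 * ((M + 1) * (130 * (l + 1))) + 130 * (l + 1))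
          (\<lambda>r'. (\<exists>z. r1 30 < z \<and> ?g z = 0 \<and> z \<le> r' 33 \<and> r' 33 \<le> z * (1 + \<delta>)) \<and>
            same_off find_root_regs r1 r')"
        by (rule spec_find_root_search[OF h2 h(2,3)]) (use e L d M False t in auto)
      have "wpc find_root_search (\<lambda>r' k. k \<le> 700 * ((M + 1) * (l + 1)) \<and>
          find_root_res ?g ?L \<delta> (r' 33) \<and> same_off find_root_regs r r') r1 (Suc k1)"
      proof (rule wpc_call[OF sp])
        fix r2 k2 assume k2: "k2 \<le> Suc k1 + (3 * ((M + 1) * (130 * (l + 1))) + 130 * (l + 1))"
          and r2: "(\<exists>z. r1 30 < z \<and> ?g z = 0 \<and> z \<le> r2 33 \<and> r2 33 \<le> z * (1 + \<delta>)) \<and>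
            same_off find_root_regs r1 r2"
        have "k2 \<le> 700 * ((M + 1) * (l + 1))" using k2 prems by (simp add: algebra_simps)
        moreover have "find_root_res ?g ?L \<delta> (r2 33)" using r2 t e by (auto simp: find_root_res_def)
        moreover have "same_off find_root_regs r r2" using r2 prems by (simp add: same_off_def find_root_regs_def)
        ultimately show "k2 \<le> 700 * ((M + 1) * (l + 1)) \<and>
          find_root_res ?g ?L \<delta> (r2 33) \<and> same_off find_root_regs r r2" by blast
      qed
      then show ?thesis using False prems d by simp
    qed
    done
qed

lemma spec_find_root_far:
  assumes h: "holds_tri r A0 A1 A2 p q" "nrm A1 A2 p q" "q < 2 ^ l"
    and L: "0 < r 30" "slope A1 A2 p q (r 30) \<ge> 0"
    and d: "r 31 = \<delta>" "r 32 = 1 / \<delta>" "0 < \<delta>" "\<delta> < 1"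
    and M: "steps_suffice l M \<delta>"
    and t: "tri A0 A1 A2 p q (r 30) < 0"
  shows "spec find_root_far r (850 * ((M + 1) * (l + 1)))
    (\<lambda>r'. find_root_res (tri A0 A1 A2 p q) (r 30) \<delta> (r' 33) \<and> same_off find_root_regs r r')"
proof -
  let ?g = "tri A0 A1 A2 p q" and ?L = "r 30"
  have h1: "holds_tri (r(25 := x)) A0 A1 A2 p q" for x using h by (simp add: holds_tri_def)
  show ?thesis unfolding spec_def find_root_far_def
    apply simp
    apply (rule wpc_evl[OF h1 nrm_le(1)[OF h(2)] h(3)])
    subgoal premises prems for r1 k1
    proof (cases "?g (?L / \<delta>) \<ge> 0")
      case False
      then show ?thesis using t prems d
        by (simp add: find_root_res_def same_off_def find_root_regs_def evl_regs_def algebra_simps)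
    next
      case True
      have e: "r1 30 = ?L" "r1 31 = \<delta>" using prems d by (auto simp: same_off_def evl_regs_def)
      have h2: "holds_tri r1 A0 A1 A2 p q"
        using h prems by (simp add: holds_tri_def same_off_def evl_regs_def)
      have sp: "spec find_root_near r1 (700 * ((M + 1) * (l + 1)))
          (\<lambda>r'. find_root_res ?g (r1 30) \<delta> (r' 33) \<and> same_off find_root_regs r1 r')"
        by (rule spec_find_root_near[OF h2 h(2,3)]) (use e L d M True t in auto)
      have "wpc find_root_near (\<lambda>r' k. k \<le> 850 * ((M + 1) * (l + 1)) \<and>
          find_root_res ?g ?L \<delta> (r' 33) \<and> same_off find_root_regs r r') r1 (Suc k1)"
      proof (rule wpc_call[OF sp])
        fix r2 k2 assume k2: "k2 \<le> Suc k1 + 700 * ((M + 1) * (l + 1))"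
          and r2: "find_root_res ?g (r1 30) \<delta> (r2 33) \<and> same_off find_root_regs r1 r2"
        have "k2 \<le> 850 * ((M + 1) * (l + 1))" using k2 prems by (simp add: algebra_simps)
        moreover have "same_off find_root_regs r r2" using r2 prems by (simp add: same_off_def find_root_regs_def)
        ultimately show "k2 \<le> 850 * ((M + 1) * (l + 1)) \<and>
          find_root_res ?g ?L \<delta> (r2 33) \<and> same_off find_root_regs r r2" using r2 e by simp
      qed
      then show ?thesis using True prems d by simp
    qed
    done
qed

text \<open>The disjunction admits the slope of a binomial: with \<open>q - p = 0\<close> it is a
  positive constant rather than a normalised trinomial, and the first test returns \<open>L\<close>
  at once.\<close>

lemma spec_find_root:
  assumes h: "holds_tri r A0 A1 A2 p q" "p \<le> q" "q < 2 ^ l"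
    and n: "nrm A1 A2 p q \<or> tri A0 A1 A2 p q (r 30) \<ge> 0"
    and L: "0 < r 30" "slope A1 A2 p q (r 30) \<ge> 0"
    and d: "r 31 = \<delta>" "r 32 = 1 / \<delta>" "0 < \<delta>" "\<delta> < 1"
    and M: "steps_suffice l M \<delta>"
  shows "spec find_root r (1000 * ((M + 1) * (l + 1)))
    (\<lambda>r'. find_root_res (tri A0 A1 A2 p q) (r 30) \<delta> (r' 33) \<and> same_off find_root_regs r r')"
proof -
  let ?g = "tri A0 A1 A2 p q" and ?L = "r 30"
  have h1: "holds_tri (r(25 := x)) A0 A1 A2 p q" for x using h by (simp add: holds_tri_def)
  show ?thesis unfolding spec_def find_root_def
    apply simp
    apply (rule wpc_evl[OF h1 h(2,3)])
    subgoal premises prems for r1 k1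
    proof (cases "?g ?L \<ge> 0")
      case True
      then show ?thesis using prems
        by (simp add: find_root_res_def same_off_def find_root_regs_def evl_regs_def algebra_simps)
    next
      case False
      have e: "r1 30 = ?L" "r1 31 = \<delta>" "r1 32 = 1 / \<delta>"
        using prems d by (auto simp: same_off_def evl_regs_def)
      have h2: "holds_tri r1 A0 A1 A2 p q"
        using h prems by (simp add: holds_tri_def same_off_def evl_regs_def)
      have n': "nrm A1 A2 p q" using n False by simp
      have sp: "spec find_root_far r1 (850 * ((M + 1) * (l + 1)))
          (\<lambda>r'. find_root_res ?g (r1 30) \<delta> (r' 33) \<and> same_off find_root_regs r1 r')"
        by (rule spec_find_root_far[OF h2 n' h(3)]) (use e L d M False in auto)
      have "wpc find_root_far (\<lambda>r' k. k \<le> 1000 * ((M + 1) * (l + 1)) \<and>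
          find_root_res ?g ?L \<delta> (r' 33) \<and> same_off find_root_regs r r') r1 (Suc k1)"
      proof (rule wpc_call[OF sp])
        fix r2 k2 assume k2: "k2 \<le> Suc k1 + 850 * ((M + 1) * (l + 1))"
          and r2: "find_root_res ?g (r1 30) \<delta> (r2 33) \<and> same_off find_root_regs r1 r2"
        have "k2 \<le> 1000 * ((M + 1) * (l + 1))" using k2 prems by (simp add: algebra_simps)
        moreover have "same_off find_root_regs r r2" using r2 prems by (simp add: same_off_def find_root_regs_def)
        ultimately show "k2 \<le> 1000 * ((M + 1) * (l + 1)) \<and>
          find_root_res ?g ?L \<delta> (r2 33) \<and> same_off find_root_regs r r2" using r2 e by simp
      qed
      then show ?thesis using False prems by simp
    qed
    done
qed

section \<open>Two-stage search: the critical point, then the root behind it\<close>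

definition holds_coeffs :: "(nat \<Rightarrow> real) \<Rightarrow> real \<Rightarrow> real \<Rightarrow> real \<Rightarrow> nat \<Rightarrow> nat \<Rightarrow> bool" where
  "holds_coeffs r A0 A1 A2 p q \<longleftrightarrow>
     r 40 = A0 \<and> r 41 = A1 \<and> r 42 = A2 \<and> r 43 = real p \<and> r 44 = real q"

definition load :: com where
  "load = (20 <- V 40 ;; 21 <- V 41 ;; 22 <- V 42 ;; 23 <- V 43 ;; 24 <- V 44)"

text \<open>A zero middle coefficient and two equal exponents put the slope into the trinomial
  format expected by \<open>find_root\<close>.\<close>

definition load_slope :: com where
  "load_slope = (20 <- V 43 *: V 41 ;; 21 <- K 0 ;; 22 <- V 44 *: V 42 ;;
     23 <- V 44 -: V 43 ;; 24 <- V 44 -: V 43)"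

text \<open>Input: a trinomial in 40 to 44, \<open>\<delta>\<close> and \<open>1 / \<delta>\<close> in 31 and 32; output in 45.
  The first call of \<^const>\<open>find_root\<close> approximates the critical point from above, so that the second
  one starts where the trinomial is increasing and convex.\<close>

definition right :: com where
  "right = (load_slope ;; 30 <- K 1 ;; find_root ;; 25 <- V 33 ;; evl ;; 45 <- V 33 ;;
     If (V 26) (load ;; 30 <- V 45 ;; find_root ;; 45 <- V 33) (45 <- V 45))"

definition right_regs :: "nat set" where
  "right_regs = find_root_regs \<union> {20,21,22,23,24,30,45}"

lemma tri_eq_slope:
  "tri (real p * A1) 0 (real q * A2) (q - p) (q - p) = slope A1 A2 p q"
  by (auto simp: tri_def slope_def)

lemma find_root_res_ge:
  assumes "find_root_res g L \<delta> x" "0 < L" "0 < \<delta>" "\<delta> < 1"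
  shows "L \<le> x"
proof -
  have "L * \<delta> \<le> L * 1" using assms by (intro mult_left_mono) auto
  then have "L \<le> L / \<delta>" using assms by (simp add: field_simps)
  then show ?thesis using assms(1) unfolding find_root_res_def by auto
qed

lemma spec_right:
  assumes h: "holds_coeffs r A0 A1 A2 p q" "nrm A1 A2 p q" "q < 2 ^ l"
    and d: "r 31 = \<delta>" "r 32 = 1 / \<delta>" "0 < \<delta>" "\<delta> < 1"
    and M: "steps_suffice l M \<delta>"
  shows "spec right r (2300 * ((M + 1) * (l + 1)))
    (\<lambda>r'. (\<forall>z. 0 < z \<and> tri A0 A1 A2 p q z = 0 \<and> slope A1 A2 p q z \<ge> 0 \<longrightarrow>
        right_approx \<delta> z (r' 45)) \<and> 1 \<le> r' 45 \<and> same_off right_regs r r')"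
proof -
  let ?b = "tri (real p * A1) 0 (real q * A2) (q - p) (q - p)"
  have pq: "p \<le> q" using nrm_le(1)[OF h(2)] .
  define r0 where "r0 = r(20 := real p * A1, 21 := 0, 22 := real q * A2,
    23 := real (q - p), 24 := real (q - p), 30 := 1)"
  have h0: "holds_tri r0 (real p * A1) 0 (real q * A2) (q - p) (q - p)"
    by (simp add: holds_tri_def r0_def)
  have q2: "q - p < 2 ^ l" using h(3) by simp
  have n0: "nrm 0 (real q * A2) (q - p) (q - p) \<or> ?b (r0 30) \<ge> 0"
    using h(2) by (cases "p = q") (auto simp: nrm_def tri_def)
  have "slope 0 (real q * A2) (q - p) (q - p) (r0 30) \<ge> 0"
    using h(2) by (auto simp: nrm_def slope_def)
  then have sp: "spec find_root r0 (1000 * ((M + 1) * (l + 1)))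
      (\<lambda>r'. find_root_res ?b (r0 30) \<delta> (r' 33) \<and> same_off find_root_regs r0 r')"
    by (intro spec_find_root[OF h0 order_refl q2 n0] M) (use d in \<open>auto simp: r0_def\<close>)
  have e0: "r(20 := r 43 * r 41, 21 := 0, 22 := r 44 * r 42, 23 := r 44 - r 43,
      24 := r 44 - r 43, 30 := 1) = r0"
    using h pq by (simp add: r0_def holds_coeffs_def of_nat_diff)
  show ?thesis
    unfolding spec_def right_def load_slope_def load_def
    apply simp
    apply (subst e0)
    apply (rule wpc_call[OF sp])
    subgoal premises p1 for r1 k1
    proof -
      let ?L = "r1 33"
      have L: "find_root_res (slope A1 A2 p q) 1 \<delta> ?L" using p1 by (simp add: r0_def tri_eq_slope)
      have L1: "1 \<le> ?L" by (rule find_root_res_ge[OF L]) (use d in auto)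
      then have L0: "0 < ?L" by simp
      have h1: "holds_tri (r1(25 := x)) (real p * A1) 0 (real q * A2) (q - p) (q - p)" for x
        using h0 p1 by (simp add: holds_tri_def same_off_def find_root_regs_def evl_regs_def)
      show ?thesis
        apply simp
        apply (rule wpc_evl[OF h1 order_refl q2])
        subgoal premises p2 for r2 k2
        proof (cases "slope A1 A2 p q ?L \<ge> 0")
          case False
          have "right_approx \<delta> z ?L" if "0 < z" "slope A1 A2 p q z \<ge> 0" for z
            using right_approx_critical[OF h(2) that d(3,4) L] False by simp
          moreover have "k2 + 20 \<le> 2300 * ((M + 1) * (l + 1))"
            using p1(1) p2(1) by (simp add: algebra_simps)
          moreover have "\<not> 0 \<le> r2 26" "r2 33 = ?L" "same_off right_regs r r2"
            using False p1 p2
            by (simp_all add: tri_eq_slope same_off_def right_regs_def find_root_regs_def evl_regs_def r0_def)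
          ultimately show ?thesis using L1 by (simp add: same_off_def right_regs_def)
        next
          case True
          define r3 where "r3 = r2(45 := ?L, 20 := A0, 21 := A1, 22 := A2,
            23 := real p, 24 := real q, 30 := ?L)"
          have h3: "holds_tri r3 A0 A1 A2 p q" by (simp add: holds_tri_def r3_def)
          have e3: "r3 30 = ?L" "r3 31 = \<delta>" "r3 32 = 1 / \<delta>"
            using p1 p2 d by (auto simp: r3_def r0_def same_off_def find_root_regs_def evl_regs_def)
          have r3: "r2(45 := r2 33, 20 := r2 40, 21 := r2 41, 22 := r2 42, 23 := r2 43, 24 := r2 44,
              30 := r2 33) = r3"
            using p1 p2 h
            by (simp add: r3_def r0_def holds_coeffs_def same_off_def find_root_regs_def evl_regs_def)
          have sp3: "spec find_root r3 (1000 * ((M + 1) * (l + 1)))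
            (\<lambda>r'. find_root_res (tri A0 A1 A2 p q) (r3 30) \<delta> (r' 33) \<and> same_off find_root_regs r3 r')"
            by (rule spec_find_root[OF h3 pq h(3)]) (use e3 h L0 True d M in auto)
          have c: "0 \<le> r2 26" using True p2 by (simp add: tri_eq_slope)
          show ?thesis
            using c
            apply simp
            apply (subst r3)
            apply (rule wpc_call[OF sp3])
            subgoal premises p3 for r4 k4
            proof -
              have "right_approx \<delta> z (r4 33)"
                if "0 < z" "tri A0 A1 A2 p q z = 0" "slope A1 A2 p q z \<ge> 0" for z
                using right_approx_root[OF h(2) that d(3,4) L True] p3 e3 by simp
              moreover have "1 \<le> r4 33"
                using find_root_res_ge[of _ ?L \<delta> "r4 33"] p3 e3 L1 d by force
              moreover have "same_off right_regs r (r4(45 := r4 33))"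
                using p1 p2 p3
                by (simp add: r3_def r0_def same_off_def right_regs_def find_root_regs_def evl_regs_def)
              ultimately show ?thesis using p1 p2 p3 by (simp add: algebra_simps)
            qed
            done
        qed
        done
    qed
    done
qed

text \<open>The second alternative is a nonzero constant, which is what remains of a monomial after
  division by its power of \<open>x\<close>.\<close>

definition normal :: "real \<Rightarrow> real \<Rightarrow> real \<Rightarrow> nat \<Rightarrow> nat \<Rightarrow> bool" where
  "normal A0 A1 A2 p q \<longleftrightarrow> A0 \<noteq> 0 \<and> (nrm A1 A2 p q \<or> A1 = 0 \<and> A2 = 0 \<and> p = 0 \<and> q = 0)"

lemma normal_le: "normal A0 A1 A2 p q \<Longrightarrow> p \<le> q"
  using nrm_le by (auto simp: normal_def)

lemma finite_roots_tri:
  assumes "normal A0 A1 A2 p q"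
  shows "finite {z. tri A0 A1 A2 p q z = 0}"
proof -
  let ?P = "[:A0:] + monom A1 p + monom A2 q"
  have P: "poly ?P z = tri A0 A1 A2 p q z" for z by (simp add: tri_def poly_monom)
  have "tri A0 A1 A2 p q 0 \<noteq> 0"
    using assms by (cases "nrm A1 A2 p q") (simp_all add: normal_def tri_0, simp add: tri_def)
  then have "?P \<noteq> 0" using P[of 0] by (metis poly_0)
  then have "finite {z. poly ?P z = 0}" by (rule poly_roots_finite)
  then show ?thesis unfolding P .
qed

text \<open>Register 49 receives the sign of the discriminant in a form that avoids extracting roots.\<close>

definition discr :: com where
  "discr =
    (10 <- V 40 *: V 44 /: ((K 0 -: V 41) *: (V 44 -: V 43)) ;; 11 <- V 44 -: V 43 ;; pow ;; 49 <- V 12 ;;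
     10 <- (K 0 -: V 41) *: V 43 /: (V 42 *: V 44) ;; 11 <- V 43 ;; pow ;; 49 <- V 49 -: V 12)"

text \<open>Input: a trinomial in 40 to 44 and \<open>x\<close> in 47; output: the number of roots in \<open>(0, x]\<close> in 48.\<close>

definition count :: com where
  "count = (load ;; 25 <- V 47 ;; evl ;;
     If (K 0 -: V 42) (48 <- K 0)
      (If (V 40)
        (If (V 41) (48 <- K 0)
          (discr ;;
           If (V 27)
             (If (V 49) (If (K 0 -: V 49) (48 <- K 1) (48 <- K 0))
                        (If (V 26) (48 <- K 2) (48 <- K 1)))
             (If (K 0 -: V 26) (48 <- K 1) (48 <- K 0))))
        (If (V 26) (48 <- K 1) (48 <- K 0))))"

definition count_regs :: "nat set" where
  "count_regs = evl_regs \<union> {20,21,22,23,24,25,48,49}"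

lemma spec_discr:
  assumes h: "holds_coeffs r A0 A1 A2 p q" "p \<le> q" "q < 2 ^ l"
  shows "spec discr r (100 * (l + 1)) (\<lambda>r'.
    r' 49 = (A0 * real q / (- A1 * real (q - p))) ^ (q - p) - (- A1 * real p / (A2 * real q)) ^ p \<and>
    same_off {10,11,12,13,14,49} r r')"
proof -
  have l: "q - p < 2 ^ l" "p < 2 ^ l" using h by auto
  show ?thesis unfolding spec_def discr_def
    apply simp
    apply (rule wpc_call[OF spec_pow[of _ "q - p" l]])
      apply (use h in \<open>simp add: holds_coeffs_def of_nat_diff\<close>)
     apply (rule l)
    apply simp
    apply (rule wpc_call[OF spec_pow[of _ p l]])
      apply (use h in \<open>simp add: holds_coeffs_def same_off_def\<close>)
     apply (rule l)
    apply (use h in \<open>simp add: holds_coeffs_def same_off_def of_nat_diff\<close>)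
    done
qed

lemma spec_count:
  assumes h: "holds_coeffs r A0 A1 A2 p q" "normal A0 A1 A2 p q" "q < 2 ^ l" and x: "0 < r 47"
  shows "spec count r (250 * (l + 1)) (\<lambda>r'.
    r' 48 = real (card (pos_roots (tri A0 A1 A2 p q) (r 47))) \<and>
    r' 26 = tri A0 A1 A2 p q (r 47) \<and> same_off count_regs r r')"
proof -
  let ?g = "tri A0 A1 A2 p q" and ?x = "r 47"
  have pq: "p \<le> q" using h by (simp add: normal_le)
  define r0 where "r0 = r(20 := A0, 21 := A1, 22 := A2, 23 := real p, 24 := real q, 25 := ?x)"
  have h0: "holds_tri r0 A0 A1 A2 p q" by (simp add: holds_tri_def r0_def)
  have e0: "r(20 := r 40, 21 := r 41, 22 := r 42, 23 := r 43, 24 := r 44, 25 := ?x) = r0"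
    using h by (simp add: r0_def holds_coeffs_def)
  \<comment> \<open>For positive \<open>x\<close> the two signs agree, so the position of
    \<open>x\<close> relative to the critical point is read from register 27, a by-product of
    \<open>evl\<close>.\<close>
  have sl: "etri A1 A2 p q ?x \<ge> 0 \<longleftrightarrow> slope A1 A2 p q ?x \<ge> 0"
    using zero_less_power[OF x, of p] by (auto simp: etri_eq[OF pq] zero_le_mult_iff)
  show ?thesis unfolding spec_def count_def load_def
    apply simp
    apply (subst e0)
    apply (rule wpc_evl[OF h0 pq h(3)])
    subgoal premises p1 for r1 k1
    proof -
      have g: "r1 26 = ?g ?x" "r1 27 = etri A1 A2 p q ?x" and r1: "same_off count_regs r r1"
        using p1 by (auto simp: r0_def same_off_def count_regs_def)
      have h1: "holds_coeffs r1 A0 A1 A2 p q"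
        using h r1 by (simp add: holds_coeffs_def same_off_def count_regs_def evl_regs_def)
      have c1: "r1 40 = A0" "r1 41 = A1" "r1 42 = A2" using h1 by (auto simp: holds_coeffs_def)
      consider "A2 = 0" | "A0 < 0" "nrm A1 A2 p q" | "A0 > 0" "A1 \<ge> 0" "nrm A1 A2 p q"
        | "A0 > 0" "A1 < 0" "nrm A1 A2 p q"
        using h(2) unfolding normal_def by linarith
      then show ?thesis
      proof cases
        case 1
        then have "?g = (\<lambda>x. A0)" "A0 \<noteq> 0" using h(2) by (auto simp: normal_def nrm_def tri_def)
        then show ?thesis using 1 c1 g r1 p1
          by (simp add: pos_roots_def same_off_def count_regs_def)
      next
        case 2
        then have "A2 > 0" by (simp add: nrm_def)
        then show ?thesis using 2 c1 g r1 p1 card_pos_roots_neg_const[OF 2(2,1) x]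
          by (simp add: same_off_def count_regs_def)
      next
        case 3
        then have "A2 > 0" by (simp add: nrm_def)
        then show ?thesis using 3 c1 g r1 p1 pos_roots_pos_coeffs[OF 3(3,1,2)]
          by (simp add: same_off_def count_regs_def)
      next
        case 4
        then have A2: "A2 > 0" by (simp add: nrm_def)
        obtain m where m: "0 < m" "slope A1 A2 p q m = 0"
          using slope_root_exists[OF 4(3,2)] .
        note D = discriminant_sgn[OF 4(3,1,2) m]
        note C = card_pos_roots_two_changes[OF 4(3,1,2) m x]
        show ?thesis using 4 A2
          apply (simp add: c1)
          apply (rule wpc_call[OF spec_discr[OF h1 pq h(3)]])
          subgoal premises p2 for r2 k2
          proof -
            have r2: "r2 26 = ?g ?x" "r2 27 = etri A1 A2 p q ?x" "same_off count_regs r r2"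
              using p2 g r1 by (auto simp: same_off_def count_regs_def evl_regs_def)
            have d2: "?g m \<ge> 0 \<longleftrightarrow> 0 \<le> r2 49" "?g m \<le> 0 \<longleftrightarrow> r2 49 \<le> 0"
              using D p2 by auto
            have k2: "k2 + 10 \<le> 250 * (l + 1)" using p1 p2 by simp
            show ?thesis using r2 d2 k2
              unfolding C sl[symmetric] by (simp add: same_off_def count_regs_def)
          qed
          done
      qed
    qed
    done
qed

section \<open>From sparse polynomials to normalised trinomials\<close>

definition holds_norm :: "(nat \<Rightarrow> real) \<Rightarrow> real \<Rightarrow> real \<Rightarrow> real \<Rightarrow> nat \<Rightarrow> nat \<Rightarrow> bool" where
  "holds_norm r A0 A1 A2 p q \<longleftrightarrow>
     r 50 = A0 \<and> r 51 = A1 \<and> r 52 = A2 \<and> r 53 = real p \<and> r 54 = real q"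

definition holds_input :: "(nat \<Rightarrow> real) \<Rightarrow> nat \<Rightarrow> (nat \<Rightarrow> real) \<Rightarrow> (nat \<Rightarrow> nat) \<Rightarrow> bool" where
  "holds_input r t c e \<longleftrightarrow> r 0 = real t \<and> r 1 = c 0 \<and> r 2 = c 1 \<and> r 3 = c 2 \<and>
     r 4 = real (e 0) \<and> r 5 = real (e 1) \<and> r 6 = real (e 2)"

text \<open>The leading coefficient may still be negative. This is the state after reading the input
  and again after the reflection of the variable; \<open>fix_sign\<close> turns it into
  \<open>normal\<close>.\<close>

definition prenormal :: "real \<Rightarrow> real \<Rightarrow> real \<Rightarrow> nat \<Rightarrow> nat \<Rightarrow> bool" where
  "prenormal A0 A1 A2 p q \<longleftrightarrow> A0 \<noteq> 0 \<and>
     (A2 \<noteq> 0 \<and> 0 < p \<and> (p < q \<or> p = q \<and> A1 = 0) \<or> A1 = 0 \<and> A2 = 0 \<and> p = 0 \<and> q = 0)"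

text \<open>A binomial is stored as a trinomial with \<open>p = q\<close> and vanishing middle coefficient.\<close>

definition prep :: com where
  "prep = If (V 0 -: K 3)
     (50 <- V 1 ;; 51 <- V 2 ;; 52 <- V 3 ;; 53 <- V 5 -: V 4 ;; 54 <- V 6 -: V 4)
     (If (V 0 -: K 2)
       (50 <- V 1 ;; 51 <- K 0 ;; 52 <- V 2 ;; 53 <- V 5 -: V 4 ;; 54 <- V 5 -: V 4)
       (50 <- V 1 ;; 51 <- K 0 ;; 52 <- K 0 ;; 53 <- K 0 ;; 54 <- K 0))"

definition fix_sign :: com where
  "fix_sign = If (V 52) (50 <- V 50)
     (50 <- K 0 -: V 50 ;; 51 <- K 0 -: V 51 ;; 52 <- K 0 -: V 52)"

text \<open>Dividing by the lowest power of \<open>x\<close> leaves a nonzero constant term, so 0 is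
  a root only through that power; hence its separate mention in the equivalence.\<close>

lemma spec_prep:
  assumes h: "holds_input r t c e" and v: "valid_enc t c e"
  shows "spec prep r 20 (\<lambda>r'. \<exists>A0 A1 A2 p q. holds_norm r' A0 A1 A2 p q \<and>
    prenormal A0 A1 A2 p q \<and> q \<le> degree (spoly t c e) \<and>
    (\<forall>x. poly (spoly t c e) x = 0 \<longleftrightarrow> 0 < e 0 \<and> x = 0 \<or> tri A0 A1 A2 p q x = 0) \<and>
    same_off {50,51,52,53,54} r r')"
proof -
  have t: "t = 1 \<or> t = 2 \<or> t = 3" using v by (auto simp: valid_enc_def)
  have c: "c i \<noteq> 0" if "i < t" for i using v that by (auto simp: valid_enc_def)
  have e: "e i < e j" if "i < j" "j < t" for i j using v that by (auto simp: valid_enc_def)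
  have pw: "x ^ n = x ^ m * x ^ (n - m)" if "m \<le> n" for x :: real and m n :: nat
    using that by (simp flip: power_add)
  show ?thesis
    using t
  proof (elim disjE)
    assume t: "t = 1"
    have c': "c 0 \<noteq> 0" using c t by auto
    have f: "spoly t c e = monom (c 0) (e 0)" by (simp add: spoly_def t)
    have "poly (spoly t c e) x = 0 \<longleftrightarrow> 0 < e 0 \<and> x = 0 \<or> tri (c 0) 0 0 0 0 x = 0" for x
      using c' by (auto simp: f poly_monom tri_def)
    moreover have "prenormal (c 0) 0 0 0 0" using c' by (simp add: prenormal_def)
    ultimately show ?thesis using h t unfolding spec_def prep_def
      by (simp add: holds_norm_def holds_input_def same_off_def)
  next
    assume t: "t = 2"
    have c': "c 0 \<noteq> 0" "c 1 \<noteq> 0" using c t by auto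
    have e01: "e 0 < e 1" using e t by simp
    have f: "spoly t c e = monom (c 0) (e 0) + monom (c 1) (e 1)"
      by (simp add: spoly_def t numeral_2_eq_2)
    let ?p = "e 1 - e 0"
    have "poly (spoly t c e) x = x ^ e 0 * tri (c 0) 0 (c 1) ?p ?p x" for x
      using pw[of "e 0" "e 1" x] e01 by (simp add: f poly_monom tri_def algebra_simps)
    moreover have "tri (c 0) 0 (c 1) ?p ?p 0 \<noteq> 0" using c' e01 by (simp add: tri_def zero_power)
    ultimately have "poly (spoly t c e) x = 0 \<longleftrightarrow> 0 < e 0 \<and> x = 0 \<or> tri (c 0) 0 (c 1) ?p ?p x = 0" for x
      by (auto simp: zero_power)
    moreover have "prenormal (c 0) 0 (c 1) ?p ?p"
      using c' e01 by (simp add: prenormal_def)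
    moreover have "e 1 \<le> degree (spoly t c e)"
      using c' e01 by (intro le_degree) (simp add: f)
    then have "?p \<le> degree (spoly t c e)" by simp
    moreover have "real ?p = real (e 1) - real (e 0)" using e01 by (simp add: of_nat_diff)
    ultimately show ?thesis using h t unfolding spec_def prep_def
      by (simp add: holds_norm_def holds_input_def same_off_def)
        (intro exI[of _ "c 0"] exI[of _ "0::real"] exI[of _ "c 1"] exI[of _ ?p] conjI; simp)
  next
    assume t: "t = 3"
    have c': "c 0 \<noteq> 0" "c 2 \<noteq> 0" using c t by auto
    have e01: "e 0 < e 1" "e 1 < e 2" using e[of 0 1] e[of 1 2] t by simp_all
    have f: "spoly t c e = monom (c 0) (e 0) + monom (c 1) (e 1) + monom (c 2) (e 2)"
      by (simp add: spoly_def t numeral_3_eq_3 numeral_2_eq_2)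
    let ?p = "e 1 - e 0" and ?q = "e 2 - e 0"
    have "poly (spoly t c e) x = x ^ e 0 * tri (c 0) (c 1) (c 2) ?p ?q x" for x
      using pw[of "e 0" "e 1" x] pw[of "e 0" "e 2" x] e01
      by (simp add: f poly_monom tri_def algebra_simps)
    moreover have "tri (c 0) (c 1) (c 2) ?p ?q 0 \<noteq> 0" using c' e01 by (simp add: tri_def zero_power)
    ultimately have "poly (spoly t c e) x = 0 \<longleftrightarrow>
        0 < e 0 \<and> x = 0 \<or> tri (c 0) (c 1) (c 2) ?p ?q x = 0" for x
      by (auto simp: zero_power)
    moreover have "prenormal (c 0) (c 1) (c 2) ?p ?q"
      using c' e01 by (auto simp: prenormal_def)
    moreover have "e 2 \<le> degree (spoly t c e)"
      using c' e01 by (intro le_degree) (simp add: f)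
    then have "?q \<le> degree (spoly t c e)" by simp
    moreover have "real ?p = real (e 1) - real (e 0)" "real ?q = real (e 2) - real (e 0)"
      using e01 by (simp_all add: of_nat_diff)
    ultimately show ?thesis using h t unfolding spec_def prep_def
      by (simp add: holds_norm_def holds_input_def same_off_def)
        (intro exI[of _ "c 0"] exI[of _ "c 1"] exI[of _ "c 2"] exI[of _ ?p] exI[of _ ?q] conjI; simp)
  qed
qed

lemma spec_fix_sign:
  assumes "holds_norm r A0 A1 A2 p q" "prenormal A0 A1 A2 p q"
  shows "spec fix_sign r 10 (\<lambda>r'. \<exists>B0 B1 B2. holds_norm r' B0 B1 B2 p q \<and> normal B0 B1 B2 p q \<and>
    (\<forall>x. tri B0 B1 B2 p q x = 0 \<longleftrightarrow> tri A0 A1 A2 p q x = 0) \<and> same_off {50,51,52} r r')"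
proof (cases "A2 \<ge> 0")
  case True
  then have "normal A0 A1 A2 p q" using assms by (auto simp: prenormal_def normal_def nrm_def)
  then show ?thesis using assms True unfolding spec_def fix_sign_def
    by (simp add: holds_norm_def same_off_def)
next
  case False
  then have "normal (- A0) (- A1) (- A2) p q"
    using assms by (auto simp: prenormal_def normal_def nrm_def)
  moreover have "tri (- A0) (- A1) (- A2) p q x = - tri A0 A1 A2 p q x" for x
    by (simp add: tri_def)
  ultimately show ?thesis using assms False unfolding spec_def fix_sign_def
    by (simp add: holds_norm_def same_off_def)
qed

definition setup_input :: com where "setup_input = (prep ;; fix_sign)"

lemma spec_setup_input:
  assumes h: "holds_input r t c e" and v: "valid_enc t c e"
  shows "spec setup_input r 30 (\<lambda>r'. \<exists>A0 A1 A2 p q. holds_norm r' A0 A1 A2 p q \<and>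
    normal A0 A1 A2 p q \<and> q \<le> degree (spoly t c e) \<and>
    (\<forall>x. poly (spoly t c e) x = 0 \<longleftrightarrow> 0 < e 0 \<and> x = 0 \<or> tri A0 A1 A2 p q x = 0) \<and>
    same_off {50,51,52,53,54} r r')"
  unfolding spec_def setup_input_def
  apply simp
  apply (rule wpc_call[OF spec_prep[OF h v]])
  apply (elim exE conjE)
  subgoal for r1 k1 A0 A1 A2 p q
    apply (rule wpc_call[OF spec_fix_sign[of r1 A0 A1 A2 p q]])
      apply assumption+
    apply (elim exE conjE)
    subgoal for r2 k2 B0 B1 B2
      by (intro conjI exI[of _ B0] exI[of _ B1] exI[of _ B2] exI[of _ p] exI[of _ q])
        (auto simp: same_off_def)
    done
  done

section \<open>Counting roots in an interval\<close>

definition load_norm :: com where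
  "load_norm = (40 <- V 50 ;; 41 <- V 51 ;; 42 <- V 52 ;; 43 <- V 53 ;; 44 <- V 54)"

definition roots_upto :: "(real \<Rightarrow> real) \<Rightarrow> real \<Rightarrow> bool \<Rightarrow> real set" where
  "roots_upto g x c = {z. 0 < z \<and> g z = 0 \<and> (if c then z \<le> x else z < x)}"

text \<open>Input: a trinomial in 40 to 44, \<open>x\<close> in 74, whether to include \<open>x\<close> in 75;
  output: the number of positive roots up to \<open>x\<close> in 76.\<close>

definition count_upto :: com where
  "count_upto = If (K 0 -: V 74) (76 <- K 0)
     (47 <- V 74 ;; count ;; 76 <- V 48 ;;
      If (V 75 -: K 1) (76 <- V 76)
       (If (V 26) (If (K 0 -: V 26) (76 <- V 76 -: K 1) (76 <- V 76)) (76 <- V 76)))"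

lemma spec_count_upto:
  assumes h: "holds_coeffs r A0 A1 A2 p q" "normal A0 A1 A2 p q" "q < 2 ^ l"
    and c: "r 75 = of_bool_real c"
  shows "spec count_upto r (270 * (l + 1)) (\<lambda>r'.
    r' 76 = real (card (roots_upto (tri A0 A1 A2 p q) (r 74) c)) \<and>
    same_off (count_regs \<union> {47,76}) r r')"
proof -
  let ?g = "tri A0 A1 A2 p q" and ?x = "r 74"
  show ?thesis
  proof (cases "?x > 0")
    case False
    then have "roots_upto ?g ?x c = {}" by (auto simp: roots_upto_def)
    then show ?thesis using False by (simp add: spec_def count_upto_def same_off_def)
  next
    case True
    have fin: "finite (pos_roots ?g ?x)"
      by (rule finite_subset[OF _ finite_roots_tri[OF h(2)]]) (auto simp: pos_roots_def)
    \<comment> \<open>\<open>count\<close> always includes the end point, so an open end must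
      discard it if it is a root; register 26 still holds the value there.\<close>
    have card: "real (card (roots_upto ?g ?x c)) =
        real (card (pos_roots ?g ?x)) - (if \<not> c \<and> ?g ?x = 0 then 1 else 0)"
    proof -
      have 1: "roots_upto ?g ?x True = pos_roots ?g ?x"
        by (auto simp: roots_upto_def pos_roots_def)
      have 2: "roots_upto ?g ?x False = pos_roots ?g ?x - {?x}"
        by (auto simp: roots_upto_def pos_roots_def)
      have 3: "?x \<in> pos_roots ?g ?x \<longleftrightarrow> ?g ?x = 0" using True by (simp add: pos_roots_def)
      show ?thesis
      proof (cases "?x \<in> pos_roots ?g ?x")
        case True
        then have "card (pos_roots ?g ?x) > 0" using fin by (auto simp: card_gt_0_iff)
        then show ?thesis using 1 2 3 True fin by (cases c) (auto simp: of_nat_diff)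
      next
        case False
        then show ?thesis using 1 2 3 by (cases c) auto
      qed
    qed
    have h1: "holds_coeffs (r(47 := ?x)) A0 A1 A2 p q" using h by (simp add: holds_coeffs_def)
    have "\<not> 0 \<le> - ?x" using True by simp
    then show ?thesis unfolding spec_def count_upto_def
      apply simp
      apply (rule wpc_call[OF spec_count[OF h1 h(2,3)]])
      using True apply simp
      subgoal premises p1 for r1 k1
        using p1 c card by (auto simp: same_off_def count_regs_def evl_regs_def of_bool_real_def)
      done
  qed
qed

text \<open>A closed left end must keep \<open>a\<close>, so the subtracted set is open there: its
  flag is negated. If the interval is reversed, the inclusion between the two sets turns around and
  the difference can be negative, hence the cut at 0.\<close>

lemma card_roots_interval:
  fixes a b :: real and la rb :: bool
  assumes "finite {z. g z = 0}"
  defines "d \<equiv> real (card (roots_upto g b rb)) - real (card (roots_upto g a (\<not> la)))"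
  shows "real (card {z \<in> bint a b la rb. 0 < z \<and> g z = 0}) = (if d \<ge> 0 then d else 0)"
proof -
  let ?B = "roots_upto g b rb" and ?A = "roots_upto g a (\<not> la)"
  have fin: "finite ?A" "finite ?B"
    by (rule finite_subset[OF _ assms(1)], auto simp: roots_upto_def)+
  have eq: "{z \<in> bint a b la rb. 0 < z \<and> g z = 0} = ?B - ?A"
    by (auto simp: roots_upto_def bint_def)
  show ?thesis
  proof (cases "?A \<subseteq> ?B")
    case True
    then have "card (?B - ?A) = card ?B - card ?A" "card ?A \<le> card ?B"
      using fin by (auto intro: card_Diff_subset card_mono)
    then show ?thesis unfolding eq d_def by (simp add: of_nat_diff)
  next
    case False
    then obtain z where z: "z \<in> ?A" "z \<notin> ?B" by auto
    have "?B \<subseteq> ?A" using z by (auto simp: roots_upto_def split: if_splits)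
    then have e: "?B - ?A = {}" and le: "card ?B \<le> card ?A" using fin by (auto intro: card_mono)
    show ?thesis unfolding eq d_def e using le by simp
  qed
qed

text \<open>Input: a trinomial in 50 to 54, the interval in 77 to 80;
  output: the number of positive roots in the interval in 81.\<close>

definition count_pos :: com where
  "count_pos = (load_norm ;; 74 <- V 78 ;; 75 <- V 80 ;; count_upto ;; 81 <- V 76 ;;
     74 <- V 77 ;; 75 <- K 1 -: V 79 ;; count_upto ;; 81 <- V 81 -: V 76 ;;
     If (V 81) (81 <- V 81) (81 <- K 0))"

definition count_pos_regs :: "nat set" where
  "count_pos_regs = count_regs \<union> {40,41,42,43,44,47,74,75,76,81}"

lemma spec_count_pos:
  assumes h: "holds_norm r A0 A1 A2 p q" "normal A0 A1 A2 p q" "q < 2 ^ l"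
    and i: "r 77 = a" "r 78 = b" "r 79 = of_bool_real la" "r 80 = of_bool_real rb"
  shows "spec count_pos r (600 * (l + 1)) (\<lambda>r'.
    r' 81 = real (card {z \<in> bint a b la rb. 0 < z \<and> tri A0 A1 A2 p q z = 0}) \<and>
    same_off count_pos_regs r r')"
proof -
  define r0 where "r0 = r(40 := A0, 41 := A1, 42 := A2, 43 := real p, 44 := real q,
    74 := b, 75 := of_bool_real rb)"
  have e0: "r(40 := r 50, 41 := r 51, 42 := r 52, 43 := r 53, 44 := r 54, 74 := r 78, 75 := r 80) = r0"
    using h i by (simp add: r0_def holds_norm_def)
  have h0: "holds_coeffs r0 A0 A1 A2 p q" by (simp add: holds_coeffs_def r0_def)
  have c0: "r0 75 = of_bool_real rb" by (simp add: r0_def)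
  show ?thesis unfolding spec_def count_pos_def load_norm_def
    apply simp
    apply (subst e0)
    apply (rule wpc_call[OF spec_count_upto[OF h0 h(2,3) c0]])
    subgoal premises p1 for r1 k1
    proof -
      define r2 where "r2 = r1(81 := r1 76, 74 := r1 77, 75 := 1 - r1 79)"
      have h2: "holds_coeffs r2 A0 A1 A2 p q"
        using h0 p1 by (simp add: holds_coeffs_def same_off_def r2_def count_regs_def evl_regs_def)
      have e2: "r1 77 = a" "r1 79 = of_bool_real la"
        using p1 i by (auto simp: same_off_def count_regs_def evl_regs_def r0_def)
      then have c2: "r2 75 = of_bool_real (\<not> la)" by (simp add: r2_def of_bool_real_def)
      show ?thesis
        apply simp
        apply (subst r2_def[symmetric])
        apply (rule wpc_call[OF spec_count_upto[OF h2 h(2,3) c2]])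
        subgoal premises p2 for r3 k3
        proof -
          note C = card_roots_interval[OF finite_roots_tri[OF h(2)], of a b la rb]
          have "r3 81 = real (card (roots_upto (tri A0 A1 A2 p q) b rb))"
            "r3 76 = real (card (roots_upto (tri A0 A1 A2 p q) a (\<not> la)))"
            using p1 p2 e2 by (auto simp: r2_def r0_def same_off_def count_regs_def evl_regs_def)
          moreover have "same_off count_pos_regs r r3"
            using p1 p2
            by (simp add: r2_def r0_def same_off_def count_pos_regs_def count_regs_def evl_regs_def)
          moreover have "k3 + 20 \<le> 600 * (l + 1)" using p1(1) p2(1) by simp
          ultimately show ?thesis unfolding C
            by (simp add: same_off_def count_pos_regs_def)
        qed
        done
    qed
    done
qed

text \<open>Negative roots are counted as positive ones after x becomes -x, with end points and
  flags exchanged; the signs (-1)^p and (-1)^q come from \<open>pow\<close>, which replaces a parity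
  test. The interval is saved first because \<open>pow\<close> overwrites register 10.\<close>

definition count_interval :: com where
  "count_interval = (70 <- V 7 ;; 71 <- V 8 ;; 72 <- V 9 ;; 73 <- V 10 ;; setup_input ;;
     77 <- V 70 ;; 78 <- V 71 ;; 79 <- V 72 ;; 80 <- V 73 ;; count_pos ;; 82 <- V 81 ;;
     10 <- K (- 1) ;; 11 <- V 53 ;; pow ;; 51 <- V 51 *: V 12 ;;
     11 <- V 54 ;; pow ;; 52 <- V 52 *: V 12 ;; fix_sign ;;
     77 <- K 0 -: V 71 ;; 78 <- K 0 -: V 70 ;; 79 <- V 73 ;; 80 <- V 72 ;; count_pos ;;
     82 <- V 82 +: V 81 ;;
     If (V 72 -: K 1) (If (K 0 -: V 70) (83 <- K 1) (83 <- K 0)) (If (V 70) (83 <- K 0) (83 <- K 1)) ;;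
     If (V 73 -: K 1) (If (V 71) (84 <- K 1) (84 <- K 0)) (If (K 0 -: V 71) (84 <- K 0) (84 <- K 1)) ;;
     If (V 4 -: K 1) (0 <- V 82 +: V 83 *: V 84) (0 <- V 82))"

lemma card_roots_split:
  fixes g :: "real \<Rightarrow> real"
  assumes fin: "finite {z. g z = 0}" and g0: "g 0 \<noteq> 0"
    and f: "\<And>x. poly f x = 0 \<longleftrightarrow> e \<and> x = 0 \<or> g x = 0"
  shows "card {x \<in> bint a b la rb. poly f x = 0} =
    card {x \<in> bint a b la rb. 0 < x \<and> g x = 0} +
    card {x \<in> bint (- b) (- a) rb la. 0 < x \<and> g (- x) = 0} +
    (if e \<and> 0 \<in> bint a b la rb then 1 else 0)"
proof -
  let ?P = "{x \<in> bint a b la rb. 0 < x \<and> g x = 0}"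
  let ?N = "{x \<in> bint (- b) (- a) rb la. 0 < x \<and> g (- x) = 0}"
  let ?N' = "{x \<in> bint a b la rb. x < 0 \<and> g x = 0}"
  let ?Z = "if e \<and> 0 \<in> bint a b la rb then {0} else {} :: real set"
  have finP: "finite ?P" "finite ?N'" by (rule finite_subset[OF _ fin], auto)+
  have N: "uminus ` ?N = ?N'"
  proof
    show "uminus ` ?N \<subseteq> ?N'" by (auto simp: bint_def split: if_splits)
    show "?N' \<subseteq> uminus ` ?N"
    proof
      fix x assume "x \<in> ?N'"
      then have "- x \<in> ?N" by (auto simp: bint_def split: if_splits)
      then show "x \<in> uminus ` ?N" by (rule rev_image_eqI) simp
    qed
  qed
  have "inj_on uminus ?N" by simp
  from card_image[OF this] have N_card: "card ?N' = card ?N" unfolding N .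
  have "0 < x \<or> x < 0" if "g x = 0" for x
    using that g0 by (cases x "0::real" rule: linorder_cases) auto
  then have Z_eq: "{x \<in> bint a b la rb. poly f x = 0} = ?P \<union> ?N' \<union> ?Z"
    using g0 unfolding f by (auto split: if_splits)
  have "card {x \<in> bint a b la rb. poly f x = 0} = card (?P \<union> ?N' \<union> ?Z)"
    by (rule arg_cong[OF Z_eq])
  also have "card (?P \<union> ?N' \<union> ?Z) = card ?P + card ?N' + card ?Z"
    using finP by (subst card_Un_disjoint; (subst card_Un_disjoint)?) auto
  also have "card ?Z = (if e \<and> 0 \<in> bint a b la rb then 1 else 0)" by simp
  finally show ?thesis unfolding N_card .
qed

lemma spec_count_interval:
  assumes h: "holds_input r t c e" and v: "valid_enc t c e" and l: "degree (spoly t c e) < 2 ^ l"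
    and i: "r 7 = a" "r 8 = b" "r 9 = of_bool_real la" "r 10 = of_bool_real rb"
  shows "spec count_interval r (1500 * (l + 1)) (\<lambda>r'.
    r' 0 = real (card {x \<in> bint a b la rb. poly (spoly t c e) x = 0}))"
proof -
  let ?f = "spoly t c e"
  have h0: "holds_input (r(70 := r 7, 71 := r 8, 72 := r 9, 73 := r 10)) t c e"
    using h by (simp add: holds_input_def)
  show ?thesis unfolding spec_def count_interval_def
    apply simp
    apply (rule wpc_call[OF spec_setup_input[OF h0 v]])
    subgoal premises p1 for r1 k1
    proof -
      from p1(2) obtain A0 A1 A2 p q where h1: "holds_norm r1 A0 A1 A2 p q"
        and n: "normal A0 A1 A2 p q" and q: "q \<le> degree ?f"
        and f: "\<And>x. poly ?f x = 0 \<longleftrightarrow> 0 < e 0 \<and> x = 0 \<or> tri A0 A1 A2 p q x = 0"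
        and s1: "same_off {50,51,52,53,54} (r(70 := r 7, 71 := r 8, 72 := r 9, 73 := r 10)) r1"
        by blast
      let ?g = "tri A0 A1 A2 p q"
      have ql: "q < 2 ^ l" "p < 2 ^ l" using q l normal_le[OF n] by auto
      have g0: "?g 0 \<noteq> 0"
        using n by (cases "nrm A1 A2 p q") (simp_all add: normal_def tri_0, simp add: tri_def)
      note C = card_roots_split[OF finite_roots_tri[OF n] g0 f, of a b la rb]
      have e1: "r1 70 = a" "r1 71 = b" "r1 72 = of_bool_real la" "r1 73 = of_bool_real rb"
        "r1 4 = real (e 0)"
        using s1 i h by (auto simp: same_off_def holds_input_def)
      define r2 where "r2 = r1(77 := a, 78 := b, 79 := of_bool_real la, 80 := of_bool_real rb)"
      have h2: "holds_norm r2 A0 A1 A2 p q" using h1 by (simp add: r2_def holds_norm_def)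
      have sp2: "spec count_pos r2 (600 * (l + 1)) (\<lambda>r'.
          r' 81 = real (card {z \<in> bint a b la rb. 0 < z \<and> ?g z = 0}) \<and>
          same_off count_pos_regs r2 r')"
        by (rule spec_count_pos[OF h2 n ql(1)]) (auto simp: r2_def)
      show ?thesis
        apply (simp add: e1)
        apply (subst r2_def[symmetric])
        apply (rule wpc_call[OF sp2])
        subgoal premises p2 for r3 k3
        proof -
          have e3: "r3 70 = a" "r3 71 = b" "r3 72 = of_bool_real la" "r3 73 = of_bool_real rb"
            "r3 4 = real (e 0)" "holds_norm r3 A0 A1 A2 p q"
            using p2 e1 h2
            by (auto simp: same_off_def r2_def count_pos_regs_def count_regs_def evl_regs_def
                holds_norm_def)
          then have n3: "r3 50 = A0" "r3 51 = A1" "r3 52 = A2" "r3 53 = real p" "r3 54 = real q"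
            by (auto simp: holds_norm_def)
          show ?thesis
            apply simp
            apply (rule wpc_call[OF spec_pow[of _ p l]])
              apply (simp add: n3)
             apply (rule ql)
            subgoal premises p4 for r4 k4
            proof -
              have e4: "r4 70 = a" "r4 71 = b" "r4 72 = of_bool_real la" "r4 73 = of_bool_real rb"
                "r4 4 = real (e 0)" "r4 82 = real (card {z \<in> bint a b la rb. 0 < z \<and> ?g z = 0})"
                "r4 10 = -1"
                "r4 50 = A0" "r4 51 = A1" "r4 52 = A2" "r4 53 = real p" "r4 54 = real q"
                "r4 12 = (- 1) ^ p"
                using p2 p4 e3 n3 by (auto simp: same_off_def)
              show ?thesis
                apply simp
                apply (rule wpc_call[OF spec_pow[of _ q l]])
                  apply (simp add: e4)
                 apply (rule ql)
                subgoal premises p5 for r5 k5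
                proof -
                  define r6 where "r6 = r5(52 := r5 52 * r5 12)"
                  let ?B1 = "A1 * (- 1) ^ p" and ?B2 = "A2 * (- 1) ^ q"
                  have h6: "holds_norm r6 A0 ?B1 ?B2 p q"
                    using p5 e4 by (simp add: r6_def holds_norm_def same_off_def)
                  \<comment> \<open>The reflection may make the leading coefficient negative, so the
                    sign has to be fixed a second time.\<close>
                  have pn: "prenormal A0 ?B1 ?B2 p q"
                    using n by (auto simp: normal_def prenormal_def nrm_def)
                  have e6: "r6 70 = a" "r6 71 = b" "r6 72 = of_bool_real la" "r6 73 = of_bool_real rb"
                    "r6 4 = real (e 0)" "r6 82 = real (card {z \<in> bint a b la rb. 0 < z \<and> ?g z = 0})"
                    using p5 e4 by (auto simp: same_off_def r6_def)
                  show ?thesis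
                    apply simp
                    apply (subst r6_def[symmetric])
                    apply (rule wpc_call[OF spec_fix_sign[OF h6 pn]])
                    subgoal premises p7 for r7 k7
                    proof -
                      from p7(2) obtain B0 B1 B2 where h7: "holds_norm r7 B0 B1 B2 p q"
                        and n7: "normal B0 B1 B2 p q"
                        and g7: "\<And>x. tri B0 B1 B2 p q x = 0 \<longleftrightarrow> tri A0 ?B1 ?B2 p q x = 0"
                        and s7: "same_off {50,51,52} r6 r7" by blast
                      \<comment> \<open>Reflection is the instance of \<open>tri_scale\<close> with
                        factor -1.\<close>
                      have g7': "tri B0 B1 B2 p q x = 0 \<longleftrightarrow> ?g (- x) = 0" for x
                        unfolding g7 using tri_scale[of A0 A1 "-1" p A2 q x] by simp
                      have e7: "r7 70 = a" "r7 71 = b" "r7 72 = of_bool_real la" "r7 73 = of_bool_real rb"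
                        "r7 4 = real (e 0)" "r7 82 = real (card {z \<in> bint a b la rb. 0 < z \<and> ?g z = 0})"
                        using s7 e6 by (auto simp: same_off_def)
                      define r8 where "r8 = r7(77 := - b, 78 := - a, 79 := of_bool_real rb,
                        80 := of_bool_real la)"
                      have h8: "holds_norm r8 B0 B1 B2 p q" using h7 by (simp add: r8_def holds_norm_def)
                      have "spec count_pos r8 (600 * (l + 1)) (\<lambda>r'.
                          r' 81 = real (card {z \<in> bint (- b) (- a) rb la. 0 < z \<and> tri B0 B1 B2 p q z = 0}) \<and>
                          same_off count_pos_regs r8 r')"
                        by (rule spec_count_pos[OF h8 n7 ql(1)]) (auto simp: r8_def)
                      then have sp8: "spec count_pos r8 (600 * (l + 1)) (\<lambda>r'.
                          r' 81 = real (card {z \<in> bint (- b) (- a) rb la. 0 < z \<and> ?g (- z) = 0}) \<and>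
                          same_off count_pos_regs r8 r')" unfolding g7' .
                      show ?thesis
                        apply (simp add: e7)
                        apply (subst r8_def[symmetric])
                        apply (rule wpc_call[OF sp8])
                        subgoal premises p9 for r9 k9
                        proof -
                          have e9: "r9 70 = a" "r9 71 = b" "r9 72 = of_bool_real la"
                            "r9 73 = of_bool_real rb" "r9 4 = real (e 0)"
                            "r9 82 = real (card {z \<in> bint a b la rb. 0 < z \<and> ?g z = 0})"
                            "r9 81 = real (card {z \<in> bint (- b) (- a) rb la. 0 < z \<and> ?g (- z) = 0})"
                            using p9 e7
                            by (auto simp: same_off_def r8_def count_pos_regs_def count_regs_def evl_regs_def)
                          have k9: "k9 + 50 \<le> 1500 * (l + 1)"
                            using p1(1) p2(1) p4(1) p5(1) p7(1) p9(1) by simp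
                          have e0: "1 \<le> real (e 0) \<longleftrightarrow> 0 < e 0" by linarith
                          show ?thesis using k9 unfolding C
                            by (cases la; cases rb)
                              (auto simp: e9 of_bool_real_def bint_def e0)
                        qed
                        done
                    qed
                    done
                qed
                done
            qed
            done
        qed
        done
    qed
    done
qed

section \<open>Approximating roots\<close>

text \<open>Roots of nonnegative slope are reached after scaling by \<open>\<delta> R\<close>,
  those of nonpositive slope after inverting the variable.\<close>

definition x_root :: com where
  "x_root = (40 <- V 50 ;; 10 <- V 31 *: V 7 ;; 11 <- V 53 ;; pow ;; 41 <- V 51 *: V 12 ;;
     11 <- V 54 ;; pow ;; 42 <- V 52 *: V 12 ;; 43 <- V 53 ;; 44 <- V 54 ;; right ;;
     64 <- V 31 *: V 7 *: V 45 ;; If (V 64 -: V 7) (64 <- V 7) (64 <- V 64))"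

definition y_root :: com where
  "y_root = (42 <- V 50 ;; 10 <- V 7 ;; 11 <- V 53 ;; pow ;; 41 <- V 51 *: V 12 ;;
     11 <- V 54 ;; pow ;; 40 <- V 52 *: V 12 ;; 43 <- V 54 -: V 53 ;; 44 <- V 54 ;; right ;;
     63 <- V 7 /: V 45)"

definition root_regs :: "nat set" where
  "root_regs = right_regs \<union> {40,41,42,43,44}"

lemmas regs_defs = root_regs_def right_regs_def find_root_regs_def evl_regs_def

lemma spec_x_root:
  assumes h: "holds_norm r A0 A1 A2 p q" "nrm A1 A2 p q" "q < 2 ^ l"
    and R: "r 7 = R" "0 < R"
    and d: "r 31 = \<delta>" "r 32 = 1 / \<delta>" "0 < \<delta>" "\<delta> < 1"
    and M: "steps_suffice l M \<delta>"
  shows "spec x_root r (2500 * ((M + 1) * (l + 1))) (\<lambda>r'. 0 \<le> r' 64 \<and> r' 64 \<le> R \<and>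
    (\<forall>z. 0 < z \<and> z \<le> R \<and> tri A0 A1 A2 p q z = 0 \<and> slope A1 A2 p q z \<ge> 0 \<longrightarrow>
       \<bar>z - r' 64\<bar> \<le> \<delta> * R) \<and> same_off (insert 64 root_regs) r r')"
proof -
  have pq: "p \<le> q" using nrm_le(1)[OF h(2)] .
  have pl: "p < 2 ^ l" using pq h(3) by simp
  let ?c = "\<delta> * R"
  have c0: "?c > 0" using d R by simp
  note n = nrm_scale[OF c0 h(2)]
  have e0: "r 50 = A0" "r 51 = A1" "r 52 = A2" "r 53 = real p" "r 54 = real q"
    using h by (auto simp: holds_norm_def)
  show ?thesis unfolding spec_def x_root_def
    apply simp
    apply (rule wpc_call[OF spec_pow[of _ p l]])
      apply (simp add: e0)
     apply (rule pl)
    apply simp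
    apply (rule wpc_call[OF spec_pow[of _ q l]])
      apply (simp add: e0 same_off_def)
     apply (rule h(3))
    subgoal premises p1 for r1 k1 r2 k2
    proof -
      have e2: "r2 50 = A0" "r2 51 = A1" "r2 52 = A2" "r2 53 = real p" "r2 54 = real q"
        "r2 40 = A0" "r2 41 = A1 * ?c ^ p" "r2 12 = ?c ^ q" "r2 31 = \<delta>" "r2 32 = 1 / \<delta>" "r2 7 = R"
        using p1 e0 R d by (auto simp: same_off_def)
      define r3 where "r3 = r2(42 := A2 * ?c ^ q, 43 := real p, 44 := real q)"
      have h3: "holds_coeffs r3 A0 (A1 * ?c ^ p) (A2 * ?c ^ q) p q"
        using e2 by (simp add: holds_coeffs_def r3_def)
      have e3: "r3 31 = \<delta>" "r3 32 = 1 / \<delta>" using e2 by (auto simp: r3_def)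
      have s3: "same_off root_regs r r3"
        using p1 by (simp add: same_off_def regs_defs r3_def)
      show ?thesis
        apply (simp add: e2)
        apply (subst r3_def[symmetric])
        apply (rule wpc_call[OF spec_right[OF h3 n h(3) e3 d(3,4) M]])
        subgoal premises p4 for r4 k4
        proof -
          have e4: "r4 31 = \<delta>" "r4 7 = R" using p4 e2 by (auto simp: same_off_def r3_def regs_defs)
          have r4: "right_approx \<delta> (z / ?c) (r4 45)"
            if "0 < z" "z \<le> R" "tri A0 A1 A2 p q z = 0" "slope A1 A2 p q z \<ge> 0" for z
          proof -
            have cz: "?c * (z / ?c) = z" using d R by simp
            have "0 < z / ?c" using that c0 by (intro divide_pos_pos)
            moreover have "tri A0 (A1 * ?c ^ p) (A2 * ?c ^ q) p q (z / ?c) = 0"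
              unfolding tri_scale cz by (fact that)
            moreover have "slope (A1 * ?c ^ p) (A2 * ?c ^ q) p q (z / ?c) \<ge> 0"
              using that c0 unfolding slope_scale[OF pq] cz by (intro mult_nonneg_nonneg) auto
            ultimately show ?thesis using p4 by blast
          qed
          have m: "\<bar>z - min R (?c * r4 45)\<bar> \<le> ?c"
            if "0 < z" "z \<le> R" "tri A0 A1 A2 p q z = 0" "slope A1 A2 p q z \<ge> 0" for z
            using right_approx_scale[OF r4[OF that] d(3) R(2) that(1,2)] by simp
          have "0 \<le> ?c * r4 45" by (rule mult_nonneg_nonneg) (use c0 p4 in auto)
          then have m0: "0 \<le> min R (?c * r4 45)" "min R (?c * r4 45) \<le> R" using R by auto
          have k4: "k4 + 20 \<le> 2500 * ((M + 1) * (l + 1))"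
            using p1(1,3) p4(1) by (simp add: algebra_simps)
          have s4: "same_off root_regs r r4"
            using s3 p4 by (simp add: same_off_def regs_defs)
          show ?thesis
          proof (cases "R \<le> ?c * r4 45")
            case True
            then have "min R (?c * r4 45) = R" by simp
            then show ?thesis using True m m0 k4 s4 e4 by (simp add: same_off_def)
          next
            case False
            then have eq: "min R (?c * r4 45) = ?c * r4 45" by simp
            \<comment> \<open>The negated test of the program after cancelling \<open>R\<close>, the
              form in which the simplifier meets it.\<close>
            have "\<not> 1 \<le> \<delta> * r4 45"
            proof
              assume "1 \<le> \<delta> * r4 45"
              then have "R * 1 \<le> R * (\<delta> * r4 45)" using R by (intro mult_left_mono) auto
              then show False using False by (simp add: mult_ac)
            qed
            then show ?thesis using m[unfolded eq] m0[unfolded eq] k4 s4 e4 R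
              by (simp add: same_off_def)
          qed
        qed
        done
    qed
    done
qed

text \<open>Inversion makes \<open>A0\<close> the leading coefficient and \<open>q - p\<close> the
  middle exponent; \<open>A0 > 0\<close> and \<open>p < q\<close> are what keep the reversed
  trinomial normalised.\<close>

lemma spec_y_root:
  assumes h: "holds_norm r A0 A1 A2 p q" "nrm A1 A2 p q" "q < 2 ^ l"
    and A: "A0 > 0" "p < q"
    and R: "r 7 = R" "0 < R"
    and d: "r 31 = \<delta>" "r 32 = 1 / \<delta>" "0 < \<delta>" "\<delta> < 1"
    and M: "steps_suffice l M \<delta>"
  shows "spec y_root r (2500 * ((M + 1) * (l + 1))) (\<lambda>r'. 0 \<le> r' 63 \<and> r' 63 \<le> R \<and>
    (\<forall>z. 0 < z \<and> z \<le> R \<and> tri A0 A1 A2 p q z = 0 \<and> slope A1 A2 p q z \<le> 0 \<longrightarrow>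
       \<bar>z - r' 63\<bar> \<le> \<delta> * R) \<and> same_off (insert 63 root_regs) r r')"
proof -
  have pq: "p \<le> q" using nrm_le(1)[OF h(2)] .
  have pl: "p < 2 ^ l" using pq h(3) by simp
  have n: "nrm (A1 * R ^ p) A0 (q - p) q" using h A by (simp add: nrm_def)
  have e0: "r 50 = A0" "r 51 = A1" "r 52 = A2" "r 53 = real p" "r 54 = real q"
    using h by (auto simp: holds_norm_def)
  show ?thesis unfolding spec_def y_root_def
    apply simp
    apply (rule wpc_call[OF spec_pow[of _ p l]])
      apply (simp add: e0)
     apply (rule pl)
    apply simp
    apply (rule wpc_call[OF spec_pow[of _ q l]])
      apply (simp add: e0 same_off_def)
     apply (rule h(3))
    subgoal premises p1 for r1 k1 r2 k2
    proof -
      have e2: "r2 50 = A0" "r2 51 = A1" "r2 52 = A2" "r2 53 = real p" "r2 54 = real q"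
        "r2 42 = A0" "r2 41 = A1 * R ^ p" "r2 12 = R ^ q" "r2 31 = \<delta>" "r2 32 = 1 / \<delta>" "r2 7 = R"
        using p1 e0 R d by (auto simp: same_off_def)
      define r3 where "r3 = r2(40 := A2 * R ^ q, 43 := real q - real p, 44 := real q)"
      have h3: "holds_coeffs r3 (A2 * R ^ q) (A1 * R ^ p) A0 (q - p) q"
        using e2 pq by (simp add: holds_coeffs_def r3_def of_nat_diff)
      have e3: "r3 31 = \<delta>" "r3 32 = 1 / \<delta>" using e2 by (auto simp: r3_def)
      have s3: "same_off root_regs r r3"
        using p1 by (simp add: same_off_def regs_defs r3_def)
      show ?thesis
        apply (simp add: e2)
        apply (subst r3_def[symmetric])
        apply (rule wpc_call[OF spec_right[OF h3 n h(3) e3 d(3,4) M]])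
        subgoal premises p4 for r4 k4
        proof -
          have e4: "r4 7 = R" using p4 e2 by (auto simp: same_off_def r3_def regs_defs)
          have m: "\<bar>z - R / r4 45\<bar> \<le> \<delta> * R"
            if z: "0 < z" "z \<le> R" "tri A0 A1 A2 p q z = 0" "slope A1 A2 p q z \<le> 0" for z
          proof -
            have "0 < R / z" "tri (A2 * R ^ q) (A1 * R ^ p) A0 (q - p) q (R / z) = 0"
              using z R by (simp_all add: tri_inverse[OF pq R(2) z(1)])
            moreover have "slope (A1 * R ^ p) A0 (q - p) q (R / z) \<ge> 0"
              by (rule slope_inverse[OF pq R(2) z(1,3,4)])
            ultimately have "right_approx \<delta> (R / z) (r4 45)" using p4 by blast
            from right_approx_inverse(1)[OF this d(3) R(2) z(1,2)] show ?thesis .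
          qed
          have r45: "1 \<le> r4 45" using p4 by simp
          then have m0: "0 \<le> R / r4 45" "R / r4 45 \<le> R" using R by (auto simp: field_simps)
          have k4: "k4 + 20 \<le> 2500 * ((M + 1) * (l + 1))"
            using p1(1,3) p4(1) by (simp add: algebra_simps)
          have s4: "same_off root_regs r r4"
            using s3 p4 by (simp add: same_off_def regs_defs)
          show ?thesis using m m0 k4 s4 by (simp add: e4 same_off_def)
        qed
        done
    qed
    done
qed

text \<open>Decides which of the two root finders is responsible. With \<open>A0 < 0\<close> the
  only root is on a rising branch. With \<open>A0 > 0\<close> a root before the critical point is
  met first, so a single root in the interval, simple or double, has nonpositive slope.\<close>

lemma pos_roots_structure:
  assumes n: "normal A0 A1 A2 p q" and R: "0 < R"
  defines "S \<equiv> pos_roots (tri A0 A1 A2 p q) R"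
  shows "card S \<le> 2"
    and "card S \<noteq> 0 \<Longrightarrow> nrm A1 A2 p q"
    and "card S \<noteq> 0 \<Longrightarrow> A0 \<ge> 0 \<Longrightarrow> A0 > 0 \<and> p < q"
    and "A0 < 0 \<Longrightarrow> card S \<noteq> 0 \<Longrightarrow> card S = 1"
    and "A0 < 0 \<Longrightarrow> z \<in> S \<Longrightarrow> slope A1 A2 p q z \<ge> 0"
    and "A0 > 0 \<Longrightarrow> card S = 1 \<Longrightarrow> z \<in> S \<Longrightarrow> slope A1 A2 p q z \<le> 0"
proof -
  let ?g = "tri A0 A1 A2 p q"
  have nrm: "nrm A1 A2 p q" if "card S \<noteq> 0"
  proof (rule ccontr)
    assume "\<not> nrm A1 A2 p q"
    then have "S = {}" using n by (auto simp: normal_def S_def pos_roots_def tri_def)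
    then show False using that by simp
  qed
  then show "card S \<noteq> 0 \<Longrightarrow> nrm A1 A2 p q" .
  have neg: "A1 < 0" if "card S \<noteq> 0" "A0 > 0"
  proof (rule ccontr)
    assume "\<not> A1 < 0"
    then have "S = {}" using pos_roots_pos_coeffs[OF nrm[OF that(1)] that(2)] by (simp add: S_def)
    then show False using that by simp
  qed
  show "A0 > 0 \<and> p < q" if "card S \<noteq> 0" "A0 \<ge> 0"
  proof -
    have "A0 > 0" using that n by (simp add: normal_def)
    with neg[OF that(1) this] nrm[OF that(1)] show ?thesis by (auto simp: nrm_def)
  qed
  have one: "card S = 1" if "A0 < 0" "card S \<noteq> 0"
    using card_pos_roots_neg_const[OF nrm[OF that(2)] that(1) R] that(2)
    by (auto simp: S_def split: if_splits)
  then show "A0 < 0 \<Longrightarrow> card S \<noteq> 0 \<Longrightarrow> card S = 1" .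
  show "card S \<le> 2"
  proof (cases "card S = 0 \<or> A0 < 0")
    case True
    then show ?thesis using one by force
  next
    case False
    then have c: "card S \<noteq> 0" "A0 > 0" using n by (auto simp: normal_def)
    obtain m where "0 < m" "slope A1 A2 p q m = 0"
      using slope_root_exists[OF nrm[OF c(1)] neg[OF c]] .
    from card_pos_roots_two_changes[OF nrm[OF c(1)] c(2) neg[OF c] this R]
    show ?thesis by (simp add: S_def)
  qed
  have finS: "finite S"
    by (rule finite_subset[OF _ finite_roots_tri[OF n]]) (auto simp: S_def pos_roots_def)
  then have c0: "card S \<noteq> 0" if "z \<in> S" using that by auto
  show "slope A1 A2 p q z \<ge> 0" if "A0 < 0" "z \<in> S"
    using slope_pos_of_neg_const[OF nrm[OF c0[OF that(2)]] that(1), of z] that(2)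
    by (simp add: S_def pos_roots_def)
  show "slope A1 A2 p q z \<le> 0" if A0: "A0 > 0" and c: "card S = 1" and z: "z \<in> S"
  proof (rule ccontr)
    \<comment> \<open>A root on the rising branch forces a negative minimum; since the value at 0 is
      positive, there is a further root before \<open>m\<close>, hence also in the interval.\<close>
    assume "\<not> ?thesis"
    then have sz: "slope A1 A2 p q z > 0" by simp
    note N = nrm[OF c0[OF z]]
    have z': "0 < z" "z \<le> R" "?g z = 0" using z by (auto simp: S_def pos_roots_def)
    obtain m where m: "0 < m" "slope A1 A2 p q m = 0"
      using slope_root_exists[OF N neg[OF c0[OF z] A0]] .
    have mz: "m < z"
      using slope_strict_mono[OF N z'(1), of m] sz m by (cases m z rule: linorder_cases) auto
    have "?g m < 0" using tri_strict_mono[OF N m(1) mz, of A0] m z' by simp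
    with tri_IVT2[of 0 m A0 A1 A2 p q] m A0 tri_0[OF N]
    obtain u where u: "0 < u" "u \<le> m" "?g u = 0" by auto
    then have "{u, z} \<subseteq> S" using z z' mz by (auto simp: S_def pos_roots_def)
    then have "card {u, z} \<le> card S" using finS by (intro card_mono) auto
    then show False using c u mz by simp
  qed
qed

section \<open>The complete approximation program\<close>

definition write_roots :: com where
  "write_roots = If (V 4 -: K 1)
     (1 <- K 0 ;; 2 <- V 63 ;; 3 <- V 64 ;; 0 <- V 61 +: K 1)
     (1 <- V 63 ;; 2 <- V 64 ;; 0 <- V 61)"

text \<open>The minimum with 1 covers \<epsilon> > R and, after halving, keeps \<delta> below 1;
  halving also makes the absolute error \<open>\<delta> * R\<close> strictly smaller than
  \<epsilon>.\<close>

definition set_delta :: com where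
  "set_delta = (62 <- V 8 /: V 7 ;; If (V 62 -: K 1) (62 <- K 1) (62 <- V 62) ;;
     31 <- V 62 /: K 2 ;; 32 <- K 1 /: V 31)"

text \<open>A single root must end up in 63, the value written first. For \<open>A0 \<ge> 0\<close>
  that is the root of nonpositive slope; otherwise the result of \<open>x_root\<close> is copied
  there.\<close>

definition find_roots :: com where
  "find_roots = If (V 61 -: K 1) (x_root ;; If (V 50) y_root (63 <- V 64)) (63 <- V 63)"

definition approx :: com where
  "approx = (setup_input ;; load_norm ;; 47 <- V 7 ;; count ;; 61 <- V 48 ;;
     set_delta ;; find_roots ;; write_roots)"

lemma spec_set_delta:
  "spec set_delta r 20 (\<lambda>r'. r' 31 = min 1 (r 8 / r 7) / 2 \<and>
     r' 32 = 1 / (min 1 (r 8 / r 7) / 2) \<and> same_off {31,32,62} r r')"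
  by (simp add: spec_def set_delta_def same_off_def min_def)

text \<open>The values have to cover the roots but need not match them one to one, so it suffices
  that each root is near one of the values written. With a single positive root only
  \<open>z1\<close> is written, hence the guard \<open>n = 2\<close>.\<close>

lemma eps_approx_outI:
  fixes g :: "real \<Rightarrow> real"
  assumes fin: "finite (pos_roots g R)" and g0: "g 0 \<noteq> 0" and R: "0 < R" "0 < \<epsilon>"
    and f: "\<And>x. poly f x = 0 \<longleftrightarrow> e \<and> x = 0 \<or> g x = 0"
    and n: "n = card (pos_roots g R)" "n \<le> 2"
    and z: "n \<noteq> 0 \<Longrightarrow> 0 \<le> z1 \<and> z1 \<le> R" "n = 2 \<Longrightarrow> 0 \<le> z2 \<and> z2 \<le> R"
    and cover: "\<And>z. z \<in> pos_roots g R \<Longrightarrow> \<bar>z - z1\<bar> < \<epsilon> \<or> n = 2 \<and> \<bar>z - z2\<bar> < \<epsilon>"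
    and r: "if e then r 0 = real n + 1 \<and> r 1 = 0 \<and> r 2 = z1 \<and> r 3 = z2
      else r 0 = real n \<and> r 1 = z1 \<and> r 2 = z2"
  shows "eps_approx_out f {0..R} \<epsilon> r"
proof -
  have Z: "{x \<in> {0..R}. poly f x = 0} = (if e then {0} else {}) \<union> pos_roots g R"
    using g0 R by (auto simp: f pos_roots_def order.order_iff_strict)
  have "0 \<notin> pos_roots g R" by (simp add: pos_roots_def)
  then have cZ: "card {x \<in> {0..R}. poly f x = 0} = (if e then Suc n else n)"
    unfolding Z using fin n by simp
  have n0: "n \<noteq> 0" if "z \<in> pos_roots g R" for z using that fin n by auto
  have "n = 0 \<or> n = 1 \<or> n = 2" using n(2) by auto
  then have I: "\<forall>j < card {x \<in> {0..R}. poly f x = 0}. r (Suc j) \<in> {0..R}"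
    unfolding cZ using r z R by (auto simp: less_Suc_eq numeral_2_eq_2 numeral_3_eq_3 split: if_splits)
  have ex: "\<exists>j < card {x \<in> {0..R}. poly f x = 0}. \<bar>\<zeta> - r (Suc j)\<bar> < \<epsilon>"
    if "\<zeta> \<in> {x \<in> {0..R}. poly f x = 0}" for \<zeta>
  proof (cases "\<zeta> \<in> pos_roots g R")
    case True
    from cover[OF this] show ?thesis
    proof
      assume "\<bar>\<zeta> - z1\<bar> < \<epsilon>"
      then show ?thesis unfolding cZ using r n0[OF True]
        by (intro exI[of _ "if e then 1 else 0"]) (auto simp: numeral_2_eq_2 split: if_splits)
    next
      assume "n = 2 \<and> \<bar>\<zeta> - z2\<bar> < \<epsilon>"
      then show ?thesis unfolding cZ using r
        by (intro exI[of _ "if e then 2 else 1"])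
          (auto simp: numeral_2_eq_2 numeral_3_eq_3 split: if_splits)
    qed
  next
    case False
    then have "e" "\<zeta> = 0" using that unfolding Z by (auto split: if_splits)
    then show ?thesis unfolding cZ using r R by (intro exI[of _ 0]) auto
  qed
  have "r 0 = real (card {x \<in> {0..R}. poly f x = 0})" unfolding cZ using r by (simp split: if_splits)
  with I ex show ?thesis unfolding eps_approx_out_def Let_def by blast
qed

text \<open>The postcondition ranges over all states that agree on registers 0 to 3, since the
  machine state is controlled only below \<open>T\<close>; a count and at most three roots fit into
  these registers.\<close>

lemma spec_approx:
  assumes h: "holds_input r t c e" and v: "valid_enc t c e" and l: "degree (spoly t c e) < 2 ^ l"
    and R: "r 7 = R" "0 < R" and e: "r 8 = \<epsilon>" "0 < \<epsilon>"
    and M: "steps_suffice l M (min 1 (\<epsilon> / R) / 2)"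
  shows "spec approx r (6000 * ((M + 1) * (l + 1)))
    (\<lambda>r'. \<forall>s. (\<forall>i\<le>3. s i = r' i) \<longrightarrow> eps_approx_out (spoly t c e) {0..R} \<epsilon> s)"
proof -
  let ?f = "spoly t c e"
  define \<delta> where "\<delta> = min 1 (\<epsilon> / R) / 2"
  have d: "0 < \<delta>" "\<delta> < 1" using R e by (auto simp: \<delta>_def)
  have "\<delta> * R \<le> \<epsilon> / R / 2 * R" using R by (intro mult_right_mono) (auto simp: \<delta>_def)
  also have "\<dots> < \<epsilon>" using R e by simp
  finally have dR: "\<delta> * R < \<epsilon>" .
  show ?thesis unfolding spec_def approx_def load_norm_def
    apply simp
    apply (rule wpc_call[OF spec_setup_input[OF h v]])
    subgoal premises p1 for r1 k1
    proof -
      from p1(2) obtain A0 A1 A2 p q where h1: "holds_norm r1 A0 A1 A2 p q"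
        and n: "normal A0 A1 A2 p q" and q: "q \<le> degree ?f"
        and f: "\<And>x. poly ?f x = 0 \<longleftrightarrow> 0 < e 0 \<and> x = 0 \<or> tri A0 A1 A2 p q x = 0"
        and s1: "same_off {50,51,52,53,54} r r1"
        by blast
      let ?g = "tri A0 A1 A2 p q"
      let ?S = "pos_roots ?g R"
      have ql: "q < 2 ^ l" using q l by simp
      have g0: "?g 0 \<noteq> 0"
        using n by (cases "nrm A1 A2 p q") (simp_all add: normal_def tri_0, simp add: tri_def)
      have finS: "finite ?S"
        by (rule finite_subset[OF _ finite_roots_tri[OF n]]) (auto simp: pos_roots_def)
      note S = pos_roots_structure[OF n R(2)]
      have e1: "r1 4 = real (e 0)" "r1 7 = R" "r1 8 = \<epsilon>"
        "r1 50 = A0" "r1 51 = A1" "r1 52 = A2" "r1 53 = real p" "r1 54 = real q"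
        using s1 h R e h1 by (auto simp: same_off_def holds_input_def holds_norm_def)
      define r2 where "r2 = r1(40 := A0, 41 := A1, 42 := A2, 43 := real p, 44 := real q, 47 := R)"
      have h2: "holds_coeffs r2 A0 A1 A2 p q" by (simp add: holds_coeffs_def r2_def)
      have x2: "0 < r2 47" using R by (simp add: r2_def)
      show ?thesis
        apply (simp add: e1)
        apply (subst r2_def[symmetric])
        apply (rule wpc_call[OF spec_count[OF h2 n ql x2]])
        subgoal premises p3 for r3 k3
        proof -
          have e3: "r3 4 = real (e 0)" "r3 7 = R" "r3 8 = \<epsilon>" "r3 48 = real (card ?S)"
            "r3 50 = A0" "r3 51 = A1" "r3 52 = A2" "r3 53 = real p" "r3 54 = real q"
            using p3 e1 by (auto simp: same_off_def count_regs_def evl_regs_def r2_def)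
          define r3' where "r3' = r3(61 := real (card ?S))"
          show ?thesis
            apply (simp add: e3)
            apply (subst r3'_def[symmetric])
            apply (rule wpc_call[OF spec_set_delta])
            subgoal premises p4 for r4 k4
            proof -
              have e4: "r4 4 = real (e 0)" "r4 7 = R" "r4 61 = real (card ?S)" "r4 50 = A0"
                "r4 31 = \<delta>" "r4 32 = 1 / \<delta>" "r4 51 = A1" "r4 52 = A2" "r4 53 = real p" "r4 54 = real q"
                using p4 e3 by (auto simp: r3'_def same_off_def \<delta>_def)
              have h4: "holds_norm r4 A0 A1 A2 p q" using e4 by (simp add: holds_norm_def)
              define P where "P r' k \<longleftrightarrow> k \<le> 6000 * ((M + 1) * (l + 1)) \<and>
                (\<forall>s. (\<forall>i\<le>3. s i = r' i) \<longrightarrow> eps_approx_out ?f {0..R} \<epsilon> s)" for r' k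
              have out: "wpc write_roots P r' k"
                if k: "k + 20 \<le> 6000 * ((M + 1) * (l + 1))"
                  and r': "r' 4 = real (e 0)" "r' 61 = real (card ?S)"
                  and z: "card ?S \<noteq> 0 \<Longrightarrow> 0 \<le> r' 63 \<and> r' 63 \<le> R" "card ?S = 2 \<Longrightarrow> 0 \<le> r' 64 \<and> r' 64 \<le> R"
                  and cover: "\<And>z. z \<in> ?S \<Longrightarrow> \<bar>z - r' 63\<bar> < \<epsilon> \<or> card ?S = 2 \<and> \<bar>z - r' 64\<bar> < \<epsilon>"
                for r' k
              proof -
                note E = eps_approx_outI[OF finS g0 R(2) e(2) f refl S(1) z cover]
                show ?thesis
                proof (cases "0 < e 0")
                  case True
                  have "P (r'(1 := 0, 2 := r' 63, 3 := r' 64, 0 := r' 61 + 1)) k'"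
                    if "k' \<le> 6000 * ((M + 1) * (l + 1))" for k'
                    unfolding P_def
                  proof (intro conjI allI impI)
                    fix s :: "nat \<Rightarrow> real"
                    assume s: "\<forall>i\<le>3. s i = (r'(1 := 0, 2 := r' 63, 3 := r' 64, 0 := r' 61 + 1)) i"
                    show "eps_approx_out ?f {0..R} \<epsilon> s"
                      by (rule E) (use s True r' in auto)
                  qed (rule that)
                  moreover have "0 \<le> r' 4 - 1" using True r' by simp
                  ultimately show ?thesis using k unfolding write_roots_def by simp
                next
                  case False
                  have "P (r'(1 := r' 63, 2 := r' 64, 0 := r' 61)) k'"
                    if "k' \<le> 6000 * ((M + 1) * (l + 1))" for k'
                    unfolding P_def
                  proof (intro conjI allI impI)
                    fix s :: "nat \<Rightarrow> real"
                    assume s: "\<forall>i\<le>3. s i = (r'(1 := r' 63, 2 := r' 64, 0 := r' 61)) i"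
                    show "eps_approx_out ?f {0..R} \<epsilon> s"
                      by (rule E) (use s False r' in auto)
                  qed (rule that)
                  moreover have "\<not> 0 \<le> r' 4 - 1" using False r' by simp
                  ultimately show ?thesis using k unfolding write_roots_def by simp
                qed
              qed
              have main: "wpc find_roots (wpc write_roots P) r4 k" if k: "k + 30 \<le> 600 * ((M + 1) * (l + 1))" for k
              proof (cases "card ?S = 0")
                case True
                then have "z \<notin> ?S" for z using finS by auto
                moreover have "(M + 1) * (l + 1) \<ge> 1" by simp
                ultimately have "wpc write_roots P r4 (Suc (Suc (Suc (Suc k))))"
                  using True k e4 by (intro out) (auto simp del: mult_Suc)
                then show ?thesis using True e4 by (simp add: find_roots_def)
              next
                case False
                then have c: "1 \<le> real (card ?S)" by linarith
                have N: "nrm A1 A2 p q" using S(2) False by simp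
                have sx: "spec x_root r4 (2500 * ((M + 1) * (l + 1))) (\<lambda>r'. 0 \<le> r' 64 \<and> r' 64 \<le> R \<and>
                    (\<forall>z. 0 < z \<and> z \<le> R \<and> ?g z = 0 \<and> slope A1 A2 p q z \<ge> 0 \<longrightarrow>
                       \<bar>z - r' 64\<bar> \<le> \<delta> * R) \<and> same_off (insert 64 root_regs) r4 r')"
                  by (rule spec_x_root[OF h4 N ql e4(2) R(2) e4(5,6) d M[folded \<delta>_def]])
                have "wpc (x_root ;; If (V 50) y_root (63 <- V 64)) (wpc write_roots P) r4 (Suc (Suc k))"
                proof (rule wpc_Seq[THEN iffD2, OF wpc_call[OF sx]])
                  fix r5 k5 assume k5: "k5 \<le> Suc (Suc k) + 2500 * ((M + 1) * (l + 1))"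
                    and "0 \<le> r5 64 \<and> r5 64 \<le> R \<and>
                    (\<forall>z. 0 < z \<and> z \<le> R \<and> ?g z = 0 \<and> slope A1 A2 p q z \<ge> 0 \<longrightarrow>
                       \<bar>z - r5 64\<bar> \<le> \<delta> * R) \<and> same_off (insert 64 root_regs) r4 r5"
                  then have r5: "0 \<le> r5 64" "r5 64 \<le> R" and s5: "same_off (insert 64 root_regs) r4 r5"
                    and x5: "\<And>z. z \<in> ?S \<Longrightarrow> slope A1 A2 p q z \<ge> 0 \<Longrightarrow> \<bar>z - r5 64\<bar> < \<epsilon>"
                    using dR by (auto simp: pos_roots_def intro: order.strict_trans1)
                  have e5: "r5 4 = real (e 0)" "r5 7 = R" "r5 61 = real (card ?S)" "r5 50 = A0"
                    "r5 31 = \<delta>" "r5 32 = 1 / \<delta>"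
                    using s5 e4 by (auto simp: same_off_def regs_defs)
                  have h5: "holds_norm r5 A0 A1 A2 p q"
                    using h4 s5 by (simp add: holds_norm_def same_off_def regs_defs)
                  show "wpc (If (V 50) y_root (63 <- V 64)) (wpc write_roots P) r5 k5"
                  proof (cases "A0 \<ge> 0")
                    case True
                    then have A: "A0 > 0" "p < q" using S(3) False by auto
                    have sy: "spec y_root r5 (2500 * ((M + 1) * (l + 1))) (\<lambda>r'. 0 \<le> r' 63 \<and> r' 63 \<le> R \<and>
                        (\<forall>z. 0 < z \<and> z \<le> R \<and> ?g z = 0 \<and> slope A1 A2 p q z \<le> 0 \<longrightarrow>
                           \<bar>z - r' 63\<bar> \<le> \<delta> * R) \<and> same_off (insert 63 root_regs) r5 r')"
                      by (rule spec_y_root[OF h5 N ql A e5(2) R(2) e5(5,6) d M[folded \<delta>_def]])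
                    have "wpc y_root (wpc write_roots P) r5 (Suc k5)"
                    proof (rule wpc_call[OF sy])
                      fix r6 k6 assume k6: "k6 \<le> Suc k5 + 2500 * ((M + 1) * (l + 1))"
                        and "0 \<le> r6 63 \<and> r6 63 \<le> R \<and>
                        (\<forall>z. 0 < z \<and> z \<le> R \<and> ?g z = 0 \<and> slope A1 A2 p q z \<le> 0 \<longrightarrow>
                           \<bar>z - r6 63\<bar> \<le> \<delta> * R) \<and> same_off (insert 63 root_regs) r5 r6"
                      then have r6: "0 \<le> r6 63" "r6 63 \<le> R" and s6: "same_off (insert 63 root_regs) r5 r6"
                        and x6: "\<And>z. z \<in> ?S \<Longrightarrow> slope A1 A2 p q z \<le> 0 \<Longrightarrow> \<bar>z - r6 63\<bar> < \<epsilon>"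
                        using dR by (auto simp: pos_roots_def intro: order.strict_trans1)
                      have e6: "r6 4 = real (e 0)" "r6 61 = real (card ?S)" "r6 64 = r5 64"
                        using s6 e5 by (auto simp: same_off_def regs_defs)
                      \<comment> \<open>Whatever the sign of the slope at \<open>z\<close>, one of
                        the two values is close; if there is only one root, its slope is nonpositive
                        and 63 suffices.\<close>
                      have "\<bar>z - r6 63\<bar> < \<epsilon> \<or> card ?S = 2 \<and> \<bar>z - r6 64\<bar> < \<epsilon>" if "z \<in> ?S" for z
                      proof (cases "card ?S = 2")
                        case True
                        then show ?thesis using x6[OF that] x5[OF that] e6 by linarith
                      next
                        case F: False
                        then have "card ?S = 1" using S(1) False by linarith
                        then show ?thesis using x6[OF that] S(6)[OF A(1) _ that] by simp
                      qed
                      then show "wpc write_roots P r6 k6"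
                        using k k5 k6 r5 r6 e6 by (intro out) auto
                    qed
                    then show ?thesis using True e5 by simp
                  next
                    case neg: False
                    then have "A0 < 0" by simp
                    note S1 = S(4)[OF this] S(5)[OF this]
                    have "card ?S = 1" using S1(1) False by simp
                    moreover have "\<bar>z - r5 64\<bar> < \<epsilon>" if "z \<in> ?S" for z
                      using x5[OF that] S1(2)[OF that] by simp
                    ultimately have "wpc write_roots P (r5(63 := r5 64)) (Suc (Suc (Suc k5)))"
                      using k k5 r5 e5 by (intro out) auto
                    then show ?thesis using neg e5 by simp
                  qed
                qed
                then show ?thesis using c e4 by (simp add: find_roots_def del: wpc_Seq)
              qed
              have "k4 + 30 \<le> 600 * ((M + 1) * (l + 1))"
                using p1(1) p3(1) p4(1) by (simp add: algebra_simps)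
              from main[OF this] have "wpc (find_roots ;; write_roots) P r4 k4" by (rule wpc_Seq[THEN iffD2])
              then show ?thesis unfolding P_def[abs_def] by (simp del: wpc_Seq)
            qed
            done
        qed
        done
    qed
    done
qed

section \<open>Bounds on the number of steps\<close>

lemma ln_2_ge: "ln 2 \<ge> (1 / 2 :: real)"
  using ln_le_minus_one[of "1 / 2 :: real"] by (simp add: ln_div)

lemma ex_power_2_between:
  fixes n :: nat
  shows "\<exists>l. n < 2 ^ l \<and> 2 ^ l \<le> 2 * (n + 1)"
proof -
  define l where "l = (LEAST l. n < 2 ^ l)"
  have 1: "n < 2 ^ l" unfolding l_def by (rule LeastI[of _ n]) (rule less_exp)
  have "2 ^ l \<le> 2 * (n + 1)"
  proof (cases l)
    case (Suc m)
    then have "\<not> n < 2 ^ m" using not_less_Least[of m "\<lambda>l. n < 2 ^ l"] by (simp add: l_def)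
    then show ?thesis using Suc by simp
  qed simp
  with 1 show ?thesis by blast
qed

text \<open>The shift to D + 2 keeps the logarithm at least ln 2 for constants, so it absorbs the
  additive terms.\<close>

lemma length_bound:
  assumes "(2::nat) ^ l \<le> 2 * (D + 1)"
  shows "real (l + 1) \<le> 6 * ln (real D + 2)"
proof -
  have "real (2 ^ l) \<le> real (2 * (D + 1))" using assms by (rule of_nat_mono)
  then have "(2::real) ^ l \<le> 2 * (real D + 2)" by simp
  then have "ln ((2::real) ^ l) \<le> ln (2 * (real D + 2))" by (subst ln_le_cancel_iff) auto
  also have "ln (2 * (real D + 2)) = ln 2 + ln (real D + 2)" by (rule ln_mult_pos) auto
  finally have A: "real l * ln 2 \<le> ln 2 + ln (real D + 2)" by (simp add: ln_realpow)
  have B: "ln 2 \<le> ln (real D + 2)" by simp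
  have "real (l + 1) * (1 / 2) \<le> real (l + 1) * ln 2"
    using ln_2_ge by (intro mult_left_mono) auto
  also have "\<dots> = real l * ln 2 + ln 2" by (simp add: algebra_simps)
  also have "\<dots> \<le> 3 * ln (real D + 2)" using A B by linarith
  finally show ?thesis by simp
qed

text \<open>Two steps of the recurrence at least double the value, so the depth of the Fibonacci
  search is logarithmic in the number of grid points.\<close>

lemma fib_ge_power_2: "2 ^ i \<le> fib (2 * i + 2)"
proof (induction i)
  case (Suc i)
  have "fib (2 * Suc i + 2) = 2 * fib (2 * i + 2) + fib (2 * i + 1)"
    by (simp add: numeral_2_eq_2)
  then show ?case using Suc by simp
qed (simp add: numeral_2_eq_2)

text \<open>By Bernoulli, q grid steps span a factor of at least 2, so \<open>q * k\<close> steps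
  span \<open>2 ^ k\<close>. As \<open>q * k\<close> is at most \<open>2 ^ l * k\<close>, which is
  below \<open>2 ^ i\<close> and hence below \<open>fib (2 * i + 2)\<close>, the choice is
  \<open>M = 2 * i + 2\<close>, logarithmic in D log(1/\<delta>).\<close>

lemma ex_steps_suffice:
  fixes R \<epsilon> :: real
  assumes R: "0 < R" "0 < \<epsilon>" and l: "(2::nat) ^ l \<le> 2 * (D + 1)"
  shows "\<exists>M. steps_suffice l M (min 1 (\<epsilon> / R) / 2) \<and>
    real (M + 1) \<le> 20 * ln ((real D + 2) * (2 + \<bar>ln (R / \<epsilon>)\<bar>))"
proof -
  define \<delta> where "\<delta> = min 1 (\<epsilon> / R) / 2"
  define H where "H = 1 / \<delta>"
  define a where "a = \<bar>ln (R / \<epsilon>)\<bar>"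
  have d: "0 < \<delta>" "\<delta> \<le> 1 / 2" using R by (auto simp: \<delta>_def)
  have H: "2 \<le> H" using d by (simp add: H_def field_simps)
  have lnH: "ln H \<le> ln 2 + a"
  proof (cases "1 \<le> \<epsilon> / R")
    case True
    then have "H = 2" by (simp add: H_def \<delta>_def)
    then show ?thesis by (simp add: a_def)
  next
    case False
    then have "H = 2 * (R / \<epsilon>)" using R by (simp add: H_def \<delta>_def field_simps)
    moreover have "ln (2 * (R / \<epsilon>)) = ln 2 + ln (R / \<epsilon>)" using R by (intro ln_mult_pos) auto
    ultimately show ?thesis by (simp add: a_def)
  qed
  \<comment> \<open>The number of doublings the grid has to span: \<open>2 ^ k\<close> reaches
    1/\<delta>^2.\<close>
  define k where "k = nat \<lceil>2 * log 2 H\<rceil>"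
  have lg: "log 2 H \<ge> 1" using H by simp
  then have k1: "1 \<le> k" by (simp add: k_def) linarith
  have "2 powr (log 2 H * 2) = (2 powr log 2 H) powr 2" by (rule powr_powr[symmetric])
  then have "H powr 2 = 2 powr (2 * log 2 H)" using H by (simp add: mult.commute)
  also have "\<dots> \<le> 2 powr real k" using lg by (intro powr_mono) (auto simp: k_def)
  finally have kH: "H ^ 2 \<le> 2 ^ k" using H by (simp add: powr_realpow powr_numeral)
  have "real k \<le> 2 * log 2 H + 1" using lg by (simp add: k_def)
  also have "log 2 H \<le> 2 * ln H"
  proof -
    have "ln H \<ge> 0" using H by simp
    then have "ln H * 1 \<le> ln H * (2 * ln 2)" using ln_2_ge by (intro mult_left_mono) auto
    then show ?thesis by (simp add: log_def field_simps)
  qed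
  also have "ln H \<le> 1 + a" using lnH ln_2_less_1 by simp
  finally have ka: "real k \<le> 5 * (2 + a)" by (simp add: a_def)
  define n where "n = 2 ^ l * k"
  obtain i where i: "n < 2 ^ i" "2 ^ i \<le> 2 * (n + 1)"
    using ex_power_2_between by blast
  have "1 \<le> n" using k1 by (simp add: n_def Suc_le_eq)
  with i(2) have "2 ^ i \<le> 4 * n" by simp
  then have "real (2 ^ i) \<le> real (4 * (2 ^ l * k))" unfolding n_def by (rule of_nat_mono)
  \<comment> \<open>The factors 4, 2 and 5 multiply to 40, rounded up to \<open>2 ^ 6\<close> so
    that its logarithm is a multiple of ln 2.\<close>
  also have "\<dots> \<le> 4 * ((2 * (real D + 2)) * (5 * (2 + a)))"
  proof -
    have "real (2 ^ l) \<le> real (2 * (D + 1))" using l by (rule of_nat_mono)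
    then have "(2::real) ^ l \<le> 2 * (real D + 2)" by simp
    then have "2 ^ l * real k \<le> (2 * (real D + 2)) * (5 * (2 + a))"
      using ka by (intro mult_mono) auto
    then show ?thesis by simp
  qed
  also have "\<dots> = 40 * ((real D + 2) * (2 + a))" by (simp add: algebra_simps)
  also have "\<dots> \<le> 2 ^ 6 * ((real D + 2) * (2 + a))"
    by (intro mult_right_mono mult_nonneg_nonneg) (auto simp: a_def)
  finally have iX: "(2::real) ^ i \<le> 2 ^ 6 * ((real D + 2) * (2 + a))" by simp
  let ?X = "(real D + 2) * (2 + a)"
  have X: "4 \<le> ?X" using mult_mono[of 2 "real D + 2" 2 "2 + a"] by (simp add: a_def)
  have "ln ((2::real) ^ i) \<le> ln (2 ^ 6 * ?X)" using iX X by (subst ln_le_cancel_iff) auto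
  also have "\<dots> = ln (2 ^ 6) + ln ?X" using X by (intro ln_mult_pos) auto
  also have "ln (2 ^ 6) = 6 * ln (2::real)" by (subst ln_realpow) auto
  finally have iln: "real i * ln 2 \<le> 6 * ln 2 + ln ?X" by (simp add: ln_realpow)
  have "ln (2 ^ 2) \<le> ln ?X" using X by (subst ln_le_cancel_iff) auto
  moreover have "ln (2 ^ 2) = 2 * ln (2::real)" by (subst ln_realpow) auto
  ultimately have X2: "2 * ln 2 \<le> ln ?X" by linarith
  have "real i * ln 2 \<le> 4 * ln ?X" using iln X2 by linarith
  moreover have "real i * (1 / 2) \<le> real i * ln 2" using ln_2_ge by (intro mult_left_mono) auto
  ultimately have "real i \<le> 8 * ln ?X" by simp
  then have MX: "real (2 * i + 2 + 1) \<le> 20 * ln ?X" using X2 ln_2_ge by simp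
  have "steps_suffice l (2 * i + 2) \<delta>"
    unfolding steps_suffice_def
  proof (intro conjI allI impI)
    have "k \<le> n" by (simp add: n_def)
    \<comment> \<open>Newton's demand is far weaker than that of the search:
      \<open>2 ^ (k + 2)\<close> is at least 4/\<delta>^2, which exceeds the required 2/\<delta>,
      and the exponent available is exponential in \<open>M\<close>.\<close>
    then have "k + 2 \<le> 4 * 2 ^ i" using i(1) k1 by linarith
    also have "(4::nat) * 2 ^ i \<le> 2 ^ (2 * i + 2)" by (simp add: power_add)
    finally have "(2::real) ^ (k + 2) \<le> 2 ^ (2 ^ (2 * i + 2))" by (intro power_increasing) auto
    then have "4 * H ^ 2 \<le> 2 ^ (2 ^ (2 * i + 2))" using kH by simp
    moreover have "2 * H < 4 * H ^ 2" using H by (simp add: power2_eq_square)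
    ultimately have "2 * H < 2 ^ (2 ^ (2 * i + 2))" by linarith
    then have "2 * (1 / 2 ^ (2 ^ (2 * i + 2))) < 1 / H"
      using H by (simp add: field_simps)
    then show "2 * (1 / 2) ^ (2 ^ (2 * i + 2)) < \<delta>" by (simp add: H_def power_one_over)
    fix q :: nat assume q: "0 < q \<and> q < 2 ^ l"
    have "1 + real q * (1 / real q) \<le> (1 + 1 / real q) ^ q"
      by (rule Bernoulli_inequality) (use q in \<open>simp add: field_simps\<close>)
    then have two: "2 \<le> (1 + 1 / real q) ^ q" using q by simp
    have "1 / \<delta>\<^sup>2 = H ^ 2" by (simp add: H_def power_one_over)
    also have "\<dots> \<le> 2 ^ k" by (rule kH)
    also have "\<dots> \<le> ((1 + 1 / real q) ^ q) ^ k" using two by (intro power_mono) auto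
    also have "\<dots> = (1 + 1 / real q) ^ (q * k)" by (simp add: power_mult)
    also have "\<dots> \<le> (1 + 1 / real q) ^ fib (2 * i + 2)"
    proof (rule power_increasing)
      have "q * k \<le> n" unfolding n_def using q by (intro mult_right_mono) auto
      then show "q * k \<le> fib (2 * i + 2)" using i(1) fib_ge_power_2[of i] by linarith
    qed simp
    finally show "1 / \<delta>\<^sup>2 \<le> (1 + 1 / real q) ^ fib (2 * i + 2)" .
  qed
  then show ?thesis using MX unfolding \<delta>_def a_def by blast
qed

section \<open>Absolute constants of the two cost bounds\<close>

lemmas com_defs = approx_def count_interval_def setup_input_def prep_def fix_sign_def
  load_norm_def count_def load_def discr_def evl_def pow_def pow_up_def pow_down_def
  set_delta_def find_roots_def write_roots_def x_root_def y_root_def right_def load_slope_def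
  find_root_def find_root_far_def find_root_near_def find_root_search_def test_up_def fib_up_def
  fib_down_def newton_def count_pos_def count_upto_def

lemma cvars_programs: "cvars approx" "cvars count_interval"
  by (simp_all add: com_defs T_def)

theorem theorem1p1:
  shows "(\<exists>(P::prog) (C::real). C > 0 \<and>
           (\<forall>t c e (R::real) (\<epsilon>::real). valid_enc t c e \<and> R > 0 \<and> \<epsilon> > 0 \<longrightarrow>
              (let f = spoly t c e; D = real (degree f) in
                computes_within P (enc t c e @ [R, \<epsilon>])
                  (C * ln (D + 2) * ln ((D + 2) * (2 + \<bar>ln (R / \<epsilon>)\<bar>)))
                  (eps_approx_out f {0..R} \<epsilon>))))
       \<and> (\<exists>(P::prog) (C::real). C > 0 \<and>
           (\<forall>t c e (a::real) (b::real) la rb. valid_enc t c e \<longrightarrow>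
              (let f = spoly t c e; D = real (degree f) in
                computes_within P (enc t c e @ [a, b, of_bool_real la, of_bool_real rb])
                  (C * (ln (D + 2))^2)
                  (\<lambda>r. r 0 = real (card {x \<in> bint a b la rb. poly f x = 0})))))"
proof (intro conjI exI allI impI)
  fix t c e and R \<epsilon> :: real
  assume *: "valid_enc t c e \<and> R > 0 \<and> \<epsilon> > 0"
  define D where "D = degree (spoly t c e)"
  obtain l where l: "D < 2 ^ l" "2 ^ l \<le> 2 * (D + 1)" using ex_power_2_between by blast
  obtain M where M: "steps_suffice l M (min 1 (\<epsilon> / R) / 2)"
    "real (M + 1) \<le> 20 * ln ((real D + 2) * (2 + \<bar>ln (R / \<epsilon>)\<bar>))"
    using ex_steps_suffice[OF _ _ l(2)] * by blast
  have "real (M + 1) * real (l + 1) \<le>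
      (20 * ln ((real D + 2) * (2 + \<bar>ln (R / \<epsilon>)\<bar>))) * (6 * ln (real D + 2))"
    by (intro mult_mono M length_bound l) (use M(2) in linarith, simp)
  \<comment> \<open>The constant is 6000 * 20 * 6.\<close>
  then have cost: "real (6000 * ((M + 1) * (l + 1))) \<le>
      720000 * ln (real D + 2) * ln ((real D + 2) * (2 + \<bar>ln (R / \<epsilon>)\<bar>))"
    by (simp add: algebra_simps)
  let ?r = "inp (enc t c e @ [R, \<epsilon>])"
  have h: "holds_input ?r t c e" "?r 7 = R" "?r 8 = \<epsilon>"
    by (simp_all add: holds_input_def inp_def enc_def)
  have "computes_within (cc approx 0) (enc t c e @ [R, \<epsilon>])
    (720000 * ln (real D + 2) * ln ((real D + 2) * (2 + \<bar>ln (R / \<epsilon>)\<bar>)))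
    (eps_approx_out (spoly t c e) {0..R} \<epsilon>)"
  proof (rule computes_within_cc[OF spec_approx[OF h(1) _ _ h(2) _ h(3) _ M(1)] _ cost])
    fix r s :: "nat \<Rightarrow> real"
    assume "\<forall>s. (\<forall>i\<le>3. s i = r i) \<longrightarrow> eps_approx_out (spoly t c e) {0..R} \<epsilon> s"
      and "\<forall>i<T. s i = r i"
    then show "eps_approx_out (spoly t c e) {0..R} \<epsilon> s" by (simp add: T_def)
  qed (use * l in \<open>simp_all add: D_def cvars_programs\<close>)
  then show "let f = spoly t c e; D = real (degree f) in
    computes_within (cc approx 0) (enc t c e @ [R, \<epsilon>])
      (720000 * ln (D + 2) * ln ((D + 2) * (2 + \<bar>ln (R / \<epsilon>)\<bar>)))
      (eps_approx_out f {0..R} \<epsilon>)"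
    by (simp add: D_def Let_def)
next
  fix t c e and a b :: real and la rb
  assume v: "valid_enc t c e"
  define D where "D = degree (spoly t c e)"
  obtain l where l: "D < 2 ^ l" "2 ^ l \<le> 2 * (D + 1)" using ex_power_2_between by blast
  have "ln (real D + 2) \<ge> ln 2" by simp
  \<comment> \<open>Counting costs only O(log D) operations. The factor 2 ln(D + 2), at least 1,
    weakens this to the squared bound and turns the 6 of \<open>length_bound\<close> into 12; 18000
    is 1500 * 12.\<close>
  then have "1 \<le> 2 * ln (real D + 2)" using ln_2_ge by linarith
  then have "ln (real D + 2) * 1 \<le> ln (real D + 2) * (2 * ln (real D + 2))"
    by (intro mult_left_mono) auto
  then have "6 * ln (real D + 2) \<le> 12 * (ln (real D + 2))\<^sup>2" by (simp add: power2_eq_square)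
  with length_bound[OF l(2)] have "real (l + 1) \<le> 12 * (ln (real D + 2))\<^sup>2" by linarith
  then have cost: "real (1500 * (l + 1)) \<le> 18000 * (ln (real D + 2))\<^sup>2" by simp
  let ?r = "inp (enc t c e @ [a, b, of_bool_real la, of_bool_real rb])"
  have h: "holds_input ?r t c e" "?r 7 = a" "?r 8 = b" "?r 9 = of_bool_real la"
    "?r 10 = of_bool_real rb"
    by (simp_all add: holds_input_def inp_def enc_def)
  have "computes_within (cc count_interval 0) (enc t c e @ [a, b, of_bool_real la, of_bool_real rb])
    (18000 * (ln (real D + 2))\<^sup>2)
    (\<lambda>r. r 0 = real (card {x \<in> bint a b la rb. poly (spoly t c e) x = 0}))"
    by (rule computes_within_cc[OF spec_count_interval[OF h(1) v _ h(2-)] _ cost])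
      (use l in \<open>simp_all add: D_def cvars_programs T_def\<close>)
  then show "let f = spoly t c e; D = real (degree f) in
    computes_within (cc count_interval 0) (enc t c e @ [a, b, of_bool_real la, of_bool_real rb])
      (18000 * (ln (D + 2))\<^sup>2)
      (\<lambda>r. r 0 = real (card {x \<in> bint a b la rb. poly f x = 0}))"
    by (simp add: D_def Let_def)
qed simp_all

end
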